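(* Let $N\ge 11$ and let $f$ satisfy the standing assumptions given in the context. Assume that the finite limits $q_0=\lim_{u\to 0+}f'(u)F(u)$ and $q_\infty=\lim_{u\to\infty}f'(u)F(u)$ exist and that $1<q_0<q_{JL}<q_\infty$. Then there exists $\alpha^*\in(0,\infty)$ such that $u(r,\alpha)$ is stable if $\alpha\in(0,\alpha^*]$ and $u(r,\alpha)$ is unstable if $\alpha>\alpha^*$; moreover, $u(r,\alpha)$ is strictly increasing in $\alpha\in(0,\alpha^* )$ for each fixed $r>0$.
   Context: Standing assumptions on $f:\mathbb{R}\to\mathbb{R}$: $f\in C^2(\mathbb{R}\setminus\{0\})\cap C^1(\mathbb{R})$; $f$ is odd (so $f(0)=0$); and for all $u>0$, $f(u)>0$, $f'(u)>0$, $f''(u)>0$ and $F(u):=\int_u^\infty \frac{ds}{f(s)}<\infty$. $q_{JL}:=\frac{N-2\sqrt{N-1}}{4}$. For $\alpha>0$, $u(r,\alpha)$ denotes the unique solution of $u''+\frac{N-1}{r}u'+f(u)=0$ for $r>0$, $u(0)=\alpha$, $u'(0)=0$. A solution $u\in C^2(\mathbb{R}^N)$ of $\Delta u+f(u)=0$ in $\mathbb{R}^N$ is called stable if $\int_{\mathbb{R}^N}(|\nabla\phi|^2-f'(u)\phi^2)\,dx\ge 0$ for every $\phi\in C^1_0(\mathbb{R}^N)$ ($C^1$ functions with compact support), and unstable if it is not stable. We say $u(r,\alpha)$ is stable (unstable) if $x\mapsto u(|x|,\alpha)$ is. *)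

theory Defs
  imports "HOL-Analysis.Analysis"
begin

definition tail_integral :: "(real \<Rightarrow> real) \<Rightarrow> real \<Rightarrow> real" where
  "tail_integral f u = (LINT s:{u..}|lborel. 1 / f s)"

definition admissible :: "(real \<Rightarrow> real) \<Rightarrow> bool" where
  "admissible f \<longleftrightarrow>
     (\<forall>u. f differentiable at u) \<and> continuous_on UNIV (deriv f) \<and>
     (\<forall>u. u \<noteq> 0 \<longrightarrow> deriv f differentiable at u) \<and>
     continuous_on (UNIV - {0}) (deriv (deriv f)) \<and>
     (\<forall>u. f (- u) = - f u) \<and>
     (\<forall>u>0. f u > 0 \<and> deriv f u > 0 \<and> deriv (deriv f) u > 0 \<and>
            set_integrable lborel {u..} (\<lambda>s. 1 / f s))"

definition q_JL :: "nat \<Rightarrow> real" where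
  "q_JL N = (real N - 2 * sqrt (real N - 1)) / 4"

text \<open>Only the values of \<open>v\<close> on \<open>[0, \<infinity>)\<close> matter; the derivative at 0 is one-sided.\<close>

definition radial_solution :: "nat \<Rightarrow> (real \<Rightarrow> real) \<Rightarrow> real \<Rightarrow> (real \<Rightarrow> real) \<Rightarrow> bool" where
  "radial_solution N f \<alpha> v \<longleftrightarrow>
     v 0 = \<alpha> \<and> (v has_real_derivative 0) (at 0 within {0..}) \<and>
     (\<forall>r>0. v differentiable at r \<and> deriv v differentiable at r \<and>
            deriv (deriv v) r + (real N - 1) / r * deriv v r + f (v r) = 0)"

definition partial_deriv :: "'n::finite \<Rightarrow> (real^'n \<Rightarrow> real) \<Rightarrow> real^'n \<Rightarrow> real" where
  "partial_deriv i U x = frechet_derivative U (at x) (axis i 1)"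

definition grad :: "(real^'n::finite \<Rightarrow> real) \<Rightarrow> real^'n \<Rightarrow> real^'n" where
  "grad U x = (\<chi> i. partial_deriv i U x)"

definition laplacian :: "(real^'n::finite \<Rightarrow> real) \<Rightarrow> real^'n \<Rightarrow> real" where
  "laplacian U x = (\<Sum>i\<in>UNIV. partial_deriv i (partial_deriv i U) x)"

definition C1_fun :: "(real^'n::finite \<Rightarrow> real) \<Rightarrow> bool" where
  "C1_fun U \<longleftrightarrow> (\<forall>x. U differentiable at x) \<and> (\<forall>i. continuous_on UNIV (partial_deriv i U))"

definition C2_fun :: "(real^'n::finite \<Rightarrow> real) \<Rightarrow> bool" where
  "C2_fun U \<longleftrightarrow> C1_fun U \<and> (\<forall>i. C1_fun (partial_deriv i U))"

definition C1_compact_support :: "(real^'n::finite \<Rightarrow> real) \<Rightarrow> bool" where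
  "C1_compact_support \<phi> \<longleftrightarrow> C1_fun \<phi> \<and> compact (closure {x. \<phi> x \<noteq> 0})"

definition classical_solution :: "(real \<Rightarrow> real) \<Rightarrow> (real^'n::finite \<Rightarrow> real) \<Rightarrow> bool" where
  "classical_solution f U \<longleftrightarrow> C2_fun U \<and> (\<forall>x. laplacian U x + f (U x) = 0)"

text \<open>Stability and instability are notions for classical solutions only, so both
  predicates include being one.\<close>

definition stable_solution :: "(real \<Rightarrow> real) \<Rightarrow> (real^'n::finite \<Rightarrow> real) \<Rightarrow> bool" where
  "stable_solution f U \<longleftrightarrow> classical_solution f U \<and>
     (\<forall>\<phi>. C1_compact_support \<phi> \<longrightarrow>
        (LINT x|lborel. (norm (grad \<phi> x))\<^sup>2 - deriv f (U x) * (\<phi> x)\<^sup>2) \<ge> 0)"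

definition unstable_solution :: "(real \<Rightarrow> real) \<Rightarrow> (real^'n::finite \<Rightarrow> real) \<Rightarrow> bool" where
  "unstable_solution f U \<longleftrightarrow> classical_solution f U \<and> \<not> stable_solution f U"

end

theory Submission
  imports Defs
begin

text \<open>
  If \<open>u(\<cdot>,\<beta>)\<close> is stable and \<open>\<alpha> < \<beta>\<close>, convexity of \<open>f\<close> makes \<open>u(\<cdot>,\<beta>) - u(\<cdot>,\<alpha>)\<close> a subsolution of the
  linearisation at \<open>u(\<cdot>,\<beta>)\<close>; a first zero of it would give a test function with negative energy. Hence
  \<open>0 < u(\<cdot>,\<alpha>) < u(\<cdot>,\<beta>)\<close>, so that stability passes down to \<open>\<alpha>\<close>, and by continuous dependence the set of stable
  parameters is an interval that contains its supremum.

  For small \<open>\<alpha>\<close> put \<open>y = F(u)\<close>. As \<open>f'F\<close> is close to \<open>q\<^sub>0 < q\<^sub>J\<^sub>L\<close> along the solution, \<open>y - c r\<^sup>2\<close>, with \<open>c r\<^sup>2\<close> the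
  singular solution for a slightly smaller exponent, satisfies an Euler inequality with real negative
  exponents and stays nonnegative. This bounds \<open>f'(u) = f'F(u) / y\<close> by a Hardy potential \<open>C / r\<^sup>2\<close>, \<open>C < (N-2)\<^sup>2 / 4\<close>.

  If all solutions were stable, the test functions \<open>u\<^sub>r \<eta>\<close> with \<open>\<eta>\<close> close to \<open>r\<^sup>-\<^sup>a\<close>, \<open>a = sqrt (N-1)\<close>, would bound the
  decay of \<open>u\<^sub>r\<close> from below. For large \<open>\<alpha>\<close> this contradicts the upper bound coming from \<open>f'F \<ge> q > q\<^sub>J\<^sub>L\<close>,
  which is available on a fixed ball because \<open>u(r,\<alpha>)\<close> increases with \<open>\<alpha>\<close>.
\<close>

section \<open>Gradients and the divergence theorem\<close>

text \<open>The number \<open>q_JL\<close> enters through one factorisation: with a = sqrt (N-1),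
  (N-2)^2 / 4 - q (2N - 4q) = (N - 2a - 4q) (N + 2a - 4q) / 4. Its positivity for q <
  \<open>q_JL\<close> = (N - 2a) / 4 says two things at once: the Euler exponents are real, and q
  (2N - 4q), the size of f'(u) r^2 along the singular solution, lies below the Hardy constant. With
  complex exponents an Euler inequality would not exclude sign changes. On the unstable side the
  same a governs the scales: stability bounds f(\<alpha>)^2 F(\<alpha>)^(2 q_JL) by a multiple of
  the squared slope at a fixed radius, hence by a multiple of f(\<alpha>)^2 F(\<alpha>)^(2q) with q
  > \<open>q_JL\<close>, while F(\<alpha>) tends to 0. Two obstacles shape the details. As f is odd,
  it is convex only on the positive half-line, and solutions are not known to stay there; positivity
  has to be obtained together with each comparison. Moreover test functions must be C^1, so positive
  parts, cut-offs and powers of r are replaced by C^1 versions whose errors are carried through the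
  estimates.\<close>

definition has_grad :: "(real^'n::finite \<Rightarrow> real) \<Rightarrow> (real^'n \<Rightarrow> real^'n) \<Rightarrow> bool" where
  "has_grad h H \<longleftrightarrow> (\<forall>x. (h has_derivative (\<lambda>v. H x \<bullet> v)) (at x)) \<and> continuous_on UNIV H"

lemma has_gradI:
  assumes "\<And>x. (h has_derivative (\<lambda>v. H x \<bullet> v)) (at x)" and "continuous_on UNIV H"
  shows "has_grad h H"
  using assms by (simp add: has_grad_def)

lemma has_grad_has_derivative: "has_grad h H \<Longrightarrow> (h has_derivative (\<lambda>v. H x \<bullet> v)) (at x)"
  by (simp add: has_grad_def)

lemma has_grad_continuous_gradient: "has_grad h H \<Longrightarrow> continuous_on UNIV H"
  by (simp add: has_grad_def)

lemma has_grad_continuous: "has_grad h H \<Longrightarrow> continuous_on UNIV h"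
  by (meson continuous_at_imp_continuous_on has_derivative_continuous has_grad_has_derivative)

lemma has_grad_partial_deriv:
  assumes "has_grad h H"
  shows "partial_deriv i h = (\<lambda>x. H x $ i)"
proof
  fix x
  have "frechet_derivative h (at x) = (\<lambda>v. H x \<bullet> v)"
    using has_grad_has_derivative[OF assms] frechet_derivative_at by metis
  then show "partial_deriv i h x = H x $ i"
    by (simp add: partial_deriv_def inner_axis)
qed

lemma has_grad_grad: "has_grad h H \<Longrightarrow> grad h = H"
  by (auto simp: grad_def has_grad_partial_deriv vec_eq_iff)

lemma has_grad_C1:
  assumes "has_grad h H" shows "C1_fun h"
  unfolding C1_fun_def has_grad_partial_deriv[OF assms]
  using assms by (auto simp: has_grad_def differentiable_def intro!: continuous_intros)

lemma C1_has_grad: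
  assumes "C1_fun h" shows "has_grad h (grad h)"
proof (rule has_gradI)
  fix x
  have d: "(h has_derivative frechet_derivative h (at x)) (at x)"
    using assms by (simp add: C1_fun_def frechet_derivative_works)
  then interpret linear "frechet_derivative h (at x)"
    by (simp add: has_derivative_linear)
  have "frechet_derivative h (at x) v = grad h x \<bullet> v" for v
  proof -
    have "frechet_derivative h (at x) v = frechet_derivative h (at x) (\<Sum>i\<in>UNIV. v $ i *\<^sub>R axis i 1)"
      by (simp add: basis_expansion flip: scalar_mult_eq_scaleR)
    also have "\<dots> = (\<Sum>i\<in>UNIV. v $ i * frechet_derivative h (at x) (axis i 1))"
      by (simp add: sum scale)
    finally show ?thesis
      by (simp add: grad_def partial_deriv_def inner_vec_def mult.commute)
  qed
  then have "frechet_derivative h (at x) = (\<lambda>v. grad h x \<bullet> v)" by auto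
  with d show "(h has_derivative (\<lambda>v. grad h x \<bullet> v)) (at x)" by simp
next
  show "continuous_on UNIV (grad h)"
    unfolding grad_def using assms by (auto simp: C1_fun_def intro!: continuous_intros)
qed

lemma has_grad_mult:
  assumes "has_grad h H" "has_grad k K"
  shows "has_grad (\<lambda>x. h x * k x) (\<lambda>x. h x *\<^sub>R K x + k x *\<^sub>R H x)"
proof (rule has_gradI)
  fix x
  show "((\<lambda>x. h x * k x) has_derivative (\<lambda>v. (h x *\<^sub>R K x + k x *\<^sub>R H x) \<bullet> v)) (at x)"
    by (rule has_derivative_eq_rhs[OF has_derivative_mult[OF has_grad_has_derivative[OF assms(1)] has_grad_has_derivative[OF assms(2)]]])
      (auto simp: inner_add_left)
qed (use assms has_grad_continuous in \<open>auto simp: has_grad_def intro!: continuous_intros\<close>)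

lemma has_grad_add:
  assumes "has_grad h H" "has_grad k K"
  shows "has_grad (\<lambda>x. h x + k x) (\<lambda>x. H x + K x)"
  using assms by (auto simp: has_grad_def inner_add_left intro!: continuous_intros derivative_intros)

lemma has_grad_diff:
  assumes "has_grad h H" "has_grad k K"
  shows "has_grad (\<lambda>x. h x - k x) (\<lambda>x. H x - K x)"
  using assms by (auto simp: has_grad_def inner_diff_left intro!: continuous_intros derivative_intros)

lemma has_grad_cmult:
  assumes "has_grad h H"
  shows "has_grad (\<lambda>x. c * h x) (\<lambda>x. c *\<^sub>R H x)"
  using assms by (auto simp: has_grad_def intro!: continuous_intros derivative_intros)

lemma has_grad_compose:
  fixes k k' :: "real \<Rightarrow> real"
  assumes "has_grad h H" and "\<And>x. (k has_real_derivative k' (h x)) (at (h x))"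
    and "continuous_on UNIV (\<lambda>x. k' (h x))"
  shows "has_grad (\<lambda>x. k (h x)) (\<lambda>x. k' (h x) *\<^sub>R H x)"
proof (rule has_gradI)
  fix x
  show "((\<lambda>x. k (h x)) has_derivative (\<lambda>v. (k' (h x) *\<^sub>R H x) \<bullet> v)) (at x)"
    by (rule has_derivative_eq_rhs[OF has_derivative_compose[OF has_grad_has_derivative[OF assms(1)]
        assms(2)[unfolded has_field_derivative_def]]]) auto
qed (use assms in \<open>auto simp: has_grad_def intro!: continuous_intros\<close>)

lemma has_grad_inner_self: "has_grad (\<lambda>x::real^'n::finite. x \<bullet> x) (\<lambda>x. 2 *\<^sub>R x)"
  by (auto simp: has_grad_def inner_commute intro!: continuous_intros derivative_eq_intros)

lemma has_grad_nth: "has_grad (\<lambda>x::real^'n::finite. x $ i) (\<lambda>x. axis i 1)"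
  by (auto simp: has_grad_def inner_axis' intro!: bounded_linear_imp_has_derivative bounded_linear_vec_nth)

text \<open>Being C^1 is a local property. This glues a truncated function inside a ball to zero
  outside it.\<close>

lemma has_grad_local:
  assumes "\<And>x. \<exists>S k K. open S \<and> x \<in> S \<and> has_grad k K \<and> (\<forall>y\<in>S. h y = k y \<and> H y = K y)"
  shows "has_grad h H"
proof (rule has_gradI)
  fix x
  obtain S k K where S: "open S" "x \<in> S" "has_grad k K" "\<forall>y\<in>S. h y = k y \<and> H y = K y"
    using assms by blast
  have "(h has_derivative (\<lambda>v. K x \<bullet> v)) (at x)"
    by (rule has_derivative_transform_within_open[OF has_grad_has_derivative[OF S(3)] S(1,2)]) (use S in auto)
  then show "(h has_derivative (\<lambda>v. H x \<bullet> v)) (at x)" using S by simp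
next
  have "isCont H x" for x
  proof -
    obtain S k K where S: "open S" "x \<in> S" "has_grad k K" "\<forall>y\<in>S. h y = k y \<and> H y = K y"
      using assms by blast
    have "isCont K x"
      using has_grad_continuous_gradient[OF S(3)] by (simp add: continuous_on_eq_continuous_at)
    moreover have "eventually (\<lambda>y. H y = K y) (nhds x)"
      using S by (auto simp: eventually_nhds)
    ultimately show ?thesis by (simp add: isCont_cong)
  qed
  then show "continuous_on UNIV H" by (simp add: continuous_at_imp_continuous_on)
qed

lemma has_grad_zero_outside:
  assumes "has_grad h H" "\<And>x. norm x > R \<Longrightarrow> h x = 0" "norm x > R"
  shows "H x = 0"
proof -
  have "(h has_derivative (\<lambda>v. 0)) (at x)"
    by (rule has_derivative_transform_within_open[where s="- cball 0 R" and f="\<lambda>_. 0"])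
      (use assms in \<open>auto simp: dist_norm\<close>)
  moreover have "(h has_derivative (\<lambda>v. H x \<bullet> v)) (at x)"
    using assms by (simp add: has_grad_def)
  ultimately have "(\<lambda>v. H x \<bullet> v) = (\<lambda>v. 0)" by (rule has_derivative_unique[symmetric])
  then have "H x \<bullet> H x = 0" by meson
  then show ?thesis by simp
qed

lemma C1_compact_support_iff:
  "C1_compact_support \<phi> \<longleftrightarrow> has_grad \<phi> (grad \<phi>) \<and> (\<exists>R. \<forall>x. norm x > R \<longrightarrow> \<phi> x = 0)" (is "?l \<longleftrightarrow> ?r")
proof
  assume ?l
  then have "bounded {x. \<phi> x \<noteq> 0}"
    unfolding C1_compact_support_def by (meson bounded_subset closure_subset compact_imp_bounded)
  then obtain R where "\<forall>x\<in>{x. \<phi> x \<noteq> 0}. norm x \<le> R" by (auto simp: bounded_iff)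
  then have "\<forall>x. norm x > R \<longrightarrow> \<phi> x = 0" by force
  with \<open>?l\<close> show ?r by (auto simp: C1_compact_support_def C1_has_grad)
next
  assume ?r
  then obtain R where R: "\<And>x. norm x > R \<Longrightarrow> \<phi> x = 0" by auto
  have "bounded {x. \<phi> x \<noteq> 0}"
    unfolding bounded_iff using R by (intro exI[of _ R]) (auto simp: not_less[symmetric])
  with \<open>?r\<close> show ?l by (auto simp: C1_compact_support_def has_grad_C1)
qed

lemma C1_compact_supportI:
  assumes "has_grad \<phi> G" "\<And>x. norm x > R \<Longrightarrow> \<phi> x = 0"
  shows "C1_compact_support \<phi>"
  using assms has_grad_grad[OF assms(1)] by (auto simp: C1_compact_support_iff)

lemma integrable_continuous_compact_support:
  fixes h :: "real^'n::finite \<Rightarrow> real"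
  assumes "continuous_on UNIV h" "\<And>x. norm x > R \<Longrightarrow> h x = 0"
  shows "integrable lborel h"
proof -
  have "integrable lborel (\<lambda>x. indicator (cball 0 R) x *\<^sub>R h x)"
    by (rule borel_integrable_compact) (use assms in \<open>auto intro: continuous_on_subset\<close>)
  moreover have "(\<lambda>x. indicator (cball 0 R) x *\<^sub>R h x) = h"
    using assms(2) by (force simp: indicator_def)
  ultimately show ?thesis by simp
qed

text \<open>By translation invariance the difference quotients of \<open>h\<close> in direction \<open>axis i 1\<close> have integral 0.\<close>

lemma integral_partial_deriv_zero:
  fixes h :: "real^'n::finite \<Rightarrow> real"
  assumes hg: "has_grad h H" and supp: "\<And>x. norm x > R \<Longrightarrow> h x = 0"
  shows "(LINT x|lborel. H x $ i) = 0"
proof -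
  let ?e = "axis i 1 :: real^'n"
  define q where "q = (\<lambda>n x. real (Suc n) * (h (x + (1 / real (Suc n)) *\<^sub>R ?e) - h x))"
  have Hc: "continuous_on UNIV H" and hc: "continuous_on UNIV h"
    using hg has_grad_continuous by (auto simp: has_grad_def)
  have H0: "H x = 0" if "norm x > R" for x
    using has_grad_zero_outside[OF hg supp that] by simp
  have "compact (H ` cball 0 R)"
    by (intro compact_continuous_image) (use Hc continuous_on_subset in auto)
  from compact_imp_bounded[OF this] obtain B0 where B0: "\<And>x. x \<in> cball 0 R \<Longrightarrow> norm (H x) \<le> B0"
    unfolding bounded_iff by blast
  define B where "B = max B0 0"
  have B: "norm (H x) \<le> B" for x
    using B0[of x] H0[of x] by (cases "norm x > R") (auto simp: B_def)
  have lip: "\<bar>h y - h x\<bar> \<le> B * norm (y - x)" for x y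
  proof -
    have "norm (h y - h x) \<le> B * norm (y - x)"
    proof (rule differentiable_bound[where S=UNIV and f'="\<lambda>x v. H x \<bullet> v"])
      fix x show "onorm (\<lambda>v. H x \<bullet> v) \<le> B"
      proof (rule onorm_bound)
        fix v
        have "norm (H x \<bullet> v) \<le> norm (H x) * norm v"
          by (simp add: Cauchy_Schwarz_ineq2)
        also have "\<dots> \<le> B * norm v" by (rule mult_right_mono[OF B]) simp
        finally show "norm (H x \<bullet> v) \<le> B * norm v" .
      qed (simp add: B_def)
    qed (use hg in \<open>auto simp: has_grad_def\<close>)
    then show ?thesis by simp
  qed
  have q_int: "integrable lborel (q n) \<and> integral\<^sup>L lborel (q n) = 0" for n
  proof -
    let ?c = "(1 / real (Suc n)) *\<^sub>R ?e"
    have i1: "integrable lborel h"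
      using integrable_continuous_compact_support[OF hc supp] by simp
    have i2: "integrable lborel (\<lambda>x. h (x + ?c))"
    proof (rule integrable_continuous_compact_support[where R="R + norm ?c"])
      show "continuous_on UNIV (\<lambda>x. h (x + ?c))"
        by (rule continuous_on_compose2[OF hc]) (auto intro!: continuous_intros)
      fix x :: "real^'n" assume "norm x > R + norm ?c"
      moreover have "norm x \<le> norm (x + ?c) + norm ?c"
        using norm_triangle_ineq4[of "x + ?c" ?c] by simp
      ultimately show "h (x + ?c) = 0" using supp by simp
    qed
    have "integral\<^sup>L lborel h = integral\<^sup>L (distr lborel borel ((+) ?c)) h"
      by (simp add: lborel_distr_plus)
    also have "\<dots> = (LINT x|lborel. h (?c + x))"
      by (rule integral_distr) (use hc in \<open>auto intro!: borel_measurable_continuous_onI\<close>)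
    finally have "(LINT x|lborel. h (x + ?c)) = integral\<^sup>L lborel h"
      by (simp add: add.commute)
    with i1 i2 show ?thesis unfolding q_def by (simp del: of_nat_Suc)
  qed
  have "(\<lambda>n. integral\<^sup>L lborel (q n)) \<longlonglongrightarrow> (LINT x|lborel. H x $ i)"
  \<comment> \<open>The increments 1 / (n + 1) are at most 1, so every quotient lives in the ball of
    radius R + 1 and is bounded there by the Lipschitz constant \<open>B\<close>.\<close>
  proof (rule integral_dominated_convergence[where w="\<lambda>x. B * indicator (cball 0 (R + 1)) x"])
    show "(\<lambda>x. H x $ i) \<in> borel_measurable lborel"
      using Hc by (auto intro!: borel_measurable_continuous_onI continuous_intros)
    show "q n \<in> borel_measurable lborel" for n
      using q_int[of n] by auto
    show "integrable lborel (\<lambda>x. B * indicator (cball (0::real^'n) (R + 1)) x :: real)"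
      using emeasure_bounded_finite[of "cball (0::real^'n) (R+1)"]
      by (intro integrable_mult_right integrable_real_indicator) auto
    show "AE x in lborel. (\<lambda>n. q n x) \<longlonglongrightarrow> H x $ i"
    proof (rule AE_I2)
      fix x
      have "((\<lambda>t. h (x + t *\<^sub>R ?e)) has_derivative (\<lambda>t. H (x + 0 *\<^sub>R ?e) \<bullet> (t *\<^sub>R ?e))) (at 0)"
        by (rule has_derivative_compose[of "\<lambda>t. x + t *\<^sub>R ?e" _ _ _ h])
          (use hg in \<open>auto simp: has_grad_def intro!: derivative_eq_intros\<close>)
      then have "((\<lambda>t. h (x + t *\<^sub>R ?e)) has_real_derivative (H x $ i)) (at 0)"
        by (simp add: has_field_derivative_def inner_axis mult.commute[of _ "H x $ i"])
      then have "((\<lambda>t. (h (x + t *\<^sub>R ?e) - h x) / t) \<longlongrightarrow> H x $ i) (at 0)"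
        by (simp add: DERIV_def)
      moreover have "filterlim (\<lambda>n. 1 / real (Suc n)) (at 0) sequentially"
        unfolding filterlim_at using LIMSEQ_inverse_real_of_nat by (auto simp: divide_inverse simp del: of_nat_Suc)
      ultimately have "(\<lambda>n. (h (x + (1 / real (Suc n)) *\<^sub>R ?e) - h x) / (1 / real (Suc n))) \<longlonglongrightarrow> H x $ i"
        by (rule filterlim_compose)
      then show "(\<lambda>n. q n x) \<longlonglongrightarrow> H x $ i"
        by (simp add: q_def mult.commute del: of_nat_Suc)
    qed
    show "AE x in lborel. norm (q n x) \<le> B * indicator (cball 0 (R + 1)) x" for n
    proof (rule AE_I2)
      fix x
      let ?c = "(1 / real (Suc n)) *\<^sub>R ?e"
      have nc: "norm ?c = 1 / real (Suc n)" by simp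
      show "norm (q n x) \<le> B * indicator (cball 0 (R + 1)) x"
      proof (cases "norm x \<le> R + 1")
        case True
        have "\<bar>h (x + ?c) - h x\<bar> \<le> B * (1 / real (Suc n))"
          using lip[of "x + ?c" x] nc by simp
        then have "norm (q n x) \<le> B"
          unfolding q_def real_norm_def abs_mult by (simp add: field_simps del: of_nat_Suc right_diff_distrib left_diff_distrib)
        with True show ?thesis by simp
      next
        case False
        have "norm x \<le> norm (x + ?c) + norm ?c"
          using norm_triangle_ineq4[of "x + ?c" ?c] by simp
        moreover have "norm ?c \<le> 1" unfolding nc by (simp add: field_simps)
        ultimately have "norm (x + ?c) > R" "norm x > R" using False by linarith+
        then show ?thesis using supp by (simp add: q_def B_def)
      qed
    qed
  qed
  then have "(\<lambda>n. 0) \<longlonglongrightarrow> (LINT x|lborel. H x $ i)" using q_int by simp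
  then show ?thesis by (simp add: LIMSEQ_const_iff)
qed

text \<open>The source of all integrations by parts in space: the fields have compact support, so
  boundary terms never arise.\<close>

lemma integral_divergence_zero:
  fixes V :: "'n::finite \<Rightarrow> real^'n \<Rightarrow> real"
  assumes hg: "\<And>i. has_grad (V i) (D i)" and supp: "\<And>i x. norm x > R \<Longrightarrow> V i x = 0"
  shows "integrable lborel (\<lambda>x. \<Sum>i\<in>UNIV. D i x $ i)" "(LINT x|lborel. (\<Sum>i\<in>UNIV. D i x $ i)) = 0"
proof -
  have "integrable lborel (\<lambda>x. D i x $ i)" for i
  proof (rule integrable_continuous_compact_support)
    show "continuous_on UNIV (\<lambda>x. D i x $ i)"
      using hg[of i] by (auto simp: has_grad_def intro!: continuous_intros)
    show "D i x $ i = 0" if "norm x > R" for x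
      using has_grad_zero_outside[OF hg supp that] by simp
  qed
  then show "integrable lborel (\<lambda>x. \<Sum>i\<in>UNIV. D i x $ i)" "(LINT x|lborel. (\<Sum>i\<in>UNIV. D i x $ i)) = 0"
    using integral_partial_deriv_zero[OF hg supp] by auto
qed

section \<open>Radial solutions\<close>

text \<open>A radial solution \<open>v\<close> is handled through \<open>g = v' / r\<close>, which extends continuously to the
  origin; then \<open>x \<mapsto> v (norm x)\<close> has the gradient \<open>g (norm x) *\<^sub>R x\<close>.\<close>

definition radial_profile :: "real \<Rightarrow> (real \<Rightarrow> real) \<Rightarrow> (real \<Rightarrow> real) \<Rightarrow> (real \<Rightarrow> real) \<Rightarrow> bool" where
  "radial_profile N f v g \<longleftrightarrow>
     (v has_real_derivative 0) (at 0 within {0..}) \<and>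
     (\<forall>r>0. (v has_real_derivative r * g r) (at r)) \<and>
     (\<forall>r>0. (g has_real_derivative - (N * g r + f (v r)) / r) (at r)) \<and>
     continuous_on {0..} v \<and> continuous_on {0..} g \<and> g 0 = - f (v 0) / N"

text \<open>Integrates the derivative bound from a point near 0. Smallness of \<open>m\<close> is
  required only at some points arbitrarily near 0, because for m = r^n g = r^(n-1) v' the mean value
  theorem applied to \<open>v\<close> yields no more than that.\<close>

lemma lower_bound_of_derivative_bound:
  fixes m d :: "real \<Rightarrow> real"
  assumes "n > 0"
    and der: "\<And>r. 0 < r \<Longrightarrow> (m has_real_derivative d r) (at r)"
    and d: "\<And>r. 0 < r \<Longrightarrow> r \<le> \<delta> \<Longrightarrow> d r \<ge> - K * r ^ (n - 1)"
    and small: "\<And>e \<delta>. e > 0 \<Longrightarrow> \<delta> > 0 \<Longrightarrow> \<exists>\<xi>. 0 < \<xi> \<and> \<xi> < \<delta> \<and> \<bar>m \<xi>\<bar> < e"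
    and r: "0 < r" "r \<le> \<delta>"
  shows "m r \<ge> - K * r ^ n / n"
proof (rule field_le_epsilon)
  fix e :: real assume e: "e > 0"
  \<comment> \<open>The bound 1 gives \<xi>^n \<le> \<xi>, and the last term then makes |K| \<xi>^n
    / n at most e / 2.\<close>
  define \<delta>' where "\<delta>' = min r (min 1 (e / (2 * (\<bar>K\<bar> + 1))))"
  have "\<delta>' > 0" using r e by (simp add: \<delta>'_def)
  then obtain \<xi> where \<xi>: "0 < \<xi>" "\<xi> < \<delta>'" "\<bar>m \<xi>\<bar> < e / 2" using small[of "e/2" \<delta>'] e by auto
  have "m \<xi> + K * \<xi> ^ n / n \<le> m r + K * r ^ n / n"
  proof (rule DERIV_nonneg_imp_nondecreasing[where f="\<lambda>x. m x + K * x ^ n / n"])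
    show "\<xi> \<le> r" using \<xi> by (simp add: \<delta>'_def)
    fix x assume x: "\<xi> \<le> x" "x \<le> r"
    then have "x > 0" using \<xi> by simp
    have "((\<lambda>x. m x + K * x ^ n / n) has_real_derivative d x + K * x ^ (n - 1)) (at x)"
      by (rule derivative_eq_intros der \<open>x > 0\<close> refl)+ (use \<open>n > 0\<close> in auto)
    moreover have "d x + K * x ^ (n - 1) \<ge> 0" using d[of x] x \<open>x > 0\<close> r by simp
    ultimately show "\<exists>y. ((\<lambda>x. m x + K * x ^ n / n) has_real_derivative y) (at x) \<and> 0 \<le> y" by blast
  qed
  moreover have "\<bar>K * \<xi> ^ n / n\<bar> \<le> e / 2"
  proof -
    have "\<xi> ^ n \<le> \<xi>" using \<xi> \<open>n > 0\<close> power_decreasing[of 1 n \<xi>] by (simp add: \<delta>'_def)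
    moreover have "\<xi> ^ n / n \<le> \<xi> ^ n / 1" using \<open>n > 0\<close> \<xi> by (intro divide_left_mono) auto
    ultimately have "\<xi> ^ n / n \<le> \<xi>" by simp
    then have "\<bar>K\<bar> * (\<xi> ^ n / n) \<le> \<bar>K\<bar> * \<xi>" by (rule mult_left_mono) simp
    also have "\<dots> \<le> (\<bar>K\<bar> + 1) * (e / (2 * (\<bar>K\<bar> + 1)))"
      by (rule mult_mono) (use \<xi> in \<open>auto simp: \<delta>'_def\<close>)
    also have "\<dots> = e / 2"
      by (metis abs_add_one_gt_zero add.commute less_irrefl nonzero_mult_divide_mult_cancel_left mult.commute times_divide_eq_right)
    finally show ?thesis using \<xi> by (simp add: abs_mult)
  qed
  ultimately show "- K * r ^ n / n \<le> m r + e" using \<xi> by (auto simp: abs_if split: if_splits)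
qed

text \<open>The difficulty is the origin, where only a one-sided derivative of \<open>v\<close> is
  given. Writing the equation as (r^n g)' = - r^(n-1) f(v) and integrating from points where r^n g
  is small, with f(v) within e / 2 of f(\<alpha>), pins g (r) to - f(\<alpha>) / n as r tends to
  0.\<close>

lemma radial_solution_profile:
  assumes sol: "radial_solution n f \<alpha> v" and "n > 0" and fc: "continuous_on UNIV f"
  obtains g where "radial_profile (real n) f v g"
proof -
  define g where "g = (\<lambda>r. if r = 0 then - f \<alpha> / n else deriv v r / r)"
  have v0: "v 0 = \<alpha>" and d0: "(v has_real_derivative 0) (at 0 within {0..})"
    using sol by (auto simp: radial_solution_def)
  have dv: "(v has_real_derivative r * g r) (at r)" if "r > 0" for r
    using sol that by (auto simp: radial_solution_def g_def DERIV_deriv_iff_real_differentiable)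
  have dg: "(g has_real_derivative - (n * g r + f (v r)) / r) (at r)" if "r > 0" for r
  proof -
    have d2: "(deriv v has_real_derivative deriv (deriv v) r) (at r)"
      using sol that by (auto simp: radial_solution_def DERIV_deriv_iff_real_differentiable)
    have eq: "deriv (deriv v) r = - (real n - 1) / r * deriv v r - f (v r)"
    proof -
      have "deriv (deriv v) r + (real n - 1) / r * deriv v r + f (v r) = 0"
        using sol that by (simp add: radial_solution_def)
      then show ?thesis by (simp add: eq_neg_iff_add_eq_0 left_diff_distrib diff_divide_distrib)
    qed
    have "((\<lambda>r. deriv v r / r) has_real_derivative - (n * g r + f (v r)) / r) (at r)"
      by (rule derivative_eq_intros d2 refl)+ (use that in \<open>auto simp: eq g_def field_simps\<close>)
    then show ?thesis
      by (rule has_field_derivative_transform_within_open[where S="{0<..}"]) (use that in \<open>auto simp: g_def\<close>)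
  qed
  have vc: "continuous_on {0..} v"
  proof (rule continuous_on_eq_continuous_within[THEN iffD2, rule_format])
    fix r :: real assume "r \<in> {0..}"
    then show "continuous (at r within {0..}) v"
      using DERIV_continuous[OF d0] DERIV_continuous[OF dv[of r]] continuous_at_imp_continuous_at_within
      by (cases "r = 0") auto
  qed
  define m where "m = (\<lambda>r. r ^ n * g r)"
  have dm: "(m has_real_derivative - f (v r) * r ^ (n - 1)) (at r)" if "r > 0" for r
  proof -
    have "r ^ n = r * r ^ (n - 1)" using \<open>n > 0\<close> by (simp add: power_eq_if)
    then show ?thesis unfolding m_def
      by (intro DERIV_mult[OF DERIV_pow dg[OF that], THEN DERIV_cong]) (use that in \<open>auto simp: field_simps\<close>)
  qed
  have small: "\<exists>\<xi>. 0 < \<xi> \<and> \<xi> < \<delta> \<and> \<bar>m \<xi>\<bar> < e" if "e > 0" "\<delta> > 0" for e \<delta>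
  proof -
    have "((\<lambda>r. (v r - v 0) / r) \<longlongrightarrow> 0) (at 0 within {0..})"
      using d0 by (simp add: has_field_derivative_iff)
    then have "\<forall>\<^sub>F r in at 0 within {0..}. \<bar>(v r - v 0) / r\<bar> < e"
      using that(1) by (auto simp: tendsto_iff dist_real_def)
    then obtain d where d: "d > 0" "\<And>r. 0 < r \<Longrightarrow> r < d \<Longrightarrow> \<bar>(v r - v 0) / r\<bar> < e"
      by (auto simp: eventually_at dist_real_def)
    define r where "r = min (min d \<delta>) 1 / 2"
    have r: "0 < r" "r < d" "r < \<delta>" "r < 1" using d that by (auto simp: r_def)
    have "\<exists>l z. 0 < z \<and> z < r \<and> (v has_real_derivative l) (at z) \<and> v r - v 0 = (r - 0) * l"
    proof (rule MVT)
      show "continuous_on {0..r} v" using vc by (rule continuous_on_subset) auto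
    qed (use r dv real_differentiable_def in auto)
    then obtain l z where z: "0 < z" "z < r" "(v has_real_derivative l) (at z)" "v r - v 0 = r * l" by auto
    then have "l = z * g z" using dv DERIV_unique by blast
    then have ze: "\<bar>z * g z\<bar> < e" using d(2)[of r] r z by simp
    have "z ^ n = z ^ (n - 1) * z" using \<open>n > 0\<close> by (simp add: power_eq_if)
    then have "\<bar>m z\<bar> = z ^ (n - 1) * \<bar>z * g z\<bar>"
      using z by (simp add: m_def abs_mult)
    also have "\<dots> \<le> 1 * \<bar>z * g z\<bar>"
      using z r by (intro mult_right_mono power_le_one) auto
    finally have "\<bar>m z\<bar> < e" using ze by simp
    then show ?thesis using z r by (intro exI[of _ z]) auto
  qed
  have lim: "(g \<longlongrightarrow> g 0) (at 0 within {0..})"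
  proof (rule tendstoI)
    fix e :: real assume e: "e > 0"
    have "((\<lambda>r. f (v r)) \<longlongrightarrow> f \<alpha>) (at 0 within {0..})"
      using vc fc v0 by (metis UNIV_I atLeast_iff continuous_on_def isCont_tendsto_compose continuous_on_eq_continuous_at open_UNIV order_refl)
    then have "\<forall>\<^sub>F r in at 0 within {0..}. \<bar>f (v r) - f \<alpha>\<bar> < e / 2"
      using e unfolding tendsto_iff dist_real_def by (meson half_gt_zero)
    then obtain d where d: "d > 0" "\<And>r. 0 < r \<Longrightarrow> r < d \<Longrightarrow> \<bar>f (v r) - f \<alpha>\<bar> < e / 2"
      by (auto simp: eventually_at dist_real_def)
    have "dist (g r) (g 0) < e" if r: "0 < r" "r < d" for r
    proof -
      have "m r \<ge> - (f \<alpha> + e / 2) * r ^ n / n"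
      proof (rule lower_bound_of_derivative_bound[OF \<open>n > 0\<close> dm _ small, where \<delta>=r])
        fix s assume s: "0 < s" "s \<le> r"
        have "- (f \<alpha> + e / 2) \<le> - f (v s)" using d(2)[of s] s r unfolding abs_less_iff by linarith
        then show "- (f \<alpha> + e / 2) * s ^ (n - 1) \<le> - f (v s) * s ^ (n - 1)"
          using s by (intro mult_right_mono) auto
      qed (use r in auto)
      moreover have "- m r \<ge> - (e / 2 - f \<alpha>) * r ^ n / n"
      proof (rule lower_bound_of_derivative_bound[OF \<open>n > 0\<close> DERIV_minus[OF dm], where \<delta>=r])
        fix s assume s: "0 < s" "s \<le> r"
        have "- (e / 2 - f \<alpha>) \<le> f (v s)" using d(2)[of s] s r unfolding abs_less_iff by linarith
        then show "- (e / 2 - f \<alpha>) * s ^ (n - 1) \<le> - (- f (v s) * s ^ (n - 1))"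
          using s by (simp add: mult_right_mono)
      qed (use r small in auto)
      ultimately have le: "- (f \<alpha> + e / 2) / n * r ^ n \<le> g r * r ^ n" "- (e / 2 - f \<alpha>) / n * r ^ n \<le> - g r * r ^ n"
        by (simp_all add: m_def mult.commute)
      have "r ^ n > 0" using r by simp
      with le have "- (f \<alpha> + e / 2) / n \<le> g r" "- (e / 2 - f \<alpha>) / n \<le> - g r"
        by (meson mult_le_cancel_right_pos)+
      then have "\<bar>g r - g 0\<bar> \<le> e / 2 / n"
        unfolding g_def abs_le_iff by (simp add: diff_divide_distrib add_divide_distrib)
      also have "\<dots> \<le> e / 2 / 1" using e \<open>n > 0\<close> by (intro divide_left_mono) auto
      finally show ?thesis using e by (simp add: dist_real_def)
    qed
    then show "\<forall>\<^sub>F r in at 0 within {0..}. dist (g r) (g 0) < e"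
      using d by (auto simp: eventually_at dist_real_def)
  qed
  have gc: "continuous_on {0..} g"
  proof (rule continuous_on_eq_continuous_within[THEN iffD2, rule_format])
    fix r :: real assume "r \<in> {0..}"
    then show "continuous (at r within {0..}) g"
      using lim DERIV_continuous[OF dg[of r]] continuous_at_imp_continuous_at_within
      by (cases "r = 0") (auto simp: continuous_within)
  qed
  have "radial_profile (real n) f v g"
    using d0 dv dg vc gc v0 by (auto simp: radial_profile_def g_def)
  then show thesis by (rule that)
qed

section \<open>Radial functions as C^1 and C^2 functions on the whole space\<close>

lemma has_derivative_norm_inner:
  fixes x :: "real^'n::finite"
  assumes "x \<noteq> 0"
  shows "(norm has_derivative (\<lambda>h. x \<bullet> h / norm x)) (at x)"
  using has_derivative_norm[OF assms] by (simp add: sgn_div_norm divide_inverse mult.commute inner_commute[of _ x])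

lemma continuous_on_radial:
  fixes k :: "real \<Rightarrow> real"
  assumes "continuous_on {0..} k"
  shows "continuous_on UNIV (\<lambda>x::real^'n::finite. k (norm x))"
  by (rule continuous_on_compose2[OF assms]) (auto intro!: continuous_intros)

lemma has_grad_radial:
  fixes w k :: "real \<Rightarrow> real"
  assumes d0: "(w has_real_derivative 0) (at 0 within {0..})"
    and dw: "\<And>r. r > 0 \<Longrightarrow> (w has_real_derivative r * k r) (at r)"
    and kc: "continuous_on {0..} k"
  shows "has_grad (\<lambda>x::real^'n::finite. w (norm x)) (\<lambda>x. k (norm x) *\<^sub>R x)"
proof (rule has_gradI)
  fix x :: "real^'n"
  show "((\<lambda>x. w (norm x)) has_derivative (\<lambda>v. (k (norm x) *\<^sub>R x) \<bullet> v)) (at x)"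
  proof (cases "x = 0")
    case False
    then have "norm x > 0" by simp
    show ?thesis
      by (rule has_derivative_eq_rhs[OF has_derivative_compose[OF has_derivative_norm_inner[OF False]
          dw[OF \<open>norm x > 0\<close>, unfolded has_field_derivative_def]]])
        (use False in auto)
  next
    case True
    have "((\<lambda>r. (w r - w 0) / r) \<longlongrightarrow> 0) (at 0 within {0..})"
      using d0 by (simp add: has_field_derivative_iff)
    moreover have "filterlim norm (at 0 within {0..}) (at (0::real^'n))"
      unfolding filterlim_at by (auto simp: eventually_at_filter intro!: tendsto_norm_zero tendsto_ident_at)
    ultimately have "((\<lambda>y::real^'n. (w (norm y) - w 0) / norm y) \<longlongrightarrow> 0) (at 0)"
      by (rule filterlim_compose)
    then have "((\<lambda>y::real^'n. norm ((w (norm y) - w 0) / norm y)) \<longlongrightarrow> 0) (at 0)"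
      by (rule tendsto_norm_zero)
    then have "((\<lambda>x::real^'n. w (norm x)) has_derivative (\<lambda>v. 0)) (at 0)"
      unfolding has_derivative_at by (simp add: abs_div)
    then show ?thesis using True by simp
  qed
next
  show "continuous_on UNIV (\<lambda>x::real^'n. k (norm x) *\<^sub>R x)"
    using continuous_on_radial[OF kc] by (intro continuous_intros)
qed

text \<open>For a profile, g (|x|) x_i is the i-th partial derivative of v (|x|) and k = r g'. At
  the origin the remainder (g (|x|) - g 0) x_i is o(|x|), and the second gradient term tends to 0
  because k 0 = 0; for a profile this is the condition g 0 = - f (v 0) / N.\<close>

lemma has_grad_radial_times_coordinate:
  fixes g k :: "real \<Rightarrow> real"
  assumes dg: "\<And>r. r > 0 \<Longrightarrow> (g has_real_derivative k r / r) (at r)"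
    and gc: "continuous_on {0..} g" and kc: "continuous_on {0..} k" and k0: "k 0 = 0"
  shows "has_grad (\<lambda>x::real^'n::finite. g (norm x) * x $ i)
     (\<lambda>x. g (norm x) *\<^sub>R axis i 1 + (k (norm x) * x $ i / (norm x)\<^sup>2) *\<^sub>R x)"
proof (rule has_gradI)
  fix x :: "real^'n"
  show "((\<lambda>x. g (norm x) * x $ i) has_derivative (\<lambda>v. (g (norm x) *\<^sub>R axis i 1 + (k (norm x) * x $ i / (norm x)\<^sup>2) *\<^sub>R x) \<bullet> v)) (at x)"
  proof (cases "x = 0")
    case False
    then have "norm x > 0" by simp
    have d1: "((\<lambda>x. g (norm x)) has_derivative (\<lambda>v. k (norm x) / norm x * (x \<bullet> v / norm x))) (at x)"
      by (rule has_derivative_eq_rhs[OF has_derivative_compose[OF has_derivative_norm_inner[OF False]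
          dg[OF \<open>norm x > 0\<close>, unfolded has_field_derivative_def]]]) auto
    have d2: "((\<lambda>x. x $ i) has_derivative (\<lambda>v. axis i 1 \<bullet> v)) (at x)"
      using has_grad_has_derivative[OF has_grad_nth] .
    show ?thesis
      by (rule has_derivative_eq_rhs[OF has_derivative_mult[OF d1 d2]])
        (auto simp: inner_add_left inner_axis' power2_eq_square)
  next
    case True
    have "((\<lambda>y::real^'n. g (norm y) - g 0) \<longlongrightarrow> 0) (at 0)"
      using continuous_on_radial[OF gc, where 'n='n]
      by (auto simp: continuous_on_eq_continuous_at isCont_def LIM_zero_iff dest!: spec[of _ 0])
    then have "((\<lambda>y::real^'n. norm (g (norm y) - g 0)) \<longlongrightarrow> 0) (at 0)"
      by (rule tendsto_norm_zero)
    then have "((\<lambda>y::real^'n. norm (g (norm y) * y $ i - g 0 * y $ i) / norm y) \<longlongrightarrow> 0) (at 0)"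
    proof (rule tendsto_0_le[where K=1])
      show "\<forall>\<^sub>F y in at (0::real^'n). norm (norm (g (norm y) * y $ i - g 0 * y $ i) / norm y) \<le> norm (norm (g (norm y) - g 0)) * 1"
      proof (rule always_eventually, rule allI)
        fix y :: "real^'n"
        have "\<bar>g (norm y) * y $ i - g 0 * y $ i\<bar> = \<bar>g (norm y) - g 0\<bar> * \<bar>y $ i\<bar>"
          by (simp add: abs_mult flip: left_diff_distrib)
        also have "\<dots> \<le> \<bar>g (norm y) - g 0\<bar> * norm y"
          by (intro mult_left_mono component_le_norm_cart) auto
        finally show "norm (norm (g (norm y) * y $ i - g 0 * y $ i) / norm y) \<le> norm (norm (g (norm y) - g 0)) * 1"
          by (auto simp: divide_le_eq)
      qed
    qed
    then have "((\<lambda>x::real^'n. g (norm x) * x $ i) has_derivative (\<lambda>v. g 0 * v $ i)) (at 0)"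
      unfolding has_derivative_at by (simp add: bounded_linear_mult_right bounded_linear_vec_nth bounded_linear_compose[of "(*) (g 0)"])
    then show ?thesis using True by (simp add: inner_axis')
  qed
next
  have gr: "continuous_on UNIV (\<lambda>x::real^'n. g (norm x))" and kr: "continuous_on UNIV (\<lambda>x::real^'n. k (norm x))"
    using continuous_on_radial gc kc by auto
  have "isCont (\<lambda>x::real^'n. (k (norm x) * x $ i / (norm x)\<^sup>2) *\<^sub>R x) x" for x
  proof (cases "x = 0")
    case False
    then show ?thesis using kr by (auto simp: continuous_on_eq_continuous_at intro!: continuous_intros)
  next
    case True
    have "((\<lambda>y::real^'n. k (norm y)) \<longlongrightarrow> 0) (at 0)"
      using kr k0 by (auto simp: continuous_on_eq_continuous_at isCont_def dest!: spec[of _ 0])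
    then have "((\<lambda>x::real^'n. (k (norm x) * x $ i / (norm x)\<^sup>2) *\<^sub>R x) \<longlongrightarrow> 0) (at 0)"
    proof (rule tendsto_0_le[where K=1])
      show "\<forall>\<^sub>F y in at (0::real^'n). norm ((k (norm y) * y $ i / (norm y)\<^sup>2) *\<^sub>R y) \<le> norm (k (norm y)) * 1"
      proof (rule always_eventually, rule allI)
        fix y :: "real^'n"
        have "\<bar>k (norm y)\<bar> * \<bar>y $ i\<bar> \<le> \<bar>k (norm y)\<bar> * norm y"
          by (intro mult_left_mono component_le_norm_cart) auto
        then show "norm ((k (norm y) * y $ i / (norm y)\<^sup>2) *\<^sub>R y) \<le> norm (k (norm y)) * 1"
          by (cases "y = 0") (auto simp: abs_mult power2_eq_square field_simps)
      qed
    qed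
    with True show ?thesis by (simp add: isCont_def)
  qed
  then have "continuous_on UNIV (\<lambda>x::real^'n. (k (norm x) * x $ i / (norm x)\<^sup>2) *\<^sub>R x)"
    by (simp add: continuous_at_imp_continuous_on)
  then show "continuous_on UNIV (\<lambda>x::real^'n. g (norm x) *\<^sub>R axis i 1 + (k (norm x) * x $ i / (norm x)\<^sup>2) *\<^sub>R x)"
    by (intro continuous_on_add[OF continuous_on_scaleR[OF gr continuous_on_const]])
qed

lemma radial_profile_has_grad:
  assumes p: "radial_profile N f v g"
  shows "has_grad (\<lambda>x::real^'n::finite. v (norm x)) (\<lambda>x. g (norm x) *\<^sub>R x)"
  using p by (intro has_grad_radial) (auto simp: radial_profile_def)

lemma radial_profile_grad_components:
  assumes p: "radial_profile (real CARD('n)) f v g" and fc: "continuous_on UNIV f"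
  obtains D where "\<And>i::'n::finite. has_grad (\<lambda>x::real^'n. g (norm x) * x $ i) (D i)"
    and "\<And>x. (\<Sum>i\<in>UNIV. D i x $ i) = - f (v (norm x))"
proof -
  let ?N = "real CARD('n)"
  define k where "k = (\<lambda>r. - (?N * g r + f (v r)))"
  define D where "D = (\<lambda>i x::real^'n. g (norm x) *\<^sub>R axis i 1 + (k (norm x) * x $ i / (norm x)\<^sup>2) *\<^sub>R x)"
  have vc: "continuous_on {0..} v" and gc: "continuous_on {0..} g" using p by (auto simp: radial_profile_def)
  have k0: "k 0 = 0" using p by (simp add: k_def radial_profile_def)
  have "has_grad (\<lambda>x::real^'n. g (norm x) * x $ i) (D i)" for i
    unfolding D_def
  proof (rule has_grad_radial_times_coordinate[where g=g and k=k, OF _ gc _ k0])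
    show "continuous_on {0..} k"
      unfolding k_def using vc gc continuous_on_compose2[OF fc vc] by (auto intro!: continuous_intros)
    show "r > 0 \<Longrightarrow> (g has_real_derivative k r / r) (at r)" for r
      using p by (simp add: radial_profile_def k_def)
  qed
  moreover have "(\<Sum>i\<in>UNIV. D i x $ i) = - f (v (norm x))" for x
  proof -
    have "(\<Sum>i\<in>UNIV. D i x $ i) = (\<Sum>i\<in>UNIV. g (norm x) + k (norm x) / (norm x)\<^sup>2 * (x $ i * x $ i))"
      by (intro sum.cong) (auto simp: D_def)
    also have "\<dots> = ?N * g (norm x) + k (norm x) / (norm x)\<^sup>2 * (x \<bullet> x)"
      by (simp add: sum.distrib inner_vec_def sum_distrib_left sum_divide_distrib)
    also have "\<dots> = ?N * g (norm x) + k (norm x)"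
      using k0 by (cases "x = 0") (auto simp: dot_square_norm)
    finally show ?thesis by (simp add: k_def)
  qed
  ultimately show thesis by (rule that)
qed

lemma radial_profile_classical_solution:
  assumes p: "radial_profile (real CARD('n)) f v g" and fc: "continuous_on UNIV f"
  shows "classical_solution f (\<lambda>x::real^'n::finite. v (norm x))"
proof -
  obtain D where D: "\<And>i::'n. has_grad (\<lambda>x::real^'n. g (norm x) * x $ i) (D i)"
    "\<And>x. (\<Sum>i\<in>UNIV. D i x $ i) = - f (v (norm x))"
    using radial_profile_grad_components[OF assms] by blast
  note U = radial_profile_has_grad[OF p, where 'n='n]
  have pd: "partial_deriv i (\<lambda>x::real^'n. v (norm x)) = (\<lambda>x. g (norm x) * x $ i)" for i
    by (simp add: has_grad_partial_deriv[OF U])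
  show ?thesis
    unfolding classical_solution_def C2_fun_def laplacian_def pd has_grad_partial_deriv[OF D(1)]
    using has_grad_C1[OF U] has_grad_C1[OF D(1)] D(2) by auto
qed

section \<open>Monotonicity and continuous dependence of profiles\<close>

lemma positive_profile_nonpos:
  assumes p: "radial_profile (real n) f v g" and "n > 0"
    and f: "\<And>s. s > 0 \<Longrightarrow> f s \<ge> 0" and pos: "\<And>s. 0 \<le> s \<Longrightarrow> s < R \<Longrightarrow> v s > 0" and r: "0 \<le> r" "r < R"
  shows "g r \<le> 0"
proof (cases "r = 0")
  case True
  then show ?thesis using p f[of "v 0"] pos[of 0] r by (auto simp: radial_profile_def divide_nonpos_nonneg)
next
  case False
  have gc: "continuous_on {0..r} g" using p by (auto simp: radial_profile_def intro: continuous_on_subset)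
  have "r ^ n * g r \<le> 0 ^ n * g 0"
  proof (rule DERIV_nonpos_imp_decreasing_open[where f="\<lambda>s. s ^ n * g s"])
    fix s assume s: "0 < s" "s < r"
    have dg: "(g has_real_derivative - (n * g s + f (v s)) / s) (at s)"
      using p s by (simp add: radial_profile_def)
    have "s ^ n = s * s ^ (n - 1)" using \<open>n > 0\<close> by (simp add: power_eq_if)
    then have "((\<lambda>s. s ^ n * g s) has_real_derivative - f (v s) * s ^ (n - 1)) (at s)"
      by (intro DERIV_mult[OF DERIV_pow dg, THEN DERIV_cong]) (use s in \<open>auto simp: field_simps\<close>)
    moreover have "f (v s) \<ge> 0" using f pos s r by simp
    ultimately show "\<exists>y. ((\<lambda>s. s ^ n * g s) has_real_derivative y) (at s) \<and> y \<le> 0"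
      using s by (intro exI[of _ "- f (v s) * s ^ (n - 1)"]) (auto simp: mult_nonneg_nonneg)
  qed (use r gc in \<open>auto intro!: continuous_intros\<close>)
  then have "r ^ n * g r \<le> 0" unfolding zero_power[OF \<open>n > 0\<close>] mult_zero_left .
  moreover have "r ^ n > 0" using r False by simp
  ultimately show ?thesis by (simp only: mult_le_0_iff) auto
qed

lemma positive_profile_antimono:
  assumes p: "radial_profile (real n) f v g" and "n > 0"
    and f: "\<And>s. s > 0 \<Longrightarrow> f s \<ge> 0" and pos: "\<And>s. 0 \<le> s \<Longrightarrow> s < R \<Longrightarrow> v s > 0" and r: "0 \<le> q" "q \<le> r" "r < R"
  shows "v r \<le> v q"
proof (rule DERIV_nonpos_imp_decreasing_open[where f=v])
  fix s assume s: "q < s" "s < r"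
  then have "(v has_real_derivative s * g s) (at s)" using p r by (simp add: radial_profile_def)
  moreover have "g s \<le> 0" using positive_profile_nonpos[OF p \<open>n > 0\<close> f pos] s r by simp
  ultimately show "\<exists>y. (v has_real_derivative y) (at s) \<and> y \<le> 0"
    using s r by (intro exI[of _ "s * g s"]) (auto simp: mult_nonneg_nonpos)
qed (use p r in \<open>auto simp: radial_profile_def intro: continuous_on_subset\<close>)

text \<open>Gronwall for the energy w^2 + w'^2 of the difference, with w' = s \<gamma>. The friction
  term -2 (N-1) w'^2 / s has the good sign, so its singularity at 0 is harmless. The Lipschitz bound
  is needed only along the two solutions.\<close>

lemma radial_profile_dependence:
  assumes p1: "radial_profile N f v1 g1" and p2: "radial_profile N f v2 g2" and "N \<ge> 1" and "L \<ge> 0"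
    and lip: "\<And>s. 0 < s \<Longrightarrow> s < r \<Longrightarrow> \<bar>f (v1 s) - f (v2 s)\<bar> \<le> L * \<bar>v1 s - v2 s\<bar>" and r: "0 \<le> r"
  shows "(v1 r - v2 r)\<^sup>2 \<le> (v1 0 - v2 0)\<^sup>2 * exp ((1 + L) * r)"
proof -
  define w \<gamma> where "w = (\<lambda>s. v1 s - v2 s)" and "\<gamma> = (\<lambda>s. g1 s - g2 s)"
  define E where "E = (\<lambda>s. ((w s)\<^sup>2 + (s * \<gamma> s)\<^sup>2) * exp (- (1 + L) * s))"
  have c: "continuous_on {0..r} w" "continuous_on {0..r} \<gamma>"
    using p1 p2 unfolding w_def \<gamma>_def radial_profile_def
    by (auto intro!: continuous_intros intro: continuous_on_subset)
  have "E r \<le> E 0"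
  proof (rule DERIV_nonpos_imp_decreasing_open[where f=E])
    show "continuous_on {0..r} E" unfolding E_def using c by (intro continuous_intros)
    fix s assume s: "0 < s" "s < r"
    define \<Delta> where "\<Delta> = f (v1 s) - f (v2 s)"
    define e where "e = exp (- (1 + L) * s)"
    have "(v1 has_real_derivative s * g1 s) (at s)" "(v2 has_real_derivative s * g2 s) (at s)"
      using p1 p2 s by (auto simp: radial_profile_def)
    from DERIV_diff[OF this] have dw: "(w has_real_derivative s * \<gamma> s) (at s)"
      by (simp add: w_def \<gamma>_def algebra_simps)
    have "(g1 has_real_derivative - (N * g1 s + f (v1 s)) / s) (at s)" "(g2 has_real_derivative - (N * g2 s + f (v2 s)) / s) (at s)"
      using p1 p2 s by (auto simp: radial_profile_def)
    from DERIV_diff[OF this] have d\<gamma>: "(\<gamma> has_real_derivative - (N * \<gamma> s + \<Delta>) / s) (at s)"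
      unfolding \<gamma>_def \<Delta>_def by (rule DERIV_cong) (use s in \<open>simp add: field_simps\<close>)
    have d: "(E has_real_derivative (2 * w s * (s * \<gamma> s) - 2 * (N - 1) * s * (\<gamma> s)\<^sup>2 - 2 * (s * \<gamma> s) * \<Delta> - (1 + L) * ((w s)\<^sup>2 + (s * \<gamma> s)\<^sup>2)) * e) (at s)"
      unfolding E_def
      by (rule derivative_eq_intros dw d\<gamma> refl)+ (use s in \<open>simp add: e_def power2_eq_square field_simps\<close>)
    have "\<bar>(s * \<gamma> s) * \<Delta>\<bar> \<le> \<bar>s * \<gamma> s\<bar> * (L * \<bar>w s\<bar>)"
      unfolding abs_mult[of "s * \<gamma> s"] using lip[OF s] by (intro mult_left_mono) (auto simp: \<Delta>_def w_def)
    moreover have "\<bar>w s * (s * \<gamma> s)\<bar> = \<bar>s * \<gamma> s\<bar> * \<bar>w s\<bar>" by (simp add: abs_mult)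
    ultimately have "w s * (s * \<gamma> s) - (s * \<gamma> s) * \<Delta> \<le> \<bar>s * \<gamma> s\<bar> * \<bar>w s\<bar> + \<bar>s * \<gamma> s\<bar> * (L * \<bar>w s\<bar>)"
      by linarith
    then have "2 * w s * (s * \<gamma> s) - 2 * (s * \<gamma> s) * \<Delta> \<le> 2 * (\<bar>s * \<gamma> s\<bar> * \<bar>w s\<bar> + \<bar>s * \<gamma> s\<bar> * (L * \<bar>w s\<bar>))"
      by (simp only: mult.assoc flip: right_diff_distrib) simp
    also have "\<dots> = (1 + L) * (2 * \<bar>w s\<bar> * \<bar>s * \<gamma> s\<bar>)"
      by (simp add: algebra_simps)
    also have "\<dots> \<le> (1 + L) * ((w s)\<^sup>2 + (s * \<gamma> s)\<^sup>2)"
      using sum_squares_bound[of "\<bar>w s\<bar>" "\<bar>s * \<gamma> s\<bar>"] \<open>L \<ge> 0\<close> by (intro mult_left_mono) auto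
    finally have "2 * w s * (s * \<gamma> s) - 2 * (s * \<gamma> s) * \<Delta> \<le> (1 + L) * ((w s)\<^sup>2 + (s * \<gamma> s)\<^sup>2)" .
    moreover have "2 * (N - 1) * s * (\<gamma> s)\<^sup>2 \<ge> 0" using s \<open>N \<ge> 1\<close> by simp
    ultimately have "2 * w s * (s * \<gamma> s) - 2 * (N - 1) * s * (\<gamma> s)\<^sup>2 - 2 * (s * \<gamma> s) * \<Delta> - (1 + L) * ((w s)\<^sup>2 + (s * \<gamma> s)\<^sup>2) \<le> 0" by linarith
    with d show "\<exists>y. (E has_real_derivative y) (at s) \<and> y \<le> 0"
      by (auto simp: e_def mult_nonpos_nonneg)
  qed (rule r)
  then have "((w r)\<^sup>2 + (r * \<gamma> r)\<^sup>2) * exp (- ((1 + L) * r)) \<le> (w 0)\<^sup>2" by (simp add: E_def left_diff_distrib distrib_right)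
  then have "(w r)\<^sup>2 + (r * \<gamma> r)\<^sup>2 \<le> (w 0)\<^sup>2 * exp ((1 + L) * r)"
    by (simp add: exp_minus divide_le_eq flip: divide_inverse)
  moreover have "(w r)\<^sup>2 \<le> (w r)\<^sup>2 + (r * \<gamma> r)\<^sup>2" by simp
  ultimately show ?thesis unfolding w_def by (rule order_trans[rotated])
qed

section \<open>Test functions, Euler and Hardy inequalities\<close>

text \<open>Squaring removes the corner of the positive part; the truncation of subsolutions and the
  cut-off in the slope inequality are both built from it.\<close>

lemma DERIV_max_0_square:
  "((\<lambda>s::real. (max 0 s)\<^sup>2) has_real_derivative 2 * max 0 s) (at s)"
proof -
  consider "s < 0" | "s > 0" | "s = 0" by linarith
  then show ?thesis
  proof cases
    case 1
    show ?thesis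
      by (rule has_field_derivative_transform_within_open[where f="\<lambda>_. 0" and S="{..<0}"]) (use 1 in auto)
  next
    case 2
    have "((\<lambda>s. s\<^sup>2) has_real_derivative 2 * s) (at s)"
      by (auto intro!: derivative_eq_intros)
    then have "((\<lambda>s::real. (max 0 s)\<^sup>2) has_real_derivative 2 * s) (at s)"
      by (rule has_field_derivative_transform_within_open[where S="{0<..}"]) (use 2 in auto)
    with 2 show ?thesis by simp
  next
    case 3
    have "((\<lambda>h::real. (max 0 h)\<^sup>2 / h) \<longlongrightarrow> 0) (at 0)"
    proof (rule tendsto_0_le[where K=1 and f="\<lambda>h. h"])
      show "\<forall>\<^sub>F h in at (0::real). norm ((max 0 h)\<^sup>2 / h) \<le> norm h * 1"
        by (rule always_eventually) (auto simp: max_def power2_eq_square)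
    qed (rule tendsto_ident_at)
    with 3 show ?thesis by (simp add: DERIV_def)
  qed
qed

lemma integrable_stability_form:
  assumes "C1_compact_support (\<phi> :: real^'n::finite \<Rightarrow> real)" "continuous_on UNIV c"
  shows "integrable lborel (\<lambda>x. (norm (grad \<phi> x))\<^sup>2 - c x * (\<phi> x)\<^sup>2)"
proof -
  obtain R where hg: "has_grad \<phi> (grad \<phi>)" and R: "\<And>x. norm x > R \<Longrightarrow> \<phi> x = 0"
    using assms(1) by (auto simp: C1_compact_support_iff)
  show ?thesis
  proof (rule integrable_continuous_compact_support[where R=R])
    show "continuous_on UNIV (\<lambda>x. (norm (grad \<phi> x))\<^sup>2 - c x * (\<phi> x)\<^sup>2)"
      using has_grad_continuous[OF hg] has_grad_continuous_gradient[OF hg] assms(2)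
      by (intro continuous_intros)
    show "(norm (grad \<phi> x))\<^sup>2 - c x * (\<phi> x)\<^sup>2 = 0" if "norm x > R" for x
      using has_grad_zero_outside[OF hg R that] R[OF that] by simp
  qed
qed

text \<open>The truncation \<open>sqrt (\<delta>\<^sup>2 + (max 0 (s - \<delta>))\<^sup>2) - \<delta>\<close> of \<open>s\<close> is \<open>C\<^sup>1\<close>, vanishes for \<open>s \<le> \<delta>\<close>, has slope
  in \<open>[0, 1]\<close> and differs from \<open>s \<ge> 0\<close> by at most \<open>2 \<delta>\<close>; applied to \<open>W\<close> it gives an admissible test
  function on which the form is negative for small \<open>\<delta>\<close>.\<close>

lemma negative_stability_form_of_subsolution:
  fixes W c L :: "real^'n::finite \<Rightarrow> real" and D :: "'n \<Rightarrow> real^'n \<Rightarrow> real^'n"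
  assumes W: "has_grad W G" and D: "\<And>i. has_grad (\<lambda>x. G x $ i) (D i)"
    and L: "\<And>x. (\<Sum>i\<in>UNIV. D i x $ i) = L x"
    and c: "continuous_on UNIV c" and "R > 0"
    and pos: "\<And>x. norm x < R \<Longrightarrow> W x > 0" and zero: "\<And>x. norm x = R \<Longrightarrow> W x = 0"
    and sub: "\<And>x. norm x \<le> R \<Longrightarrow> L x + c x * W x \<ge> 0" and strict: "L 0 + c 0 * W 0 > 0"
  shows "\<exists>\<phi>. C1_compact_support \<phi> \<and> (LINT x|lborel. (norm (grad \<phi> x))\<^sup>2 - c x * (\<phi> x)\<^sup>2) < 0"
proof -
  define h where "h = (\<lambda>x. L x + c x * W x)"
  have Wc: "continuous_on UNIV W" using has_grad_continuous[OF W] .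
  have "continuous_on UNIV (\<lambda>x. \<Sum>i\<in>UNIV. D i x $ i)"
    using has_grad_continuous_gradient[OF D] by (intro continuous_intros) auto
  then have hc: "continuous_on UNIV h"
    unfolding h_def L using c Wc by (intro continuous_intros)
  obtain \<rho> where \<rho>: "0 < \<rho>" "\<rho> < R" "\<And>x. norm x \<le> \<rho> \<Longrightarrow> h x \<ge> h 0 / 2 \<and> W x \<ge> W 0 / 2"
  proof -
    have "\<forall>\<^sub>F x in nhds 0. h x > h 0 / 2"
    proof (rule order_tendstoD(1))
      show "(h \<longlongrightarrow> h 0) (nhds 0)"
        using hc by (auto simp: continuous_on_eq_continuous_at isCont_def tendsto_at_iff_tendsto_nhds)
      show "h 0 / 2 < h 0" using strict by (simp add: h_def algebra_simps)
    qed
    moreover have "\<forall>\<^sub>F x in nhds 0. W x > W 0 / 2"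
      using Wc pos[of 0] \<open>R > 0\<close> by (intro order_tendstoD(1)[of W "W 0"]) (auto simp: continuous_on_eq_continuous_at isCont_def tendsto_at_iff_tendsto_nhds)
    ultimately have "\<forall>\<^sub>F x in nhds 0. h x > h 0 / 2 \<and> W x > W 0 / 2" by eventually_elim auto
    then obtain d where d: "d > 0" "\<And>x. norm x < d \<Longrightarrow> h x > h 0 / 2 \<and> W x > W 0 / 2"
      by (auto simp: eventually_nhds_metric dist_norm)
    show thesis
    proof (rule that[of "min d R / 2"])
      fix x :: "real^'n" assume "norm x \<le> min d R / 2"
      then have "norm x < d" using d(1) \<open>R > 0\<close> by linarith
      then show "h x \<ge> h 0 / 2 \<and> W x \<ge> W 0 / 2" using d(2)[of x] by simp
    qed (use d \<open>R > 0\<close> in auto)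
  qed
  have "compact (c ` cball 0 R)" "compact (W ` cball 0 R)"
    using c Wc by (auto intro!: compact_continuous_image intro: continuous_on_subset)
  then have "bounded (c ` cball 0 R)" "bounded (W ` cball 0 R)" by (auto intro: compact_imp_bounded)
  then obtain C M where C0: "\<And>x. x \<in> cball 0 R \<Longrightarrow> norm (c x) \<le> C" and M0: "\<And>x. x \<in> cball 0 R \<Longrightarrow> norm (W x) \<le> M"
    unfolding bounded_iff by (metis imageI)
  have C: "c x \<le> C" and M: "W x \<le> M" if "norm x \<le> R" for x
    using C0[of x] M0[of x] that by auto
  have C0: "0 \<le> C" and M0: "0 \<le> M"
    using C0[of 0] M0[of 0] \<open>R > 0\<close> by auto
  define vR v\<rho> where "vR = measure lborel (cball (0::real^'n) R)" and "v\<rho> = measure lborel (cball (0::real^'n) \<rho>)"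
  have v\<rho>: "v\<rho> > 0" using content_cball_pos[of \<rho>] \<rho> by (simp add: v\<rho>_def)
  have W0: "W 0 > 0" using pos[of 0] \<open>R > 0\<close> by simp
  have h0: "h 0 > 0" using strict by (simp add: h_def)
  \<comment> \<open>\<open>A * \<delta>\<close> will bound the loss from replacing W by its
    truncation, which is off by at most 2 \<delta>; \<open>B\<close> is the gain on the small ball
    where the subsolution inequality is strict.\<close>
  define A B where "A = 2 * C * M * vR" and "B = W 0 / 4 * (h 0 / 2) * v\<rho>"
  have A: "A \<ge> 0" using C0 M0 by (simp add: A_def vR_def)
  have B: "B > 0" using W0 h0 v\<rho> by (simp add: B_def)
  \<comment> \<open>W 0 / 8 keeps the truncation above W 0 / 2 - 2 \<delta> \<ge> W 0 / 4 on the
    small ball; the second bound gives A \<delta> \<le> B / 2.\<close>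
  define \<delta> where "\<delta> = min (W 0 / 8) (B / (2 * (A + 1)))"
  have \<delta>: "\<delta> > 0" "\<delta> \<le> W 0 / 8" unfolding \<delta>_def using W0 A B by (simp_all only: min.cobounded1) auto
  have "A * \<delta> \<le> (A + 1) * (B / (2 * (A + 1)))"
    using A \<delta> by (intro mult_mono) (auto simp: \<delta>_def)
  also have "\<dots> = B / 2" using A by (simp add: field_simps)
  finally have AB: "A * \<delta> < B" using B by linarith
  define t where "t = (\<lambda>s::real. max 0 (s - \<delta>))"
  define \<tau> where "\<tau> = (\<lambda>s. sqrt (\<delta>\<^sup>2 + (t s)\<^sup>2) - \<delta>)"
  define \<tau>' where "\<tau>' = (\<lambda>s. t s / sqrt (\<delta>\<^sup>2 + (t s)\<^sup>2))"
  have pos_root: "\<delta>\<^sup>2 + (t s)\<^sup>2 > 0" for s using \<delta> by (simp add: add_pos_nonneg)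
  have d\<tau>: "(\<tau> has_real_derivative \<tau>' s) (at s)" for s
  proof -
    have "((\<lambda>s. (t s)\<^sup>2) has_real_derivative 2 * t s) (at s)"
      unfolding t_def using DERIV_chain2[OF DERIV_max_0_square, of "\<lambda>s. s - \<delta>" 1]
      by (simp add: DERIV_cdivide Deriv.field_differentiable_diff DERIV_diff[OF DERIV_ident DERIV_const, simplified])
    then have "((\<lambda>s. \<delta>\<^sup>2 + (t s)\<^sup>2) has_real_derivative 2 * t s) (at s)"
      using DERIV_add[OF DERIV_const] by fastforce
    from DERIV_chain2[OF DERIV_real_sqrt[OF pos_root] this]
    have "((\<lambda>s. sqrt (\<delta>\<^sup>2 + (t s)\<^sup>2)) has_real_derivative \<tau>' s) (at s)"
      by (simp add: \<tau>'_def field_simps)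
    from DERIV_diff[OF this DERIV_const] show ?thesis by (simp add: \<tau>_def)
  qed
  have tc: "continuous_on UNIV t" unfolding t_def by (intro continuous_intros)
  have \<tau>'c: "continuous_on UNIV \<tau>'"
    unfolding \<tau>'_def using tc pos_root by (intro continuous_intros) (auto simp: less_imp_neq[symmetric])
  have \<tau>'01: "0 \<le> \<tau>' s" "\<tau>' s \<le> 1" for s
  proof -
    have "t s \<ge> 0" by (simp add: t_def)
    moreover have "t s \<le> sqrt (\<delta>\<^sup>2 + (t s)\<^sup>2)" by (rule real_le_rsqrt) simp
    ultimately show "0 \<le> \<tau>' s" "\<tau>' s \<le> 1" using pos_root[of s] by (auto simp: \<tau>'_def divide_le_eq)
  qed
  have \<tau>0: "\<tau> s = 0" "\<tau>' s = 0" if "s \<le> \<delta>" for s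
    using that \<delta> by (auto simp: \<tau>_def \<tau>'_def t_def)
  have \<tau>_ge0: "\<tau> s \<ge> 0" for s
    using \<delta> real_le_rsqrt[of \<delta> "\<delta>\<^sup>2 + (t s)\<^sup>2"] by (simp add: \<tau>_def)
  have \<tau>_le: "\<tau> s \<le> s" and \<tau>_ge: "s - \<tau> s \<le> 2 * \<delta>" if "s > 0" for s
  proof -
    have t0: "t s \<ge> 0" by (simp add: t_def)
    have "sqrt (\<delta>\<^sup>2 + (t s)\<^sup>2) \<le> \<delta> + t s"
      by (rule real_le_lsqrt) (use \<delta> t0 in \<open>auto simp: power2_sum\<close>)
    moreover have "t s \<le> s" using that \<delta> by (simp add: t_def)
    ultimately show "\<tau> s \<le> s" by (simp add: \<tau>_def)
    have "t s \<le> sqrt (\<delta>\<^sup>2 + (t s)\<^sup>2)" by (rule real_le_rsqrt) simp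
    moreover have "s - \<delta> \<le> t s" by (simp add: t_def)
    ultimately show "s - \<tau> s \<le> 2 * \<delta>" unfolding \<tau>_def by linarith
  qed
  define \<phi> where "\<phi> = (\<lambda>x. if norm x < R then \<tau> (W x) else 0)"
  define \<Phi> where "\<Phi> = (\<lambda>x. (if norm x < R then \<tau>' (W x) else 0) *\<^sub>R G x)"
  have hg\<phi>: "has_grad \<phi> \<Phi>"
  proof (rule has_grad_local)
    fix x :: "real^'n"
    have "has_grad (\<lambda>x. \<tau> (W x)) (\<lambda>x. \<tau>' (W x) *\<^sub>R G x)"
      by (rule has_grad_compose[OF W d\<tau>]) (use continuous_on_compose2[OF \<tau>'c Wc] in auto)
    moreover have "has_grad (\<lambda>x::real^'n. 0) (\<lambda>x. 0)" by (auto simp: has_grad_def)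
    \<comment> \<open>As W vanishes on the sphere of radius R, this open set contains everything
      outside the open ball, and on it the truncated function is identically 0.\<close>
    moreover have "open ({y. W y < \<delta>} \<union> - cball 0 R)"
      by (intro open_Un open_Collect_less Wc continuous_on_const) auto
    moreover have "x \<in> {y. W y < \<delta>} \<union> - cball 0 R" if "\<not> norm x < R"
      using zero[of x] that \<delta> by auto
    ultimately show "\<exists>S k K. open S \<and> x \<in> S \<and> has_grad k K \<and> (\<forall>y\<in>S. \<phi> y = k y \<and> \<Phi> y = K y)"
      apply (cases "norm x < R")
       apply (rule exI[of _ "ball 0 R"], rule exI[of _ "\<lambda>x. \<tau> (W x)"], rule exI[of _ "\<lambda>x. \<tau>' (W x) *\<^sub>R G x"])
       apply (simp add: \<phi>_def \<Phi>_def)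
      apply (rule exI[of _ "{y. W y < \<delta>} \<union> - cball 0 R"], rule exI[of _ "\<lambda>x. 0"], rule exI[of _ "\<lambda>x. 0"])
      using \<tau>0 by (auto simp: \<phi>_def \<Phi>_def)
  qed
  have supp: "\<phi> x = 0" if "norm x > R" for x using that by (simp add: \<phi>_def)
  have C1: "C1_compact_support \<phi>" by (rule C1_compact_supportI[OF hg\<phi> supp])
  have gr: "grad \<phi> = \<Phi>" by (rule has_grad_grad[OF hg\<phi>])
  note div = integral_divergence_zero[of "\<lambda>i x. \<phi> x * G x $ i" _ R, OF has_grad_mult[OF hg\<phi> D]]
  have div_eq: "(\<Sum>i\<in>UNIV. (\<phi> x *\<^sub>R D i x + G x $ i *\<^sub>R \<Phi> x) $ i) = \<phi> x * L x + G x \<bullet> \<Phi> x" for x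
    by (simp add: sum.distrib L[symmetric] sum_distrib_left inner_vec_def)
  have div_int: "integrable lborel (\<lambda>x. \<phi> x * L x + G x \<bullet> \<Phi> x)" "(LINT x|lborel. \<phi> x * L x + G x \<bullet> \<Phi> x) = 0"
    using div supp unfolding div_eq by auto
  have int1: "integrable lborel (\<lambda>x. (norm (\<Phi> x))\<^sup>2 - c x * (\<phi> x)\<^sup>2)"
    using integrable_stability_form[OF C1 c] gr by simp
  have ind: "integrable lborel (indicator (cball (0::real^'n) r) :: _ \<Rightarrow> real)" for r
    using emeasure_bounded_finite[of "cball (0::real^'n) r"] by (intro integrable_real_indicator) auto
  \<comment> \<open>Subtracting the equation tested with \<phi> turns |\<Phi>|^2 into |\<Phi>|^2 - G
    \<bullet> \<Phi> = (\<tau>'^2 - \<tau>') |G|^2, which is nonpositive since 0 \<le> \<tau>' \<le>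
    1. What remains is the truncation error minus the gain.\<close>
  have "(LINT x|lborel. (norm (\<Phi> x))\<^sup>2 - c x * (\<phi> x)\<^sup>2)
      = (LINT x|lborel. ((norm (\<Phi> x))\<^sup>2 - c x * (\<phi> x)\<^sup>2) - (\<phi> x * L x + G x \<bullet> \<Phi> x))"
    using int1 div_int by simp
  also have "\<dots> \<le> (LINT x|lborel. 2 * C * M * \<delta> * indicator (cball (0::real^'n) R) x - W 0 / 4 * (h 0 / 2) * indicator (cball 0 \<rho>) x)"
  proof (rule integral_mono)
    fix x :: "real^'n"
    show "((norm (\<Phi> x))\<^sup>2 - c x * (\<phi> x)\<^sup>2) - (\<phi> x * L x + G x \<bullet> \<Phi> x)
       \<le> 2 * C * M * \<delta> * indicator (cball 0 R) x - W 0 / 4 * (h 0 / 2) * indicator (cball 0 \<rho>) x"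
    proof (cases "norm x < R")
      case False
      then show ?thesis using C0 M0 \<delta> \<rho> by (auto simp: \<phi>_def \<Phi>_def indicator_def)
    next
      case True
      let ?w = "W x" and ?X = "\<tau> (W x)"
      have w: "?w > 0" "?w \<le> M" "c x \<le> C" using pos True M C by auto
      have n: "(norm (\<Phi> x))\<^sup>2 = (\<tau>' ?w)\<^sup>2 * (G x \<bullet> G x)" "G x \<bullet> \<Phi> x = \<tau>' ?w * (G x \<bullet> G x)"
        using True by (auto simp: \<Phi>_def power_mult_distrib power2_norm_eq_inner)
      have "(\<tau>' ?w)\<^sup>2 \<le> \<tau>' ?w" using \<tau>'01[of ?w] by (simp add: power2_eq_square mult_left_le)
      then have "(norm (\<Phi> x))\<^sup>2 \<le> G x \<bullet> \<Phi> x" unfolding n by (intro mult_right_mono) auto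
      moreover have "- c x * (\<phi> x)\<^sup>2 - \<phi> x * L x = c x * (?X * (?w - ?X)) - ?X * h x"
        using True by (simp add: \<phi>_def h_def power2_eq_square algebra_simps)
      moreover have "c x * (?X * (?w - ?X)) \<le> C * (M * (2 * \<delta>))"
      proof -
        have X: "0 \<le> ?X" "?X \<le> M" "0 \<le> ?w - ?X" "?w - ?X \<le> 2 * \<delta>"
          using \<tau>_ge0 \<tau>_le \<tau>_ge w by (auto intro: order_trans)
        have "c x * (?X * (?w - ?X)) \<le> C * (?X * (?w - ?X))"
          using w X by (intro mult_right_mono) auto
        also have "\<dots> \<le> C * (M * (2 * \<delta>))"
          using X C0 M0 by (intro mult_left_mono mult_mono) auto
        finally show ?thesis .
      qed
      moreover have "W 0 / 4 * (h 0 / 2) * indicator (cball 0 \<rho>) x \<le> ?X * h x"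
      proof (cases "norm x \<le> \<rho>")
        case True
        have "?X \<ge> W 0 / 4" using \<rho>(3)[OF True] \<tau>_ge[OF w(1)] \<delta> by linarith
        moreover have "h x \<ge> h 0 / 2" using \<rho>(3)[OF True] by simp
        ultimately have "W 0 / 4 * (h 0 / 2) \<le> ?X * h x" using W0 h0 \<tau>_ge0 by (intro mult_mono) auto
        then show ?thesis using True by simp
      next
        case False
        then show ?thesis using \<tau>_ge0[of ?w] sub[of x] \<open>norm x < R\<close> by (simp add: h_def)
      qed
      ultimately show ?thesis using True by simp
    qed
  qed (use int1 div_int ind in auto)
  also have "\<dots> = A * \<delta> - B"
    using ind by (simp add: A_def B_def vR_def v\<rho>_def)
  also have "\<dots> < 0" using AB by simp
  finally show ?thesis using C1 gr by auto
qed

lemma first_zero: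
  fixes m :: "real \<Rightarrow> real"
  assumes mc: "continuous_on {0..} m" and "m 0 > 0" and r: "r \<ge> 0" "m r \<le> 0"
  obtains R where "R > 0" "R \<le> r" "m R = 0" "\<And>s. 0 \<le> s \<Longrightarrow> s < R \<Longrightarrow> m s > 0"
proof -
  define S where "S = {0..r} \<inter> m -` {..0}"
  have c: "continuous_on {0..r} m" using mc by (rule continuous_on_subset) auto
  have "closed S" unfolding S_def by (rule continuous_closed_preimage[OF c]) auto
  moreover have "bounded S" unfolding S_def by (rule bounded_subset[OF bounded_closed_interval[of 0 r]]) auto
  ultimately have "compact S" by (simp add: compact_eq_bounded_closed)
  moreover have "S \<noteq> {}" using r by (auto simp: S_def)
  ultimately obtain R where R: "R \<in> S" "\<And>s. s \<in> S \<Longrightarrow> R \<le> s"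
    by (metis compact_attains_inf)
  have le: "m R \<le> 0" "0 \<le> R" "R \<le> r" using R by (auto simp: S_def)
  have less: "m s > 0" if "0 \<le> s" "s < R" for s
    using R(2)[of s] that le by (force simp: S_def)
  have "R \<noteq> 0" using le \<open>m 0 > 0\<close> by auto
  have "\<exists>s\<ge>0. s \<le> R \<and> m s = 0"
    by (rule IVT2') (use le \<open>m 0 > 0\<close> c in \<open>auto intro: continuous_on_subset\<close>)
  then have "m R = 0" using less by (metis less_eq_real_def less_irrefl)
  moreover have "R > 0" using le \<open>R \<noteq> 0\<close> by simp
  ultimately show thesis using that less le by blast
qed

text \<open>The discriminant condition makes the roots of l^2 - p l + B real; - l1 and - l2 serve as
  exponents of an Euler equation.\<close>

lemma quadratic_positive_roots:
  fixes p B :: real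
  assumes "p > 0" "B > 0" "4 * B \<le> p\<^sup>2"
  obtains l1 l2 where "l1 > 0" "l2 > 0" "l1 + l2 = p" "l1 * l2 = B"
proof -
  define d where "d = sqrt (p\<^sup>2 - 4 * B)"
  have d: "d\<^sup>2 = p\<^sup>2 - 4 * B" "d \<ge> 0" using assms by (auto simp: d_def)
  have "d < p" using d assms by (intro power2_less_imp_less[of d p]) auto
  then show thesis using d assms
    by (intro that[of "(p - d) / 2" "(p + d) / 2"]) (auto simp: power2_eq_square field_simps)
qed

text \<open>The hypothesis \<open>ineq\<close> reads \<open>r\<^sup>2 D'' + (1 + l1 + l2) r D' + l1 l2 D \<ge> 0\<close>, that is
  \<open>(r d/dr + l1) (r d/dr + l2) D \<ge> 0\<close>; the two factors are integrated one after the other.\<close>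

lemma euler_inequality_mono:
  fixes D K k :: "real \<Rightarrow> real"
  assumes l: "l1 > 0" "l2 > 0"
    and Dc: "continuous_on {0..R} D" and Kc: "continuous_on {0..R} K"
    and dD: "\<And>r. 0 < r \<Longrightarrow> r < R \<Longrightarrow> (D has_real_derivative r * K r) (at r)"
    and dK: "\<And>r. 0 < r \<Longrightarrow> r < R \<Longrightarrow> (K has_real_derivative k r) (at r)"
    and ineq: "\<And>r. 0 < r \<Longrightarrow> r < R \<Longrightarrow> r\<^sup>2 * (r * k r + (2 + l1 + l2) * K r) + l1 * l2 * D r \<ge> 0"
    and ab: "0 \<le> a" "a \<le> b" "b \<le> R"
  shows "a powr l2 * D a \<le> b powr l2 * D b"
proof -
  define E where "E = (\<lambda>r. r\<^sup>2 * K r + l2 * D r)"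
  have E: "E r \<ge> 0" if r: "0 < r" "r < R" for r
  proof -
    \<comment> \<open>The value at 0 is 0 because \<open>0 powr l1 = 0\<close>, and l1 > 0 makes the
      product continuous there, so nothing has to be known about \<open>E 0\<close>.\<close>
    have "0 powr l1 * E 0 \<le> r powr l1 * E r"
    proof (rule DERIV_nonneg_imp_increasing_open[where f="\<lambda>r. r powr l1 * E r"])
      show "continuous_on {0..r} (\<lambda>r. r powr l1 * E r)"
        unfolding E_def using l r
        by (intro continuous_intros continuous_on_powr' continuous_on_subset[OF Dc] continuous_on_subset[OF Kc]) auto
      fix s assume s: "0 < s" "s < r"
      then have sR: "s < R" using r by simp
      let ?y = "s powr (l1 - 1) * (s\<^sup>2 * (s * k s + (2 + l1 + l2) * K s) + l1 * l2 * D s)"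
      have sp: "s powr l1 = s powr (l1 - 1) * s" using s by (simp add: powr_diff)
      have dE: "(E has_real_derivative (2 * s * K s + s\<^sup>2 * k s + l2 * (s * K s))) (at s)"
        unfolding E_def by (rule derivative_eq_intros dD[OF s(1) sR] dK[OF s(1) sR] refl)+ (simp add: algebra_simps)
      have "((\<lambda>r. r powr l1 * E r) has_real_derivative ?y) (at s)"
        by (rule DERIV_cong[OF DERIV_mult[OF has_real_derivative_powr[OF s(1)] dE]])
          (simp add: sp E_def power2_eq_square algebra_simps)
      moreover have "?y \<ge> 0" using ineq[OF s(1) sR] s by simp
      ultimately show "\<exists>y. ((\<lambda>r. r powr l1 * E r) has_real_derivative y) (at s) \<and> 0 \<le> y" by blast
    qed (use r in auto)
    then have "r powr l1 * E r \<ge> 0" by simp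
    moreover have "r powr l1 > 0" using r by simp
    ultimately show ?thesis by (simp only: zero_le_mult_iff) auto
  qed
  show ?thesis
  proof (rule DERIV_nonneg_imp_increasing_open[where f="\<lambda>r. r powr l2 * D r"])
    show "continuous_on {a..b} (\<lambda>r. r powr l2 * D r)"
      using l ab by (intro continuous_intros continuous_on_powr' continuous_on_subset[OF Dc]) auto
    fix s assume s: "a < s" "s < b"
    then have s': "0 < s" "s < R" using ab by auto
    have sp: "s powr l2 = s powr (l2 - 1) * s" using s' by (simp add: powr_diff)
    have "((\<lambda>r. r powr l2 * D r) has_real_derivative s powr (l2 - 1) * E s) (at s)"
      by (rule DERIV_cong[OF DERIV_mult[OF has_real_derivative_powr[OF s'(1)] dD[OF s']]])
        (simp add: sp E_def power2_eq_square algebra_simps)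
    moreover have "s powr (l2 - 1) * E s \<ge> 0" using E[OF s'] by simp
    ultimately show "\<exists>y. ((\<lambda>r. r powr l2 * D r) has_real_derivative y) (at s) \<and> 0 \<le> y" by blast
  qed (use ab in auto)
qed

text \<open>The regularised vector field \<open>- k x / (\<epsilon> + |x|\<^sup>2)\<close>, \<open>k = (N - 2) / 2\<close>, avoids the singularity of the
  optimal field \<open>- k x / |x|\<^sup>2\<close> and still gives a slightly weakened Hardy potential.\<close>

lemma regularised_hardy_inequality:
  fixes \<phi> :: "real^'n::finite \<Rightarrow> real"
  assumes \<phi>: "C1_compact_support \<phi>" and "\<epsilon> > 0" and N: "CARD('n) \<ge> 2"
  defines "k \<equiv> (real CARD('n) - 2) / 2"
  shows "(LINT x|lborel. (norm (grad \<phi> x))\<^sup>2 - k\<^sup>2 / (\<epsilon> + x \<bullet> x) * (\<phi> x)\<^sup>2) \<ge> 0"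
proof -
  obtain R where hg: "has_grad \<phi> (grad \<phi>)" and R: "\<And>x. norm x > R \<Longrightarrow> \<phi> x = 0"
    using \<phi> by (auto simp: C1_compact_support_iff)
  have k: "k \<ge> 0" and Nk: "real CARD('n) = 2 * k + 2" using N by (auto simp: k_def field_simps)
  have e: "\<epsilon> + x \<bullet> x > 0" for x :: "real^'n" using \<open>\<epsilon> > 0\<close> by (simp add: add_pos_nonneg)
  define m where "m = (\<lambda>x::real^'n. - k / (\<epsilon> + x \<bullet> x))"
  define M where "M = (\<lambda>x::real^'n. (2 * k / (\<epsilon> + x \<bullet> x)\<^sup>2) *\<^sub>R x)"
  have "has_grad (\<lambda>x::real^'n. - k / (\<epsilon> + x \<bullet> x)) (\<lambda>x. (k / (\<epsilon> + x \<bullet> x)\<^sup>2) *\<^sub>R (2 *\<^sub>R x))"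
  proof (rule has_grad_compose[OF has_grad_inner_self])
    fix x :: "real^'n"
    show "((\<lambda>t. - k / (\<epsilon> + t)) has_real_derivative k / (\<epsilon> + x \<bullet> x)\<^sup>2) (at (x \<bullet> x))"
      using e[of x] by (auto intro!: derivative_eq_intros simp: power2_eq_square)
  next
    show "continuous_on UNIV (\<lambda>x::real^'n. k / (\<epsilon> + x \<bullet> x)\<^sup>2)"
      using e by (intro continuous_intros) (auto simp: less_imp_neq[symmetric])
  qed
  then have hm: "has_grad m M" by (simp add: m_def M_def mult.commute)
  note hg2 = has_grad_mult[OF has_grad_mult[OF hg hg] has_grad_mult[OF hm has_grad_nth]]
  note div = integral_divergence_zero[where V="\<lambda>i x. (\<phi> x * \<phi> x) * (m x * x $ i)" and R=R, OF hg2]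
  have div_eq: "(\<Sum>i\<in>UNIV. ((\<phi> x * \<phi> x) *\<^sub>R (m x *\<^sub>R axis i 1 + x $ i *\<^sub>R M x) +
                 (m x * x $ i) *\<^sub>R (\<phi> x *\<^sub>R grad \<phi> x + \<phi> x *\<^sub>R grad \<phi> x)) $ i)
     = (\<phi> x)\<^sup>2 * (real CARD('n) * m x + M x \<bullet> x) + 2 * \<phi> x * m x * (grad \<phi> x \<bullet> x)" for x
    by (simp add: sum.distrib inner_vec_def sum_distrib_left power2_eq_square algebra_simps)
  have div_int: "integrable lborel (\<lambda>x. (\<phi> x)\<^sup>2 * (real CARD('n) * m x + M x \<bullet> x) + 2 * \<phi> x * m x * (grad \<phi> x \<bullet> x))"
    "(LINT x|lborel. (\<phi> x)\<^sup>2 * (real CARD('n) * m x + M x \<bullet> x) + 2 * \<phi> x * m x * (grad \<phi> x \<bullet> x)) = 0"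
    using div R unfolding div_eq by auto
  have "0 = (LINT x|lborel. (\<phi> x)\<^sup>2 * (real CARD('n) * m x + M x \<bullet> x) + 2 * \<phi> x * m x * (grad \<phi> x \<bullet> x))"
    using div_int by simp
  also have "\<dots> \<le> (LINT x|lborel. (norm (grad \<phi> x))\<^sup>2 - k\<^sup>2 / (\<epsilon> + x \<bullet> x) * (\<phi> x)\<^sup>2)"
  proof (rule integral_mono[OF div_int(1)])
    show "integrable lborel (\<lambda>x. (norm (grad \<phi> x))\<^sup>2 - k\<^sup>2 / (\<epsilon> + x \<bullet> x) * (\<phi> x)\<^sup>2)"
      by (rule integrable_stability_form[OF \<phi>]) (use e in \<open>auto simp: less_imp_neq[symmetric] intro!: continuous_intros\<close>)
    fix x :: "real^'n"
    define t where "t = \<epsilon> + x \<bullet> x"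
    have t: "t > 0" using e by (simp add: t_def)
    define s where "s = x \<bullet> x"
    have ts: "t = \<epsilon> + s" and s: "s \<ge> 0" by (auto simp: t_def s_def)
    have "0 \<le> (grad \<phi> x - (\<phi> x * m x) *\<^sub>R x) \<bullet> (grad \<phi> x - (\<phi> x * m x) *\<^sub>R x)" by simp
    also have "\<dots> = (norm (grad \<phi> x))\<^sup>2 - 2 * \<phi> x * m x * (grad \<phi> x \<bullet> x) + (\<phi> x)\<^sup>2 * ((m x)\<^sup>2 * s)"
      by (simp add: inner_diff_left inner_diff_right dot_square_norm[symmetric] inner_commute s_def power2_eq_square[of "\<phi> x"] power2_eq_square[of "m x"] algebra_simps)
    finally have 1: "2 * \<phi> x * m x * (grad \<phi> x \<bullet> x) \<le> (norm (grad \<phi> x))\<^sup>2 + (\<phi> x)\<^sup>2 * ((m x)\<^sup>2 * s)" by simp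
    have mm: "m x = - k / t" "M x \<bullet> x = 2 * k * s / t\<^sup>2" by (auto simp: m_def M_def t_def s_def)
    \<comment> \<open>With the field X = m x, what is needed is div X + |X|^2 + k^2 / t \<le> 0.
      Since N = 2k + 2, everything cancels except - k (k + 2) \<epsilon> / t^2, the price of the
      regularisation.\<close>
    have "real CARD('n) * m x + M x \<bullet> x + (m x)\<^sup>2 * s + k\<^sup>2 / t = - (k * (2 * k + 2) * t - 2 * k * s - k\<^sup>2 * s - k\<^sup>2 * t) / t\<^sup>2"
      using t by (simp add: mm Nk field_simps power2_eq_square)
    also have "k * (2 * k + 2) * t - 2 * k * s - k\<^sup>2 * s - k\<^sup>2 * t = k * (k + 2) * \<epsilon>"
      by (simp add: ts power2_eq_square algebra_simps)
    also have "- (k * (k + 2) * \<epsilon>) / t\<^sup>2 \<le> 0" using k \<open>\<epsilon> > 0\<close> by (simp add: divide_nonpos_nonneg)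
    finally have "(\<phi> x)\<^sup>2 * (real CARD('n) * m x + M x \<bullet> x + (m x)\<^sup>2 * s + k\<^sup>2 / t) \<le> 0"
      by (simp add: mult_nonneg_nonpos)
    with 1 show "(\<phi> x)\<^sup>2 * (real CARD('n) * m x + M x \<bullet> x) + 2 * \<phi> x * m x * (grad \<phi> x \<bullet> x)
       \<le> (norm (grad \<phi> x))\<^sup>2 - k\<^sup>2 / (\<epsilon> + x \<bullet> x) * (\<phi> x)\<^sup>2"
      unfolding t_def[symmetric] by (simp add: algebra_simps)
  qed
  finally show ?thesis .
qed

lemma measure_cball_scaling:
  assumes "r \<ge> 0"
  shows "measure lborel (cball (0::real^'n::finite) r) = r ^ CARD('n) * measure lborel (ball (0::real^'n) 1)"
  using content_ball_conv_unit_ball[OF assms, of "0::real^'n"] content_cball_conv_ball[of "0::real^'n" r] by simp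

section \<open>Ordering and stability\<close>

context
  fixes f :: "real \<Rightarrow> real"
  assumes adm: "admissible f"
begin

section \<open>Convexity of the nonlinearity on the positive half-line\<close>

lemma admissible_deriv: "(f has_real_derivative deriv f s) (at s)"
  using adm by (simp add: admissible_def DERIV_deriv_iff_real_differentiable)

lemma admissible_continuous: "continuous_on S f"
  using DERIV_continuous[OF admissible_deriv] continuous_at_imp_continuous_on by blast

lemma admissible_deriv_continuous: "continuous_on S (deriv f)"
  using adm by (auto simp: admissible_def intro: continuous_on_subset)

lemma admissible_zero: "f 0 = 0"
proof -
  have "f (- 0) = - f 0" using adm unfolding admissible_def by blast
  then show ?thesis by simp
qed

lemma admissible_pos: "s > 0 \<Longrightarrow> f s > 0"
  using adm by (simp add: admissible_def)

lemma admissible_deriv_pos: "s > 0 \<Longrightarrow> deriv f s > 0"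
  using adm by (simp add: admissible_def)

lemma admissible_deriv_less:
  assumes "0 \<le> a" "a < b" shows "deriv f a < deriv f b"
proof (rule DERIV_pos_imp_increasing_open[OF assms(2)])
  fix x assume "a < x" "x < b"
  then have "x > 0" using assms by simp
  then have "(deriv f has_real_derivative deriv (deriv f) x) (at x)" "deriv (deriv f) x > 0"
    using adm by (auto simp: admissible_def DERIV_deriv_iff_real_differentiable)
  then show "\<exists>y. (deriv f has_real_derivative y) (at x) \<and> 0 < y" by blast
qed (rule admissible_deriv_continuous)

lemma admissible_deriv_mono: "0 \<le> a \<Longrightarrow> a \<le> b \<Longrightarrow> deriv f a \<le> deriv f b"
  using admissible_deriv_less[of a b] by (cases "a = b") auto

text \<open>The tangent at b lies below the graph of a strictly convex function. The restriction to
  a \<ge> 0 is essential, as f is concave on the negative axis.\<close>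

lemma admissible_increment_less:
  assumes "0 \<le> a" "a < b" shows "f b - f a < deriv f b * (b - a)"
proof -
  obtain z where z: "a < z" "z < b" "f b - f a = (b - a) * deriv f z"
    using MVT2[OF assms(2) admissible_deriv] by blast
  then have "deriv f z < deriv f b" using assms by (intro admissible_deriv_less) auto
  then show ?thesis using z assms by (simp add: mult.commute)
qed

lemma admissible_increment_le: "0 \<le> a \<Longrightarrow> a \<le> b \<Longrightarrow> f b - f a \<le> deriv f b * (b - a)"
  using admissible_increment_less[of a b] by (cases "a = b") auto

lemma admissible_mono:
  assumes "0 \<le> a" "a \<le> b" shows "f a \<le> f b"
proof (cases "a = b")
  case False
  then have "a < b" using assms by simp
  then obtain z where z: "a < z" "z < b" "f b - f a = (b - a) * deriv f z"
    using MVT2[OF _ admissible_deriv] by blast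
  then have "deriv f z > 0" using assms by (intro admissible_deriv_pos) auto
  then have "(b - a) * deriv f z \<ge> 0" using \<open>a < b\<close> by simp
  then show ?thesis using z by simp
qed simp

lemma continuous_on_deriv_radial:
  assumes "radial_profile N f v g"
  shows "continuous_on UNIV (\<lambda>x::real^'n::finite. deriv f (v (norm x)))"
  by (rule continuous_on_compose2[OF admissible_deriv_continuous[of UNIV]])
    (use assms in \<open>auto simp: radial_profile_def intro!: continuous_on_radial\<close>)

text \<open>Either v reaches 0 or v meets v0 at the first failure radius R. In the first case W = v,
  in the second W = v0 - v is positive inside the ball, zero on its boundary and a subsolution of
  the linearisation at v0. Strict convexity at the centre supplies the strictness, and the resulting
  test function contradicts stability.\<close>

lemma stable_solution_ordered:
  assumes p0: "radial_profile (real CARD('n)) f v0 g0" and p: "radial_profile (real CARD('n)) f v g"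
    and stable: "stable_solution f (\<lambda>x::real^'n::finite. v0 (norm x))"
    and init: "0 < v 0" "v 0 < v0 0" and "r \<ge> 0"
  shows "0 < v r \<and> v r < v0 r"
proof (rule ccontr)
  assume neg: "\<not> ?thesis"
  \<comment> \<open>The minimum follows both conditions at once, so that up to its first zero both
    functions lie where f is convex.\<close>
  define m where "m = (\<lambda>r. min (v r) (v0 r - v r))"
  have "continuous_on {0..} m"
    unfolding m_def using p p0 by (auto simp: radial_profile_def intro!: continuous_intros)
  moreover have "m 0 > 0" using init by (simp add: m_def)
  moreover have "m r \<le> 0" using neg by (auto simp: m_def)
  ultimately obtain R where R: "R > 0" "m R = 0" "\<And>s. 0 \<le> s \<Longrightarrow> s < R \<Longrightarrow> m s > 0"
    using first_zero[of m r] \<open>r \<ge> 0\<close> by metis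
  have fc: "continuous_on UNIV f" by (rule admissible_continuous)
  note cc = continuous_on_deriv_radial[OF p0, where 'n='n]
  obtain D0 where D0: "\<And>i::'n. has_grad (\<lambda>x::real^'n. g0 (norm x) * x $ i) (D0 i)"
    "\<And>x. (\<Sum>i\<in>UNIV. D0 i x $ i) = - f (v0 (norm x))"
    using radial_profile_grad_components[OF p0 fc] by blast
  obtain D where D: "\<And>i::'n. has_grad (\<lambda>x::real^'n. g (norm x) * x $ i) (D i)"
    "\<And>x. (\<Sum>i\<in>UNIV. D i x $ i) = - f (v (norm x))"
    using radial_profile_grad_components[OF p fc] by blast
  note U0 = radial_profile_has_grad[OF p0, where 'n='n] and U = radial_profile_has_grad[OF p, where 'n='n]
  have ord: "0 \<le> v s \<and> v s \<le> v0 s" if "0 \<le> s" "s \<le> R" for s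
    using R(2) R(3)[of s] that by (cases "s = R") (auto simp: m_def min_def split: if_splits)
  have ords: "0 < v s \<and> v s < v0 s" if "0 \<le> s" "s < R" for s
    using R(3)[OF that] by (auto simp: m_def)
  \<comment> \<open>This makes v itself a subsolution of the linearisation at v0: f (v) \<le> f'(v)
    v by convexity and f 0 = 0, and f'(v) \<le> f'(v0) by the ordering.\<close>
  have sub1: "f (v s) \<le> deriv f (v0 s) * v s" if "0 \<le> s" "s \<le> R" for s
  proof -
    have "f (v s) - f 0 \<le> deriv f (v s) * (v s - 0)" by (rule admissible_increment_le) (use ord[OF that] in auto)
    also have "\<dots> \<le> deriv f (v0 s) * (v s - 0)"
      using ord[OF that] by (intro mult_right_mono admissible_deriv_mono) auto
    finally show ?thesis by (simp add: admissible_zero)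
  qed
  have strict1: "f (v 0) < deriv f (v0 0) * v 0"
  proof -
    have "f (v 0) - f 0 < deriv f (v 0) * (v 0 - 0)" by (rule admissible_increment_less) (use init in auto)
    also have "\<dots> \<le> deriv f (v0 0) * (v 0 - 0)"
      using init by (intro mult_right_mono admissible_deriv_mono) auto
    finally show ?thesis by (simp add: admissible_zero)
  qed
  have "\<exists>\<phi>::real^'n \<Rightarrow> real. C1_compact_support \<phi> \<and>
     (LINT x|lborel. (norm (grad \<phi> x))\<^sup>2 - deriv f (v0 (norm x)) * (\<phi> x)\<^sup>2) < 0"
  proof (cases "v R = 0")
    case True
    show ?thesis
    proof (rule negative_stability_form_of_subsolution[OF U _ _ cc \<open>R > 0\<close>, where D=D and L="\<lambda>x. - f (v (norm x))"])
      fix x :: "real^'n"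
      show "norm x < R \<Longrightarrow> v (norm x) > 0" using ords[of "norm x"] by simp
      show "norm x \<le> R \<Longrightarrow> - f (v (norm x)) + deriv f (v0 (norm x)) * v (norm x) \<ge> 0"
        using sub1[of "norm x"] by simp
    qed (use D True strict1 in auto)
  next
    case False
    then have eq: "v0 R = v R" using R(2) by (auto simp: m_def min_def split: if_splits)
    show ?thesis
    proof (rule negative_stability_form_of_subsolution[OF has_grad_diff[OF U0 U] _ _ cc \<open>R > 0\<close>,
          where D="\<lambda>i x. D0 i x - D i x" and L="\<lambda>x. - f (v0 (norm x)) + f (v (norm x))"])
      fix x :: "real^'n"
      show "has_grad (\<lambda>x. (g0 (norm x) *\<^sub>R x - g (norm x) *\<^sub>R x) $ i) (\<lambda>x. D0 i x - D i x)" for i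
        using has_grad_diff[OF D0(1) D(1)] by simp
      show "(\<Sum>i\<in>UNIV. (D0 i x - D i x) $ i) = - f (v0 (norm x)) + f (v (norm x))"
        using D0(2) D(2) by (simp add: sum_subtractf)
      show "norm x < R \<Longrightarrow> v0 (norm x) - v (norm x) > 0" using ords[of "norm x"] by simp
      show "norm x \<le> R \<Longrightarrow> - f (v0 (norm x)) + f (v (norm x)) + deriv f (v0 (norm x)) * (v0 (norm x) - v (norm x)) \<ge> 0"
        using admissible_increment_le[of "v (norm x)" "v0 (norm x)"] ord[of "norm x"] by simp
      show "- f (v0 (norm (0::real^'n))) + f (v (norm (0::real^'n))) + deriv f (v0 (norm (0::real^'n))) * (v0 (norm (0::real^'n)) - v (norm (0::real^'n))) > 0"
        using admissible_increment_less[of "v 0" "v0 0"] init by simp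
    qed (use eq in auto)
  qed
  with stable show False unfolding stable_solution_def by (meson not_less)
qed

text \<open>By 0 < v < v0 and monotonicity of f' the potential only gets smaller, so the form only
  gets larger.\<close>

lemma stable_solution_below:
  assumes p0: "radial_profile (real CARD('n)) f v0 g0" and p: "radial_profile (real CARD('n)) f v g"
    and stable: "stable_solution f (\<lambda>x::real^'n::finite. v0 (norm x))"
    and init: "0 < v 0" "v 0 < v0 0"
  shows "stable_solution f (\<lambda>x::real^'n. v (norm x))"
  unfolding stable_solution_def
proof (intro conjI allI impI)
  show "classical_solution f (\<lambda>x::real^'n. v (norm x))"
    by (rule radial_profile_classical_solution[OF p admissible_continuous])
  fix \<phi> :: "real^'n \<Rightarrow> real" assume \<phi>: "C1_compact_support \<phi>"
  have "0 \<le> (LINT x|lborel. (norm (grad \<phi> x))\<^sup>2 - deriv f (v0 (norm x)) * (\<phi> x)\<^sup>2)"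
    using stable \<phi> by (simp add: stable_solution_def)
  also have "\<dots> \<le> (LINT x|lborel. (norm (grad \<phi> x))\<^sup>2 - deriv f (v (norm x)) * (\<phi> x)\<^sup>2)"
  proof (rule integral_mono)
    fix x :: "real^'n"
    have "deriv f (v (norm x)) \<le> deriv f (v0 (norm x))"
      using stable_solution_ordered[OF p0 p stable init, of "norm x"] by (intro admissible_deriv_mono) auto
    then show "(norm (grad \<phi> x))\<^sup>2 - deriv f (v0 (norm x)) * (\<phi> x)\<^sup>2 \<le> (norm (grad \<phi> x))\<^sup>2 - deriv f (v (norm x)) * (\<phi> x)\<^sup>2"
      by (simp add: mult_right_mono)
  qed (use integrable_stability_form[OF \<phi>] continuous_on_deriv_radial p p0 in auto)
  finally show "0 \<le> (LINT x|lborel. (norm (grad \<phi> x))\<^sup>2 - deriv f (v (norm x)) * (\<phi> x)\<^sup>2)" .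
qed

text \<open>A negative value J of the form at vs would persist for \<alpha> slightly below vs 0: on
  the support of the test function solutions depend uniformly on \<alpha>, and f' is uniformly
  continuous on bounded sets.\<close>

lemma stable_solution_limit:
  assumes ps: "radial_profile (real CARD('n)) f vs gs" and vs0: "vs 0 > 0"
    and p: "\<And>\<alpha>. 0 < \<alpha> \<Longrightarrow> \<alpha> < vs 0 \<Longrightarrow> radial_profile (real CARD('n)) f (v \<alpha>) (g \<alpha>)"
    and init: "\<And>\<alpha>. 0 < \<alpha> \<Longrightarrow> \<alpha> < vs 0 \<Longrightarrow> v \<alpha> 0 = \<alpha>"
    and stable: "\<And>\<alpha>. 0 < \<alpha> \<Longrightarrow> \<alpha> < vs 0 \<Longrightarrow> stable_solution f (\<lambda>x::real^'n::finite. v \<alpha> (norm x))"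
  shows "stable_solution f (\<lambda>x::real^'n. vs (norm x))"
  unfolding stable_solution_def
proof (intro conjI allI impI)
  show "classical_solution f (\<lambda>x::real^'n. vs (norm x))"
    by (rule radial_profile_classical_solution[OF ps admissible_continuous])
  fix \<phi> :: "real^'n \<Rightarrow> real" assume \<phi>: "C1_compact_support \<phi>"
  define J where "J = (LINT x|lborel. (norm (grad \<phi> x))\<^sup>2 - deriv f (vs (norm x)) * (\<phi> x)\<^sup>2)"
  define K where "K = (LINT x|lborel. (\<phi> x)\<^sup>2)"
  obtain R0 where hg: "has_grad \<phi> (grad \<phi>)" and R0: "\<And>x. norm x > R0 \<Longrightarrow> \<phi> x = 0"
    using \<phi> by (auto simp: C1_compact_support_iff)
  define R where "R = max R0 0"
  have R: "R \<ge> 0" and supp: "\<And>x. norm x > R \<Longrightarrow> \<phi> x = 0" using R0 by (auto simp: R_def)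
  have Ki: "integrable lborel (\<lambda>x. (\<phi> x)\<^sup>2)"
    by (rule integrable_continuous_compact_support[where R=R])
      (use has_grad_continuous[OF hg] supp in \<open>auto intro!: continuous_intros\<close>)
  have "K \<ge> 0" unfolding K_def by (rule integral_nonneg_AE) auto
  show "0 \<le> J"
  proof (rule ccontr)
    assume "\<not> 0 \<le> J"
    then have J: "J < 0" by simp
    have "compact (vs ` {0..R})" using ps
      by (auto simp: radial_profile_def intro!: compact_continuous_image intro: continuous_on_subset)
    from compact_imp_bounded[OF this] obtain M0 where M0: "\<And>s. s \<in> {0..R} \<Longrightarrow> norm (vs s) \<le> M0"
      unfolding bounded_iff by blast
    have M: "\<bar>vs s\<bar> \<le> M0" if "0 \<le> s" "s \<le> R" for s using M0[of s] that by auto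
    \<comment> \<open>The interval is symmetric because no sign of vs is known at this
      stage.\<close>
    have "compact (deriv f ` {-M0..M0})"
      by (intro compact_continuous_image admissible_deriv_continuous) auto
    from compact_imp_bounded[OF this] obtain L where L: "\<And>s. s \<in> {-M0..M0} \<Longrightarrow> norm (deriv f s) \<le> L"
      unfolding bounded_iff by blast
    have M0pos: "M0 \<ge> vs 0" using M[of 0] R by auto
    have L0: "L \<ge> 0" using L[of 0] M0pos vs0 by (auto intro: order_trans[OF abs_ge_zero])
    have lip: "\<bar>f a - f b\<bar> \<le> L * \<bar>a - b\<bar>" if "a \<in> {-M0..M0}" "b \<in> {-M0..M0}" for a b
    proof -
      have "norm (f a - f b) \<le> L * norm (a - b)"
        by (rule field_differentiable_bound[where S="{-M0..M0}" and f'="deriv f"])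
          (use that L admissible_deriv in \<open>auto intro: has_field_derivative_at_within\<close>)
      then show ?thesis by simp
    qed
    \<comment> \<open>A change of f' by less than e alters the form by at most e K, which is less
      than - J.\<close>
    define e where "e = - J / (2 * (K + 1))"
    have e: "e > 0" unfolding e_def using J \<open>K \<ge> 0\<close> by (intro divide_pos_pos) auto
    have "e * K < - J"
    proof -
      have "e * K \<le> e * (K + 1)" using e by simp
      also have "\<dots> = - J / 2" using \<open>K \<ge> 0\<close> by (simp add: e_def field_simps)
      finally show ?thesis using J by simp
    qed
    have "uniformly_continuous_on {-M0..M0} (deriv f)"
      by (intro compact_uniformly_continuous admissible_deriv_continuous) auto
    then obtain d where d: "d > 0" "\<And>a b. a \<in> {-M0..M0} \<Longrightarrow> b \<in> {-M0..M0} \<Longrightarrow> \<bar>b - a\<bar> < d \<Longrightarrow> \<bar>deriv f b - deriv f a\<bar> < e"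
      using e unfolding uniformly_continuous_on_def dist_real_def by metis
    \<comment> \<open>The dependence estimate gives |v \<alpha> - vs|^2 \<le> |\<alpha> - vs 0|^2 B;
      as B \<ge> 1, the bound weakens to B^2, and |\<alpha> - vs 0| < d / B suffices for closeness
      d.\<close>
    define B where "B = exp ((1 + L) * R)"
    have B: "B \<ge> 1" using L0 R by (simp add: B_def)
    define \<alpha> where "\<alpha> = vs 0 - min (vs 0) (d / B) / 2"
    have \<alpha>: "0 < \<alpha>" "\<alpha> < vs 0" using vs0 d B by (auto simp: \<alpha>_def min_def field_simps)
    have \<alpha>d: "\<bar>\<alpha> - vs 0\<bar> < d / B" using vs0 d B by (auto simp: \<alpha>_def min_def field_simps)
    have v: "0 < v \<alpha> s \<and> v \<alpha> s \<le> M0" if "0 \<le> s" for s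
    proof -
      \<comment> \<open>Stability of vs is still open, so the comparison that makes v \<alpha>
        positive uses an intermediate stable solution.\<close>
      define \<beta> where "\<beta> = (\<alpha> + vs 0) / 2"
      have \<beta>: "\<alpha> < \<beta>" "\<beta> < vs 0" using \<alpha> by (auto simp: \<beta>_def)
      have pos: "0 < v \<alpha> s" if "0 \<le> s" for s
        using stable_solution_ordered[OF p[of \<beta>] p[of \<alpha>] stable[of \<beta>] _ _ that] \<alpha> \<beta> init by simp
      have "v \<alpha> s \<le> v \<alpha> 0"
        by (rule positive_profile_antimono[OF p[OF \<alpha>], where R="s + 1"])
          (use pos that admissible_pos in \<open>auto intro: less_imp_le\<close>)
      then show ?thesis using pos[OF that] init \<alpha> M0pos by simp
    qed
    have close: "\<bar>v \<alpha> s - vs s\<bar> < d" if "0 \<le> s" "s \<le> R" for s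
    proof -
      have "(v \<alpha> s - vs s)\<^sup>2 \<le> (v \<alpha> 0 - vs 0)\<^sup>2 * exp ((1 + L) * s)"
      proof (rule radial_profile_dependence[OF p[OF \<alpha>] ps _ L0])
        fix t assume t: "0 < t" "t < s"
        show "\<bar>f (v \<alpha> t) - f (vs t)\<bar> \<le> L * \<bar>v \<alpha> t - vs t\<bar>"
        proof (rule lip)
          show "v \<alpha> t \<in> {-M0..M0}" using v[of t] t by auto
          show "vs t \<in> {-M0..M0}" using M[of t] t that by (auto simp: abs_le_iff)
        qed
      qed (use that in auto)
      also have "\<dots> \<le> (v \<alpha> 0 - vs 0)\<^sup>2 * (B * B)"
      proof (rule mult_left_mono)
        have "exp ((1 + L) * s) \<le> B" unfolding B_def using that L0 by (simp add: mult_left_mono)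
        also have "B \<le> B * B" using B by simp
        finally show "exp ((1 + L) * s) \<le> B * B" .
      qed simp
      also have "\<dots> = (\<bar>\<alpha> - vs 0\<bar> * B)\<^sup>2" using init[OF \<alpha>] by (simp add: power2_eq_square algebra_simps)
      finally have "\<bar>v \<alpha> s - vs s\<bar> \<le> \<bar>\<alpha> - vs 0\<bar> * B"
        using B by (simp add: abs_le_square_iff[of _ "\<bar>\<alpha> - vs 0\<bar> * B", symmetric] abs_mult)
      also have "\<dots> < d" using \<alpha>d B by (simp add: field_simps)
      finally show ?thesis .
    qed
    have "0 \<le> (LINT x|lborel. (norm (grad \<phi> x))\<^sup>2 - deriv f (v \<alpha> (norm x)) * (\<phi> x)\<^sup>2)"
      using stable[OF \<alpha>] \<phi> by (simp add: stable_solution_def)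
    also have "\<dots> \<le> (LINT x|lborel. ((norm (grad \<phi> x))\<^sup>2 - deriv f (vs (norm x)) * (\<phi> x)\<^sup>2) + e * (\<phi> x)\<^sup>2)"
    proof (rule integral_mono)
      show "integrable lborel (\<lambda>x. (norm (grad \<phi> x))\<^sup>2 - deriv f (v \<alpha> (norm x)) * (\<phi> x)\<^sup>2)"
        by (rule integrable_stability_form[OF \<phi> continuous_on_deriv_radial[OF p[OF \<alpha>]]])
      show "integrable lborel (\<lambda>x. ((norm (grad \<phi> x))\<^sup>2 - deriv f (vs (norm x)) * (\<phi> x)\<^sup>2) + e * (\<phi> x)\<^sup>2)"
        using Ki integrable_stability_form[OF \<phi> continuous_on_deriv_radial[OF ps]] by auto
      fix x :: "real^'n"
      have "- deriv f (v \<alpha> (norm x)) * (\<phi> x)\<^sup>2 \<le> (- deriv f (vs (norm x)) + e) * (\<phi> x)\<^sup>2"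
      proof (cases "norm x \<le> R")
        case True
        have "\<bar>deriv f (v \<alpha> (norm x)) - deriv f (vs (norm x))\<bar> < e"
        proof (rule d(2))
          show "v \<alpha> (norm x) \<in> {-M0..M0}" using v[of "norm x"] by auto
          show "vs (norm x) \<in> {-M0..M0}" using M[of "norm x"] True by (auto simp: abs_le_iff)
        qed (use close[of "norm x"] True in auto)
        then show ?thesis by (intro mult_right_mono) (auto simp: abs_less_iff)
      next
        case False
        then show ?thesis using supp by simp
      qed
      then show "(norm (grad \<phi> x))\<^sup>2 - deriv f (v \<alpha> (norm x)) * (\<phi> x)\<^sup>2 \<le> ((norm (grad \<phi> x))\<^sup>2 - deriv f (vs (norm x)) * (\<phi> x)\<^sup>2) + e * (\<phi> x)\<^sup>2"
        by (simp add: algebra_simps)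
    qed
    also have "\<dots> = J + e * K"
      unfolding J_def K_def using Ki integrable_stability_form[OF \<phi> continuous_on_deriv_radial[OF ps]] by simp
    finally show False using \<open>e * K < - J\<close> by simp
  qed
qed

section \<open>The tail integral F: derivative, sign and limit at infinity\<close>

lemma tail_integral_eq:
  assumes "0 < a" "a \<le> x"
  shows "tail_integral f x = tail_integral f a - integral {a..x} (\<lambda>s. 1 / f s)"
    "(LINT s:{a..x}|lborel. 1 / f s) = integral {a..x} (\<lambda>s. 1 / f s)"
proof -
  have i: "set_integrable lborel {a..} (\<lambda>s. 1 / f s)" using adm assms by (simp add: admissible_def)
  have i1: "set_integrable lborel {a..x} (\<lambda>s. 1 / f s)" and i2: "set_integrable lborel {x<..} (\<lambda>s. 1 / f s)"
    by (rule set_integrable_subset[OF i]; use assms in auto)+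
  show eq: "(LINT s:{a..x}|lborel. 1 / f s) = integral {a..x} (\<lambda>s. 1 / f s)"
    by (rule set_borel_integral_eq_integral[OF i1])
  have "{a..} = {a..x} \<union> {x<..}" using assms by auto
  then have "tail_integral f a = (LINT s:{a..x}|lborel. 1 / f s) + (LINT s:{x<..}|lborel. 1 / f s)"
    unfolding tail_integral_def using set_integral_Un[OF ivl_disj_int_one(7) i1 i2] by simp
  moreover have "(LINT s:{x<..}|lborel. 1 / f s) = (LINT s:{x..}|lborel. 1 / f s)"
    unfolding set_lebesgue_integral_def
  proof (rule integral_cong_AE)
    show "(\<lambda>s. indicat_real {x<..} s *\<^sub>R (1 / f s)) \<in> borel_measurable lborel"
      using i2 unfolding set_integrable_def by auto
    have "set_integrable lborel {x..} (\<lambda>s. 1 / f s)" by (rule set_integrable_subset[OF i]) (use assms in auto)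
    then show "(\<lambda>s. indicat_real {x..} s *\<^sub>R (1 / f s)) \<in> borel_measurable lborel"
      unfolding set_integrable_def by auto
    show "AE s in lborel. indicat_real {x<..} s *\<^sub>R (1 / f s) = indicat_real {x..} s *\<^sub>R (1 / f s)"
      using AE_lborel_singleton[of x] by eventually_elim (auto simp: indicator_def)
  qed
  ultimately show "tail_integral f x = tail_integral f a - integral {a..x} (\<lambda>s. 1 / f s)"
    using eq by (simp add: tail_integral_def)
qed

lemma tail_integral_deriv:
  assumes "s > 0"
  shows "(tail_integral f has_real_derivative - 1 / f s) (at s)"
proof -
  have c: "continuous_on {s/2 .. 2 * s} (\<lambda>s. 1 / f s)"
    using admissible_pos assms by (intro continuous_intros admissible_continuous) (auto simp: less_imp_neq[symmetric])
  have "((\<lambda>x. integral {s/2 .. x} (\<lambda>s. 1 / f s)) has_real_derivative 1 / f s) (at s within {s/2 .. 2 * s})"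
    by (rule integral_has_real_derivative[OF c]) (use assms in auto)
  moreover have "at s within {s/2 .. 2 * s} = at s" by (rule at_within_interior) (use assms in auto)
  ultimately have "((\<lambda>x. integral {s/2 .. x} (\<lambda>s. 1 / f s)) has_real_derivative 1 / f s) (at s)" by simp
  from DERIV_diff[OF DERIV_const this, of "tail_integral f (s/2)"]
  have "((\<lambda>x. tail_integral f (s/2) - integral {s/2 .. x} (\<lambda>s. 1 / f s)) has_real_derivative - 1 / f s) (at s)" by simp
  then show ?thesis
  proof (rule has_field_derivative_transform_within_open[where S="{s/2<..}"])
    fix x assume "x \<in> {s/2<..}"
    then show "tail_integral f (s/2) - integral {s/2 .. x} (\<lambda>s. 1 / f s) = tail_integral f x"
      using tail_integral_eq(1)[of "s/2" x] assms by simp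
  qed (use assms in auto)
qed

lemma tail_integral_nonneg:
  assumes "s > 0" shows "tail_integral f s \<ge> 0"
  unfolding tail_integral_def set_lebesgue_integral_def
  by (rule integral_nonneg_AE) (use admissible_pos assms in \<open>auto simp: indicator_def less_imp_le\<close>)

lemma tail_integral_less:
  assumes "0 < a" "a < b" shows "tail_integral f b < tail_integral f a"
proof (rule DERIV_neg_imp_decreasing[OF assms(2)])
  fix x assume "a \<le> x" "x \<le> b"
  then show "\<exists>y. (tail_integral f has_real_derivative y) (at x) \<and> y < 0"
    using assms tail_integral_deriv[of x] admissible_pos[of x] by (intro exI[of _ "- 1 / f x"]) auto
qed

lemma tail_integral_pos: "s > 0 \<Longrightarrow> tail_integral f s > 0"
  using tail_integral_less[of s "s + 1"] tail_integral_nonneg[of "s + 1"] by simp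

lemma tail_integral_tendsto_0: "(tail_integral f \<longlongrightarrow> 0) at_top"
proof -
  have "set_integrable lborel {1..} (\<lambda>s. 1 / f s)" using adm by (simp add: admissible_def)
  then have "((\<lambda>b. (LINT s:{1..b}|lborel. 1 / f s)) \<longlongrightarrow> tail_integral f 1) at_top"
    unfolding tail_integral_def by (intro tendsto_set_lebesgue_integral_at_top) auto
  then have "((\<lambda>b. tail_integral f 1 - (LINT s:{1..b}|lborel. 1 / f s)) \<longlongrightarrow> tail_integral f 1 - tail_integral f 1) at_top"
    by (intro tendsto_intros)
  then have "((\<lambda>b. tail_integral f 1 - (LINT s:{1..b}|lborel. 1 / f s)) \<longlongrightarrow> 0) at_top" by simp
  moreover have "\<forall>\<^sub>F b in at_top. tail_integral f 1 - (LINT s:{1..b}|lborel. 1 / f s) = tail_integral f b"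
    using eventually_ge_at_top[of 1]
  proof eventually_elim
    case (elim b)
    then show ?case using tail_integral_eq[of 1 b] by simp
  qed
  ultimately show ?thesis by (rule Lim_transform_eventually)
qed

text \<open>Integrate \<open>(r\<^sup>n g)' = - r\<^sup>n\<^sup>-\<^sup>1 f(v)\<close>, using that \<open>f(v)\<close> decreases in \<open>r\<close>.\<close>

lemma positive_profile_slope:
  assumes p: "radial_profile (real n) f v g" and "n > 0"
    and pos: "\<And>s. 0 \<le> s \<Longrightarrow> s < R \<Longrightarrow> v s > 0" and r: "0 \<le> r" "r < R"
  shows "f (v r) / n \<le> - g r"
proof (cases "r = 0")
  case True
  then show ?thesis using p by (simp add: radial_profile_def)
next
  case False
  have gc: "continuous_on {0..r} g" and vc: "continuous_on {0..r} v"
    using p by (auto simp: radial_profile_def intro: continuous_on_subset)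
  have fvc: "continuous_on {0..r} (\<lambda>s. f (v s))"
    by (rule continuous_on_compose2[OF admissible_continuous[of UNIV] vc]) auto
  have "0 ^ n * (- g 0 - f (v 0) / n) \<le> r ^ n * (- g r - f (v r) / n)"
  proof (rule DERIV_nonneg_imp_increasing_open[where f="\<lambda>s. s ^ n * (- g s - f (v s) / n)"])
    fix s assume s: "0 < s" "s < r"
    have dg: "(g has_real_derivative - (n * g s + f (v s)) / s) (at s)"
      and dv: "(v has_real_derivative s * g s) (at s)"
      using p s by (auto simp: radial_profile_def)
    have dfv: "((\<lambda>s. f (v s)) has_real_derivative deriv f (v s) * (s * g s)) (at s)"
      by (rule DERIV_chain2[OF admissible_deriv dv])
    define y where "y = s ^ n * (- (deriv f (v s) * (s * g s)) / n)"
    have sn: "s ^ n = s * s ^ (n - 1)" using \<open>n > 0\<close> by (simp add: power_eq_if)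
    have "((\<lambda>s. s ^ n * (- g s - f (v s) / n)) has_real_derivative y) (at s)"
      by (rule DERIV_cong[OF DERIV_mult[OF DERIV_pow DERIV_diff[OF DERIV_minus[OF dg] DERIV_cdivide[OF dfv]]]])
        (use s \<open>n > 0\<close> in \<open>simp add: y_def sn field_simps\<close>)
    moreover have "y \<ge> 0"
    proof -
      have "g s \<le> 0" using positive_profile_nonpos[OF p \<open>n > 0\<close> _ pos] admissible_pos s r by (simp add: less_imp_le)
      moreover have "deriv f (v s) > 0" using admissible_deriv_pos pos s r by simp
      ultimately have "deriv f (v s) * (s * g s) \<le> 0" using s by (simp add: mult_nonneg_nonpos)
      then show ?thesis unfolding y_def using s by (intro mult_nonneg_nonneg divide_nonneg_nonneg) auto
    qed
    ultimately show "\<exists>y. ((\<lambda>s. s ^ n * (- g s - f (v s) / n)) has_real_derivative y) (at s) \<and> 0 \<le> y" by blast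
  qed (use r gc fvc \<open>n > 0\<close> in \<open>auto intro!: continuous_intros\<close>)
  then have "0 \<le> r ^ n * (- g r - f (v r) / n)" unfolding zero_power[OF \<open>n > 0\<close>] mult_zero_left .
  moreover have "r ^ n > 0" using r False by simp
  ultimately have "0 \<le> - g r - f (v r) / n" by (simp only: zero_le_mult_iff) auto
  then show ?thesis by simp
qed

subsection \<open>Stability for small initial values\<close>

text \<open>\<open>y = F(v)\<close> satisfies \<open>y'' + (N-1)/r y' = 1 + f'F(v) y'\<^sup>2 / y\<close>. Linearising the convex function
  \<open>y'\<^sup>2 / y\<close> at the singular solution \<open>c r\<^sup>2\<close> turns this into an Euler inequality for \<open>y - c r\<^sup>2\<close>.\<close>

lemma tail_integral_ge_singular:
  assumes p: "radial_profile (real n) f v g" and n: "n > 0"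
    and q: "0 < q" "4 * q < real n - 2" "16 * q \<le> (real n - 2 - 4 * q)\<^sup>2"
    and pos: "\<And>s. 0 \<le> s \<Longrightarrow> s < R \<Longrightarrow> v s > 0"
    and Q: "\<And>s. 0 < s \<Longrightarrow> s \<le> v 0 \<Longrightarrow> q \<le> deriv f s * tail_integral f s"
    and r: "0 < r" "r < R"
  shows "r\<^sup>2 / (2 * real n - 4 * q) \<le> tail_integral f (v r)"
proof -
  define N where "N = real n"
  \<comment> \<open>The singular solution: for y = c r^2 the equation with f'F = q reads 2 N c = 1 +
    4 q c.\<close>
  define c where "c = 1 / (2 * N - 4 * q)"
  have cN: "c * (2 * N - 4 * q) = 1" using q by (simp add: c_def N_def)
  \<comment> \<open>The tangent bound y'^2 / y \<ge> 4 y' / r - 4 y / r^2 leads to r^2 D'' + (N - 1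
    - 4q) r D' + 4q D \<ge> 0, which fixes sum and product of the exponents. The hypothesis 16 q
    \<le> (N - 2 - 4q)^2 is their reality.\<close>
  obtain l1 l2 where l: "l1 > 0" "l2 > 0" "l1 + l2 = N - 2 - 4 * q" "l1 * l2 = 4 * q"
    by (rule quadratic_positive_roots[of "N - 2 - 4 * q" "4 * q"]) (use q in \<open>auto simp: N_def\<close>)
  have pos': "v s > 0" if "0 \<le> s" "s \<le> r" for s by (rule pos) (use that r in auto)
  have fnn: "f s \<ge> 0" if "s > 0" for s using admissible_pos[OF that] by simp
  have le: "v s \<le> v 0" if "0 \<le> s" "s \<le> r" for s
    by (rule positive_profile_antimono[where R=R and q=0 and r=s, OF p n fnn pos]) (use that r in auto)
  have vc: "continuous_on {0..r} v" and gc: "continuous_on {0..r} g"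
    using p by (auto simp: radial_profile_def intro: continuous_on_subset)
  have fvc: "continuous_on {0..r} (\<lambda>s. f (v s))"
    by (rule continuous_on_compose2[OF admissible_continuous[of UNIV] vc]) auto
  have "continuous_on {0<..} (tail_integral f)"
    by (intro continuous_at_imp_continuous_on ballI DERIV_isCont[OF tail_integral_deriv]) auto
  then have Fvc: "continuous_on {0..r} (\<lambda>s. tail_integral f (v s))"
    by (rule continuous_on_compose2[OF _ vc]) (use pos' in auto)
  define D where "D = (\<lambda>s. tail_integral f (v s) - c * s\<^sup>2)"
  define K where "K = (\<lambda>s. - g s / f (v s) - 2 * c)"
  define k where "k = (\<lambda>s. (N * g s + f (v s)) / (s * f (v s)) + deriv f (v s) * (g s)\<^sup>2 * s / (f (v s))\<^sup>2)"
  have "0 powr l2 * D 0 \<le> r powr l2 * D r"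
  proof (rule euler_inequality_mono[where K=K and k=k and R=r, OF l(1,2)])
    show "continuous_on {0..r} D" unfolding D_def by (intro continuous_intros Fvc)
    show "continuous_on {0..r} K" unfolding K_def
      using pos' admissible_pos by (intro continuous_intros gc fvc) (auto simp: less_imp_neq[symmetric])
    fix s assume s: "0 < s" "s < r"
    have vs: "v s > 0" using pos'[of s] s by simp
    then have fs: "f (v s) > 0" using admissible_pos by simp
    have dv: "(v has_real_derivative s * g s) (at s)" and dg: "(g has_real_derivative - (N * g s + f (v s)) / s) (at s)"
      using p s by (auto simp: radial_profile_def N_def)
    have dF: "((\<lambda>s. tail_integral f (v s)) has_real_derivative - 1 / f (v s) * (s * g s)) (at s)"
      by (rule DERIV_chain2[OF tail_integral_deriv[OF vs] dv])
    have df: "((\<lambda>s. f (v s)) has_real_derivative deriv f (v s) * (s * g s)) (at s)"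
      by (rule DERIV_chain2[OF admissible_deriv dv])
    show "(D has_real_derivative s * K s) (at s)"
      unfolding D_def by (rule derivative_eq_intros dF refl)+ (simp add: K_def algebra_simps)
    show "(K has_real_derivative k s) (at s)"
      unfolding K_def
      by (rule DERIV_cong[OF DERIV_diff[OF DERIV_divide[OF DERIV_minus[OF dg] df] DERIV_const]])
        (use fs s in \<open>auto simp: k_def power2_eq_square field_simps\<close>)
    define \<kappa> where "\<kappa> = - g s / f (v s)"
    define y where "y = tail_integral f (v s)"
    define d where "d = deriv f (v s)"
    have y: "y > 0" using tail_integral_pos[OF vs] by (simp add: y_def)
    have dy: "d * y \<ge> q" using Q[OF vs] le[of s] s by (simp add: d_def y_def)
    have gk: "g s = - \<kappa> * f (v s)" using fs by (simp add: \<kappa>_def)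
    have sk: "s * k s = - N * \<kappa> + 1 + s\<^sup>2 * d * \<kappa>\<^sup>2"
      using fs s by (simp add: k_def gk d_def field_simps power2_eq_square)
    have "s\<^sup>2 * (s * k s + (2 + l1 + l2) * K s) + l1 * l2 * D s
        = s\<^sup>2 * (- N * \<kappa> + 1 + s\<^sup>2 * d * \<kappa>\<^sup>2 + (N - 4 * q) * (\<kappa> - 2 * c)) + 4 * q * (y - c * s\<^sup>2)"
      using l(3) by (simp add: sk l(4) K_def \<kappa>_def D_def y_def add.assoc)
    also have "\<dots> = s\<^sup>2 * (1 - c * (2 * N - 4 * q)) + (s\<^sup>2)\<^sup>2 * d * \<kappa>\<^sup>2 - 4 * q * s\<^sup>2 * \<kappa> + 4 * q * y"
      by (simp add: power2_eq_square algebra_simps)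
    also have "\<dots> = (s\<^sup>2 * \<kappa>)\<^sup>2 * d - 4 * q * s\<^sup>2 * \<kappa> + 4 * q * y"
      unfolding cN by (simp add: power2_eq_square algebra_simps)
    \<comment> \<open>With \<kappa> = y' / s the tangent bound is (s y' - 2 y)^2 \<ge> 0, multiplied
      by q and divided by y.\<close>
    also have "\<dots> \<ge> 0"
    proof -
      have "(s\<^sup>2 * \<kappa>)\<^sup>2 * q \<le> (s\<^sup>2 * \<kappa>)\<^sup>2 * (d * y)" by (intro mult_left_mono dy) simp
      moreover have "0 \<le> q * (s\<^sup>2 * \<kappa> - 2 * y)\<^sup>2" using q by simp
      ultimately have "0 \<le> y * ((s\<^sup>2 * \<kappa>)\<^sup>2 * d - 4 * q * s\<^sup>2 * \<kappa> + 4 * q * y)"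
        by (simp add: power2_eq_square algebra_simps)
      with y show ?thesis by (simp only: zero_le_mult_iff) auto
    qed
    finally show "s\<^sup>2 * (s * k s + (2 + l1 + l2) * K s) + l1 * l2 * D s \<ge> 0" .
  qed (use r in auto)
  then have "0 \<le> r powr l2 * D r" by simp
  moreover have "r powr l2 > 0" using r by simp
  ultimately have "0 \<le> D r" by (simp only: zero_le_mult_iff) auto
  then show ?thesis by (simp add: D_def c_def N_def)
qed

text \<open>The bound f'(v) r^2 \<le> C needs v > 0 only up to the radius considered, so it can
  serve to prove positivity: f (v) \<le> f'(v) v \<le> C v / r^2 gives an Euler inequality for v
  itself, with real exponents since 4 C < (N-2)^2. Once v > 0 everywhere, the bound is global and
  Hardy's inequality applies.\<close>

lemma stable_solution_small:
  assumes p: "radial_profile (real CARD('n)) f v g" and n: "CARD('n) > 2" and v0: "v 0 > 0"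
    and q: "0 < q" "4 * q < real CARD('n) - 2" "16 * q \<le> (real CARD('n) - 2 - 4 * q)\<^sup>2"
    and Q: "\<And>s. 0 < s \<Longrightarrow> s \<le> v 0 \<Longrightarrow> q \<le> deriv f s * tail_integral f s \<and> deriv f s * tail_integral f s \<le> q'"
    and q': "q' * (2 * real CARD('n) - 4 * q) < (real CARD('n) - 2)\<^sup>2 / 4"
  shows "stable_solution f (\<lambda>x::real^'n::finite. v (norm x))"
proof -
  define N where "N = real CARD('n)"
  define C where "C = q' * (2 * N - 4 * q)"
  have "q' > 0" using Q[of "v 0"] v0 q by auto
  have C: "C > 0" "4 * C < (N - 2)\<^sup>2" using \<open>q' > 0\<close> q q' by (auto simp: C_def N_def)
  have n0: "CARD('n) > 0" by simp
  have bound: "deriv f (v r) * r\<^sup>2 \<le> C" if pos: "\<And>s. 0 \<le> s \<Longrightarrow> s < R \<Longrightarrow> v s > 0" and r: "0 < r" "r < R" for r R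
  proof -
    have vr: "v r > 0" using pos r by simp
    have le: "v r \<le> v 0"
      by (rule positive_profile_antimono[OF p n0 _ pos]) (use r admissible_pos in \<open>auto intro: less_imp_le\<close>)
    have "r\<^sup>2 / (2 * N - 4 * q) \<le> tail_integral f (v r)"
      unfolding N_def by (rule tail_integral_ge_singular[OF p n0 q pos _ r]) (use Q in auto)
    moreover have "2 * N - 4 * q > 0" using q by (simp add: N_def)
    ultimately have "r\<^sup>2 \<le> tail_integral f (v r) * (2 * N - 4 * q)" by (simp add: divide_le_eq)
    then have "deriv f (v r) * r\<^sup>2 \<le> deriv f (v r) * (tail_integral f (v r) * (2 * N - 4 * q))"
      using admissible_deriv_pos[OF vr] by simp
    also have "\<dots> = (deriv f (v r) * tail_integral f (v r)) * (2 * N - 4 * q)" by simp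
    also have "\<dots> \<le> C" unfolding C_def
      using Q[OF vr le] \<open>2 * N - 4 * q > 0\<close> by (intro mult_right_mono) auto
    finally show ?thesis .
  qed
  have vc: "continuous_on {0..} v" and gc: "continuous_on {0..} g" using p by (auto simp: radial_profile_def)
  have pos: "v r > 0" if "r \<ge> 0" for r
  proof (rule ccontr)
    assume "\<not> v r > 0"
    then have "v r \<le> 0" by simp
    obtain R where R: "R > 0" "v R = 0" "\<And>s. 0 \<le> s \<Longrightarrow> s < R \<Longrightarrow> v s > 0"
      using first_zero[OF vc v0 \<open>r \<ge> 0\<close> \<open>v r \<le> 0\<close>] by metis
    obtain l1 l2 where l: "l1 > 0" "l2 > 0" "l1 + l2 = N - 2" "l1 * l2 = C"
      by (rule quadratic_positive_roots[of "N - 2" C]) (use C n in \<open>auto simp: N_def\<close>)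
    \<comment> \<open>R / 2 stands for any point before the first zero: r^l2 v is nondecreasing,
      positive there and 0 at R.\<close>
    have "(R/2) powr l2 * v (R/2) \<le> R powr l2 * v R"
    proof (rule euler_inequality_mono[where K=g and k="\<lambda>s. - (N * g s + f (v s)) / s" and R=R, OF l(1,2)])
      fix s assume s: "0 < s" "s < R"
      show "(v has_real_derivative s * g s) (at s)" "(g has_real_derivative - (N * g s + f (v s)) / s) (at s)"
        using p s by (auto simp: radial_profile_def N_def)
      have vs: "v s > 0" using R s by simp
      have "f (v s) - f 0 \<le> deriv f (v s) * (v s - 0)"
        by (rule admissible_increment_le) (use vs in auto)
      then have "s\<^sup>2 * f (v s) \<le> s\<^sup>2 * (deriv f (v s) * v s)"
        by (intro mult_left_mono) (auto simp: admissible_zero)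
      also have "\<dots> = (deriv f (v s) * s\<^sup>2) * v s" by simp
      also have "\<dots> \<le> C * v s" using bound[OF R(3) s] vs by (intro mult_right_mono) auto
      finally have "s\<^sup>2 * f (v s) \<le> C * v s" .
      moreover have "s * (- (N * g s + f (v s)) / s) + (2 + l1 + l2) * g s = - f (v s)"
      proof -
        have "2 + l1 + l2 = N" using l(3) by simp
        then show ?thesis using s by simp
      qed
      ultimately show "s\<^sup>2 * (s * (- (N * g s + f (v s)) / s) + (2 + l1 + l2) * g s) + l1 * l2 * v s \<ge> 0"
        by (simp add: l(4))
    qed (use R vc gc in \<open>auto intro: continuous_on_subset\<close>)
    then have "(R/2) powr l2 * v (R/2) \<le> 0" using R by simp
    moreover have "(R/2) powr l2 * v (R/2) > 0" using R by (intro mult_pos_pos) auto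
    ultimately show False by simp
  qed
  define k where "k = (N - 2) / 2"
  have kC: "C < k\<^sup>2" using C by (simp add: k_def power_divide)
  define B where "B = deriv f (v 0)"
  have B: "B > 0" using admissible_deriv_pos[OF v0] by (simp add: B_def)
  \<comment> \<open>Chosen so that f'(v) (\<epsilon> + |x|^2) \<le> B \<epsilon> + C = k^2: the
    bound B pays for the regularisation and C for the tail.\<close>
  define \<epsilon> where "\<epsilon> = (k\<^sup>2 - C) / B"
  have \<epsilon>: "\<epsilon> > 0" "B * \<epsilon> = k\<^sup>2 - C" using kC B by (auto simp: \<epsilon>_def)
  have pot: "deriv f (v (norm x)) \<le> k\<^sup>2 / (\<epsilon> + x \<bullet> x)" for x :: "real^'n"
  proof -
    have "v (norm x) \<le> v 0"
      by (rule positive_profile_antimono[OF p n0, where R="norm x + 1"])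
         (use pos admissible_pos in \<open>auto intro: less_imp_le\<close>)
    then have dB: "deriv f (v (norm x)) \<le> B"
      unfolding B_def using pos[of "norm x"] by (intro admissible_deriv_mono) auto
    have "deriv f (v (norm x)) * (x \<bullet> x) \<le> C"
    proof (cases "x = 0")
      case False
      then show ?thesis using bound[of "norm x + 1" "norm x"] pos by (simp add: power2_norm_eq_inner)
    qed (use C in simp)
    moreover have "deriv f (v (norm x)) * \<epsilon> \<le> B * \<epsilon>" by (rule mult_right_mono[OF dB]) (use \<epsilon> in simp)
    ultimately have "deriv f (v (norm x)) * (\<epsilon> + x \<bullet> x) \<le> k\<^sup>2" using \<epsilon> by (simp add: distrib_left)
    moreover have "\<epsilon> + x \<bullet> x > 0" using \<epsilon> by (simp add: add_pos_nonneg)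
    ultimately show ?thesis by (simp add: le_divide_eq)
  qed
  show ?thesis unfolding stable_solution_def
  proof (intro conjI allI impI)
    show "classical_solution f (\<lambda>x::real^'n. v (norm x))"
      by (rule radial_profile_classical_solution[OF p admissible_continuous])
    fix \<phi> :: "real^'n \<Rightarrow> real" assume \<phi>: "C1_compact_support \<phi>"
    have "0 \<le> (LINT x|lborel. (norm (grad \<phi> x))\<^sup>2 - k\<^sup>2 / (\<epsilon> + x \<bullet> x) * (\<phi> x)\<^sup>2)"
      unfolding k_def N_def by (rule regularised_hardy_inequality[OF \<phi> \<epsilon>(1)]) (use n in simp)
    also have "\<dots> \<le> (LINT x|lborel. (norm (grad \<phi> x))\<^sup>2 - deriv f (v (norm x)) * (\<phi> x)\<^sup>2)"
    proof (rule integral_mono)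
      have "\<epsilon> + x \<bullet> x \<noteq> 0" for x :: "real^'n" using \<epsilon> inner_ge_zero[of x] by linarith
      then show "integrable lborel (\<lambda>x. (norm (grad \<phi> x))\<^sup>2 - k\<^sup>2 / (\<epsilon> + x \<bullet> x) * (\<phi> x)\<^sup>2)"
        by (intro integrable_stability_form[OF \<phi>] continuous_intros) auto
      show "integrable lborel (\<lambda>x. (norm (grad \<phi> x))\<^sup>2 - deriv f (v (norm x)) * (\<phi> x)\<^sup>2)"
        by (rule integrable_stability_form[OF \<phi> continuous_on_deriv_radial[OF p]])
      fix x :: "real^'n"
      show "(norm (grad \<phi> x))\<^sup>2 - k\<^sup>2 / (\<epsilon> + x \<bullet> x) * (\<phi> x)\<^sup>2 \<le> (norm (grad \<phi> x))\<^sup>2 - deriv f (v (norm x)) * (\<phi> x)\<^sup>2"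
        using mult_right_mono[OF pot[of x], of "(\<phi> x)\<^sup>2"] by simp
    qed
    finally show "0 \<le> (LINT x|lborel. (norm (grad \<phi> x))\<^sup>2 - deriv f (v (norm x)) * (\<phi> x)\<^sup>2)" .
  qed
qed

subsection \<open>Instability for large initial values\<close>

text \<open>This is the stability inequality for the test function \<open>u\<^sub>r \<eta>\<close> with \<open>\<eta> = r k (r\<^sup>2)\<close>: as \<open>u\<^sub>r\<close> solves
  the linearised equation up to the term \<open>(N-1) u\<^sub>r / r\<^sup>2\<close>, the form equals
  \<open>\<integral> u\<^sub>r\<^sup>2 (\<eta>'\<^sup>2 - (N-1) \<eta>\<^sup>2 / r\<^sup>2)\<close>. The factor \<open>r\<close> in \<open>\<eta>\<close> makes the test function \<open>C\<^sup>1\<close> at the origin.\<close>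

lemma stable_radial_inequality:
  fixes k k' :: "real \<Rightarrow> real"
  assumes p: "radial_profile (real CARD('n)) f v g"
    and stable: "stable_solution f (\<lambda>x::real^'n::finite. v (norm x))"
    and dk: "\<And>s. s \<ge> 0 \<Longrightarrow> (k has_real_derivative k' s) (at s)"
    and k'c: "continuous_on {0..} k'" and supp: "\<And>s. s > T \<Longrightarrow> k s = 0" and "T \<ge> 0"
  defines "I \<equiv> \<lambda>x::real^'n. (x \<bullet> x) * (g (norm x))\<^sup>2 *
     ((k (x \<bullet> x) + 2 * (x \<bullet> x) * k' (x \<bullet> x))\<^sup>2 - (real CARD('n) - 1) * (k (x \<bullet> x))\<^sup>2)"
  shows "integrable lborel I" "integral\<^sup>L lborel I \<ge> 0"
proof -
  define N where "N = real CARD('n)"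
  have fc: "continuous_on UNIV f" by (rule admissible_continuous)
  have vc: "continuous_on {0..} v" and gc: "continuous_on {0..} g" using p by (auto simp: radial_profile_def)
  have fvc: "continuous_on {0..} (\<lambda>r. f (v r))" by (rule continuous_on_compose2[OF fc vc]) auto
  define \<pi> where "\<pi> = (\<lambda>r. - ((N - 2) * g r + f (v r)))"
  have "has_grad (\<lambda>x::real^'n. g (norm x) * (norm x)\<^sup>2) (\<lambda>x. \<pi> (norm x) *\<^sub>R x)"
  proof (rule has_grad_radial[where w="\<lambda>r. g r * r\<^sup>2"])
    have "((\<lambda>r. g r * r) \<longlongrightarrow> g 0 * 0) (at 0 within {0..})"
      using gc by (intro tendsto_mult tendsto_ident_at) (auto simp: continuous_on_def)
    then have "((\<lambda>r. g r * r) \<longlongrightarrow> 0) (at 0 within {0..})" by simp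
    then show "((\<lambda>r. g r * r\<^sup>2) has_real_derivative 0) (at 0 within {0..})"
      unfolding has_field_derivative_iff
      by (rule Lim_transform_eventually) (auto simp: eventually_at_filter power2_eq_square)
    show "continuous_on {0..} \<pi>" unfolding \<pi>_def by (intro continuous_intros gc fvc)
    fix r :: real assume r: "r > 0"
    have dg: "(g has_real_derivative - (N * g r + f (v r)) / r) (at r)" using p r by (simp add: radial_profile_def N_def)
    show "((\<lambda>r. g r * r\<^sup>2) has_real_derivative r * \<pi> r) (at r)"
      by (rule derivative_eq_intros dg refl)+ (use r in \<open>simp add: \<pi>_def power2_eq_square field_simps\<close>)
  qed
  then have hP: "has_grad (\<lambda>x::real^'n. g (norm x) * (x \<bullet> x)) (\<lambda>x. \<pi> (norm x) *\<^sub>R x)"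
    by (simp add: power2_norm_eq_inner)
  have "continuous_on UNIV (\<lambda>x::real^'n. k' (x \<bullet> x))"
    by (rule continuous_on_compose2[OF k'c]) (auto intro!: continuous_intros)
  then have hK: "has_grad (\<lambda>x::real^'n. k (x \<bullet> x)) (\<lambda>x. k' (x \<bullet> x) *\<^sub>R (2 *\<^sub>R x))"
    by (intro has_grad_compose[OF has_grad_inner_self] dk) auto
  note hU = radial_profile_has_grad[OF p, where 'n='n]
  have "has_grad (\<lambda>x::real^'n. f (v (norm x))) (\<lambda>x. deriv f (v (norm x)) *\<^sub>R (g (norm x) *\<^sub>R x))"
    by (rule has_grad_compose[OF hU admissible_deriv continuous_on_deriv_radial[OF p]])
  note hM = has_grad_add[OF has_grad_cmult[OF hP, of "N - 1"] has_grad_mult[OF this has_grad_inner_self]]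
  obtain D where D: "\<And>i::'n. has_grad (\<lambda>x::real^'n. g (norm x) * x $ i) (D i)"
    "\<And>x. (\<Sum>i\<in>UNIV. D i x $ i) = - f (v (norm x))"
    using radial_profile_grad_components[OF p fc] by blast
  define \<phi> where "\<phi> = (\<lambda>x::real^'n. k (x \<bullet> x) * (g (norm x) * (x \<bullet> x)))"
  define \<Phi> where "\<Phi> = (\<lambda>x::real^'n. (k (x \<bullet> x) * \<pi> (norm x) + 2 * k' (x \<bullet> x) * (g (norm x) * (x \<bullet> x))) *\<^sub>R x)"
  have h\<phi>: "has_grad \<phi> \<Phi>"
    using has_grad_mult[OF hK hP] unfolding \<phi>_def \<Phi>_def by (simp add: scaleR_add_left mult_ac)
  have big: "x \<bullet> x > T" if "norm x > sqrt T" for x :: "real^'n"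
  proof -
    have "(sqrt T)\<^sup>2 < (norm x)\<^sup>2" using that \<open>T \<ge> 0\<close> by (intro power_strict_mono) auto
    then show ?thesis using \<open>T \<ge> 0\<close> by (simp add: power2_norm_eq_inner)
  qed
  have C1: "C1_compact_support \<phi>"
    by (rule C1_compact_supportI[OF h\<phi>, where R="sqrt T"]) (use supp big in \<open>auto simp: \<phi>_def\<close>)
  have gr: "grad \<phi> = \<Phi>" by (rule has_grad_grad[OF h\<phi>])
  \<comment> \<open>M = - r^2 u_rr, so the field k^2 M g x used below is - \<eta>^2 u_r times the
    gradient of u_r, and \<open>dv\<close> is its divergence. Subtracting it from u_r^2 \<eta>'^2 -
    (N-1) u_r^2 \<eta>^2 / r^2 leaves the stability form.\<close>
  define M where "M = (\<lambda>x::real^'n. (N - 1) * (g (norm x) * (x \<bullet> x)) + f (v (norm x)) * (x \<bullet> x))"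
  define \<mu> where "\<mu> = (\<lambda>x::real^'n. (N - 1) * \<pi> (norm x) + 2 * f (v (norm x)) + (x \<bullet> x) * deriv f (v (norm x)) * g (norm x))"
  have hM': "has_grad M (\<lambda>x. \<mu> x *\<^sub>R x)"
    using hM unfolding M_def \<mu>_def by (simp add: scaleR_add_left mult_ac add.assoc)
  note hV = has_grad_mult[OF has_grad_mult[OF hK hK] has_grad_mult[OF hM' D(1)]]
  note div = integral_divergence_zero[where V="\<lambda>i x. k (x \<bullet> x) * k (x \<bullet> x) * (M x * (g (norm x) * x $ i))" and R="sqrt T", OF hV]
  define dv where "dv = (\<lambda>x. - (k (x \<bullet> x))\<^sup>2 * M x * f (v (norm x)) + (k (x \<bullet> x))\<^sup>2 * g (norm x) * \<mu> x * (x \<bullet> x)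
     + 4 * k (x \<bullet> x) * k' (x \<bullet> x) * M x * g (norm x) * (x \<bullet> x))"
  have div_eq: "(\<Sum>i\<in>UNIV. ((k (x \<bullet> x) * k (x \<bullet> x)) *\<^sub>R (M x *\<^sub>R D i x + (g (norm x) * x $ i) *\<^sub>R (\<mu> x *\<^sub>R x)) +
       (M x * (g (norm x) * x $ i)) *\<^sub>R
       (k (x \<bullet> x) *\<^sub>R (k' (x \<bullet> x) *\<^sub>R (2 *\<^sub>R x)) + k (x \<bullet> x) *\<^sub>R (k' (x \<bullet> x) *\<^sub>R (2 *\<^sub>R x)))) $ i) = dv x" (is "?l = _") for x :: "real^'n"
  proof -
    have "?l = (\<Sum>i\<in>UNIV. (k (x \<bullet> x))\<^sup>2 * M x * D i x $ i + (k (x \<bullet> x))\<^sup>2 * g (norm x) * \<mu> x * (x $ i * x $ i)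
       + 4 * k (x \<bullet> x) * k' (x \<bullet> x) * M x * g (norm x) * (x $ i * x $ i))"
      by (intro sum.cong) (auto simp: power2_eq_square algebra_simps)
    also have "\<dots> = (k (x \<bullet> x))\<^sup>2 * M x * (\<Sum>i\<in>UNIV. D i x $ i) + (k (x \<bullet> x))\<^sup>2 * g (norm x) * \<mu> x * (x \<bullet> x)
       + 4 * k (x \<bullet> x) * k' (x \<bullet> x) * M x * g (norm x) * (x \<bullet> x)"
      by (simp add: sum.distrib inner_vec_def flip: sum_distrib_left)
    finally show ?thesis by (simp add: D(2) dv_def)
  qed
  have div_int: "integrable lborel dv" "integral\<^sup>L lborel dv = 0"
    using div big supp unfolding div_eq by auto
  have id: "(norm (\<Phi> x))\<^sup>2 - deriv f (v (norm x)) * (\<phi> x)\<^sup>2 = I x - dv x" for x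
  proof -
    define s \<gamma> F d \<kappa> \<kappa>' where "s = x \<bullet> x" and "\<gamma> = g (norm x)" and "F = f (v (norm x))" and "d = deriv f (v (norm x))"
      and "\<kappa> = k s" and "\<kappa>' = k' s"
    have "(norm (\<Phi> x))\<^sup>2 = (\<kappa> * (- ((N - 2) * \<gamma> + F)) + 2 * \<kappa>' * (\<gamma> * s))\<^sup>2 * s"
      by (simp add: \<Phi>_def \<pi>_def power_mult_distrib power2_norm_eq_inner s_def \<gamma>_def F_def \<kappa>_def \<kappa>'_def)
    moreover have "\<phi> x = \<kappa> * (\<gamma> * s)" by (simp add: \<phi>_def s_def \<gamma>_def \<kappa>_def)
    moreover have "I x = s * \<gamma>\<^sup>2 * ((\<kappa> + 2 * s * \<kappa>')\<^sup>2 - (N - 1) * \<kappa>\<^sup>2)"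
      by (simp add: I_def s_def \<gamma>_def \<kappa>_def \<kappa>'_def N_def)
    moreover have "dv x = - \<kappa>\<^sup>2 * ((N - 1) * (\<gamma> * s) + F * s) * F
       + \<kappa>\<^sup>2 * \<gamma> * ((N - 1) * (- ((N - 2) * \<gamma> + F)) + 2 * F + s * d * \<gamma>) * s
       + 4 * \<kappa> * \<kappa>' * ((N - 1) * (\<gamma> * s) + F * s) * \<gamma> * s"
      by (simp add: dv_def M_def \<mu>_def \<pi>_def s_def \<gamma>_def F_def d_def \<kappa>_def \<kappa>'_def)
    ultimately show ?thesis
      unfolding d_def[symmetric] by (simp only:) (simp add: power2_eq_square algebra_simps)
  qed
  have form: "integrable lborel (\<lambda>x. I x - dv x)" "0 \<le> (LINT x|lborel. I x - dv x)"
    using integrable_stability_form[OF C1 continuous_on_deriv_radial[OF p]]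
      stable[unfolded stable_solution_def, THEN conjunct2, rule_format, OF C1]
    unfolding gr id by auto
  have "integrable lborel (\<lambda>x. (I x - dv x) + dv x)" using form div_int by (intro Bochner_Integration.integrable_add)
  then show I: "integrable lborel I" by simp
  show "integral\<^sup>L lborel I \<ge> 0" using form(2) I div_int by simp
qed

text \<open>The weight \<open>(e + s)\<^sup>-\<^sup>b\<close>, with \<open>2 b - 1 = a = sqrt (N-1)\<close>, corresponds to \<open>\<eta> = r (e + r\<^sup>2)\<^sup>-\<^sup>b\<close>, for which
  \<open>|r \<eta>'| \<le> a \<eta>\<close>: only the cut-off region \<open>S \<le> r\<^sup>2 \<le> 2 S\<close> contributes positively.\<close>

lemma stable_slope_inequality:
  assumes p: "radial_profile (real CARD('n)) f v g" and N3: "CARD('n) \<ge> 3"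
    and stable: "stable_solution f (\<lambda>x::real^'n::finite. v (norm x))"
    and e: "0 < e" "e \<le> S" and "\<gamma> \<ge> 0"
    and lower: "\<And>r. 0 \<le> r \<Longrightarrow> r\<^sup>2 \<le> e \<Longrightarrow> \<gamma> \<le> - g r"
    and upper: "\<And>r. 0 \<le> r \<Longrightarrow> S \<le> r\<^sup>2 \<Longrightarrow> r\<^sup>2 \<le> 2 * S \<Longrightarrow> \<bar>g r\<bar> \<le> G"
  defines "a \<equiv> sqrt (real CARD('n) - 1)"
  shows "(real CARD('n) - 2) / 16 * 2 powr (- (a + 1)) * \<gamma>\<^sup>2 * e powr (real CARD('n) / 2 - a)
     \<le> 2 * S * (S powr (- ((a + 1) / 2)))\<^sup>2 * (18 + a)\<^sup>2 * (sqrt (2 * S)) ^ CARD('n) * G\<^sup>2"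
proof -
  define N where "N = real CARD('n)"
  define b where "b = (a + 1) / 2"
  have N3': "N \<ge> 3" using N3 by (simp add: N_def)
  have a: "a > 1" "a\<^sup>2 = N - 1" using N3' by (auto simp: a_def N_def)
  have b: "2 * b = a + 1" "b > 0" using a by (auto simp: b_def)
  have S: "S > 0" using e by simp
  \<comment> \<open>m is 0 up to S and at least 1 from 2 S on, so \<zeta> falls from 1 to 0 in
    between; the two squared positive parts make it C^1.\<close>
  define m where "m = (\<lambda>s. max 0 ((s - S) / S))"
  define \<zeta> where "\<zeta> = (\<lambda>s. (max 0 (1 - (m s)\<^sup>2))\<^sup>2)"
  define \<zeta>' where "\<zeta>' = (\<lambda>s. 2 * max 0 (1 - (m s)\<^sup>2) * (- (2 * m s / S)))"
  define w where "w = (\<lambda>s. (e + s) powr (- b))"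
  define k where "k = (\<lambda>s. w s * \<zeta> s)"
  define k' where "k' = (\<lambda>s. (- b * (e + s) powr (- b - 1)) * \<zeta> s + w s * \<zeta>' s)"
  have d\<zeta>: "(\<zeta> has_real_derivative \<zeta>' s) (at s)" for s
  proof -
    have "((\<lambda>s. (s - S) / S) has_real_derivative 1 / S) (at s)"
      using S by (auto intro!: derivative_eq_intros)
    from DERIV_chain2[OF DERIV_max_0_square this]
    have "((\<lambda>s. (m s)\<^sup>2) has_real_derivative 2 * m s / S) (at s)" by (simp add: m_def)
    from DERIV_diff[OF DERIV_const this]
    have "((\<lambda>s. 1 - (m s)\<^sup>2) has_real_derivative - (2 * m s / S)) (at s)" by simp
    from DERIV_chain2[OF DERIV_max_0_square this] show ?thesis by (simp add: \<zeta>_def \<zeta>'_def)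
  qed
  have dk: "(k has_real_derivative k' s) (at s)" if "s \<ge> 0" for s
  proof -
    have "e + s > 0" using e that by simp
    have "((\<lambda>s. e + s) has_real_derivative 1) (at s)" by (auto intro!: derivative_eq_intros)
    from DERIV_chain2[OF has_real_derivative_powr[OF \<open>e + s > 0\<close>] this, of "- b"]
    have "(w has_real_derivative - b * (e + s) powr (- b - 1)) (at s)" by (simp add: w_def)
    from DERIV_mult[OF this d\<zeta>] show ?thesis unfolding k_def k'_def by (rule DERIV_cong) simp
  qed
  have mc: "continuous_on {0..} m" unfolding m_def using S by (intro continuous_intros) auto
  have k'c: "continuous_on {0..} k'"
    unfolding k'_def w_def \<zeta>_def \<zeta>'_def using e S by (intro continuous_intros mc) auto
  have supp: "k s = 0" if "s > 2 * S" for s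
  proof -
    have "(s - S) / S > 1" using that S by simp
    then have "m s > 1" by (simp add: m_def)
    then have "(m s)\<^sup>2 > 1" by simp
    then show ?thesis by (simp add: k_def \<zeta>_def)
  qed
  define I where "I = (\<lambda>x::real^'n. (x \<bullet> x) * (g (norm x))\<^sup>2 *
     ((k (x \<bullet> x) + 2 * (x \<bullet> x) * k' (x \<bullet> x))\<^sup>2 - (real CARD('n) - 1) * (k (x \<bullet> x))\<^sup>2))"
  have "2 * S \<ge> 0" using S by simp
  note I = stable_radial_inequality[OF p stable dk k'c supp this, folded I_def]
  have wpow: "(e + s) powr (- b - 1) = w s / (e + s)" if "s \<ge> 0" for s
    using e that by (simp add: w_def powr_diff)
  \<comment> \<open>With t = s / (e + s) in [0, 1] this is the sign of r^2 \<eta>'^2 - a^2 \<eta>^2.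
    It factors as a difference of squares and vanishes exactly at t = 1, which is why 2 b = a +
    1.\<close>
  have quad: "(1 - (a + 1) * t)\<^sup>2 - a\<^sup>2 = - ((a - 1 + (a + 1) * t) * (a + 1) * (1 - t))" for t :: real
    by (simp add: power2_eq_square algebra_simps)
  have inner: "(k s + 2 * s * k' s)\<^sup>2 - (N - 1) * (k s)\<^sup>2 = - ((w s)\<^sup>2 * ((a - 1 + (a + 1) * (s / (e + s))) * (a + 1) * (1 - s / (e + s))))"
    if "0 \<le> s" "s \<le> S" for s
  proof -
    have "(s - S) / S \<le> 0" using that S by (simp add: divide_nonpos_pos)
    then have "m s = 0" by (simp add: m_def)
    then have z: "\<zeta> s = 1" "\<zeta>' s = 0" by (auto simp: \<zeta>_def \<zeta>'_def)
    have "k s + 2 * s * k' s = w s * (1 - 2 * b * (s / (e + s)))"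
      by (simp add: k_def k'_def z wpow[OF that(1)] algebra_simps)
    then have 1: "k s + 2 * s * k' s = w s * (1 - (a + 1) * (s / (e + s)))" by (simp only: b(1))
    have 2: "k s = w s" by (simp add: k_def z)
    have "(k s + 2 * s * k' s)\<^sup>2 - (N - 1) * (k s)\<^sup>2 = (w s)\<^sup>2 * ((1 - (a + 1) * (s / (e + s)))\<^sup>2 - a\<^sup>2)"
      unfolding 1 unfolding 2 a(2) power_mult_distrib by (simp only: right_diff_distrib mult.commute)
    also have "\<dots> = - ((w s)\<^sup>2 * ((a - 1 + (a + 1) * (s / (e + s))) * (a + 1) * (1 - s / (e + s))))"
      unfolding quad by simp
    finally show ?thesis .
  qed
  have ratio: "0 \<le> s / (e + s)" "s / (e + s) \<le> 1" if "0 \<le> s" for s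
    using that e by (auto simp: divide_le_eq)
  \<comment> \<open>A bounds the integrand above on the cut-off region, and - B bounds it above on e
    / 4 \<le> |x|^2 \<le> e. The lower radius is needed because the integrand carries a factor
    |x|^2; there t \<le> 1/2 yields (a - 1) (a + 1) / 2 = (N - 2) / 2.\<close>
  define A where "A = 2 * S * G\<^sup>2 * ((S powr (- b))\<^sup>2 * (18 + a)\<^sup>2)"
  define B where "B = e / 4 * \<gamma>\<^sup>2 * (((2 * e) powr (- b))\<^sup>2 * ((N - 2) / 2))"
  have A0: "A \<ge> 0" using S by (simp add: A_def)
  have I1: "I x \<le> 0" if "x \<bullet> x \<le> S" for x
  proof -
    have "0 \<le> (w (x \<bullet> x))\<^sup>2 * ((a - 1 + (a + 1) * ((x \<bullet> x) / (e + x \<bullet> x))) * (a + 1) * (1 - (x \<bullet> x) / (e + x \<bullet> x)))"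
      using ratio[of "x \<bullet> x"] a by (intro mult_nonneg_nonneg add_nonneg_nonneg) auto
    then have "(k (x \<bullet> x) + 2 * (x \<bullet> x) * k' (x \<bullet> x))\<^sup>2 - (N - 1) * (k (x \<bullet> x))\<^sup>2 \<le> 0"
      using inner[of "x \<bullet> x"] that by simp
    then show ?thesis unfolding I_def N_def by (intro mult_nonneg_nonpos) auto
  qed
  have I2: "I x \<le> - B" if x: "e / 4 \<le> x \<bullet> x" "x \<bullet> x \<le> e" for x
  proof -
    let ?s = "x \<bullet> x"
    have s0: "?s \<ge> 0" by simp
    have r: "?s / (e + ?s) \<le> 1 / 2" using x e by (simp add: divide_le_eq)
    have "(a - 1) * (a + 1) * (1 / 2) \<le> (a - 1 + (a + 1) * (?s / (e + ?s))) * (a + 1) * (1 - ?s / (e + ?s))"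
    proof -
      have *: "(a - 1) * (a + 1) * (1 / 2) \<le> (a - 1 + (a + 1) * t) * (a + 1) * (1 - t)" if "0 \<le> t" "t \<le> 1 / 2" for t
        using a that by (intro mult_mono) auto
      show ?thesis by (rule *[OF ratio(1)[OF s0] r])
    qed
    moreover have "(a - 1) * (a + 1) = N - 2" using a(2) by (simp add: power2_eq_square algebra_simps)
    moreover have "((2 * e) powr (- b))\<^sup>2 \<le> (w ?s)\<^sup>2"
      unfolding w_def using x e b by (intro power_mono powr_mono2') auto
    ultimately have 1: "((2 * e) powr (- b))\<^sup>2 * ((N - 2) / 2) \<le> (w ?s)\<^sup>2 * ((a - 1 + (a + 1) * (?s / (e + ?s))) * (a + 1) * (1 - ?s / (e + ?s)))"
      using N3' by (intro mult_mono) auto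
    have "\<gamma> \<le> - g (norm x)" using lower[of "norm x"] x by (simp add: power2_norm_eq_inner)
    then have "\<gamma>\<^sup>2 \<le> (g (norm x))\<^sup>2" using \<open>\<gamma> \<ge> 0\<close> power_mono[of \<gamma> "- g (norm x)" 2] by simp
    then have 2: "e / 4 * \<gamma>\<^sup>2 \<le> ?s * (g (norm x))\<^sup>2" using x e by (intro mult_mono) auto
    have "B \<le> (?s * (g (norm x))\<^sup>2) * ((w ?s)\<^sup>2 * ((a - 1 + (a + 1) * (?s / (e + ?s))) * (a + 1) * (1 - ?s / (e + ?s))))"
      unfolding B_def using e N3' by (intro mult_mono 1 2) auto
    also have "\<dots> = - I x" using inner[of ?s] x e by (simp add: I_def N_def)
    finally show ?thesis by simp
  qed
  \<comment> \<open>The constant 18 + a splits into 2 + a for |1 - 2 b t| and 16 for the cut-off, as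
    |2 s \<zeta>'| \<le> 2 (2 S) (4 / S).\<close>
  have I3: "I x \<le> A" if x: "S \<le> x \<bullet> x" "x \<bullet> x \<le> 2 * S" for x
  proof -
    let ?s = "x \<bullet> x"
    have s0: "?s \<ge> 0" by simp
    have m01: "0 \<le> m ?s" "m ?s \<le> 1" using x S by (auto simp: m_def divide_le_eq)
    then have m2: "(m ?s)\<^sup>2 \<le> 1" by (simp add: power_le_one)
    then have mx: "0 \<le> max 0 (1 - (m ?s)\<^sup>2)" "max 0 (1 - (m ?s)\<^sup>2) \<le> 1" by auto
    have z: "0 \<le> \<zeta> ?s" "\<zeta> ?s \<le> 1" unfolding \<zeta>_def using mx by (auto intro: power_le_one)
    have "\<bar>\<zeta>' ?s\<bar> = 4 / S * (max 0 (1 - (m ?s)\<^sup>2) * m ?s)"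
      unfolding \<zeta>'_def using m01 mx S by (simp add: abs_mult)
    also have "\<dots> \<le> 4 / S * (1 * 1)" using m01 mx S by (intro mult_left_mono mult_mono) auto
    finally have z': "\<bar>\<zeta>' ?s\<bar> \<le> 4 / S" by simp
    have "\<bar>2 * ?s * \<zeta>' ?s\<bar> = 2 * ?s * \<bar>\<zeta>' ?s\<bar>" by (simp add: abs_mult)
    also have "\<dots> \<le> 2 * (2 * S) * (4 / S)" using x z' S by (intro mult_mono) auto
    finally have z2: "\<bar>2 * ?s * \<zeta>' ?s\<bar> \<le> 16" using S by simp
    have "\<bar>(1 - 2 * b * (?s / (e + ?s))) * \<zeta> ?s\<bar> \<le> (2 + a) * 1"
      unfolding abs_mult
    proof (rule mult_mono)
      have "0 \<le> 2 * b * (?s / (e + ?s))" "2 * b * (?s / (e + ?s)) \<le> 2 * b * 1"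
        using ratio[OF s0] b(2) by (intro mult_nonneg_nonneg mult_left_mono; simp)+
      then show "\<bar>1 - 2 * b * (?s / (e + ?s))\<bar> \<le> 2 + a" using b(1) a(1) unfolding abs_le_iff by linarith
    qed (use z a in auto)
    from order_trans[OF abs_triangle_ineq add_mono[OF this z2]]
    have "\<bar>(1 - 2 * b * (?s / (e + ?s))) * \<zeta> ?s + 2 * ?s * \<zeta>' ?s\<bar> \<le> 18 + a" by simp
    moreover have w0: "0 \<le> w ?s" "w ?s \<le> S powr (- b)"
      unfolding w_def using x e S b by (auto intro!: powr_mono2')
    moreover have eq: "k ?s + 2 * ?s * k' ?s = w ?s * ((1 - 2 * b * (?s / (e + ?s))) * \<zeta> ?s + 2 * ?s * \<zeta>' ?s)"
      by (simp add: k_def k'_def wpow[OF s0] algebra_simps)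
    ultimately have "\<bar>k ?s + 2 * ?s * k' ?s\<bar> \<le> S powr (- b) * (18 + a)"
      unfolding eq abs_mult by (intro mult_mono) auto
    then have "(k ?s + 2 * ?s * k' ?s)\<^sup>2 \<le> (S powr (- b) * (18 + a))\<^sup>2"
      by (metis abs_ge_zero power2_abs power_mono)
    moreover have "(N - 1) * (k ?s)\<^sup>2 \<ge> 0" using N3' by simp
    ultimately have 1: "(k ?s + 2 * ?s * k' ?s)\<^sup>2 - (N - 1) * (k ?s)\<^sup>2 \<le> (S powr (- b))\<^sup>2 * (18 + a)\<^sup>2"
      by (simp add: power_mult_distrib)
    have "\<bar>g (norm x)\<bar> \<le> G" using upper[of "norm x"] x by (simp add: power2_norm_eq_inner)
    then have "(g (norm x))\<^sup>2 \<le> G\<^sup>2" by (metis abs_ge_zero power2_abs power_mono)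
    then have 2: "?s * (g (norm x))\<^sup>2 \<le> 2 * S * G\<^sup>2" using x S by (intro mult_mono) auto
    have "I x \<le> (?s * (g (norm x))\<^sup>2) * ((S powr (- b))\<^sup>2 * (18 + a)\<^sup>2)"
      unfolding I_def by (intro mult_left_mono 1[unfolded N_def]) auto
    also have "\<dots> \<le> A" unfolding A_def by (intro mult_right_mono 2) auto
    finally show ?thesis .
  qed
  have I4: "I x = 0" if x: "x \<bullet> x > 2 * S" for x
  proof -
    have "k' (x \<bullet> x) = 0"
    proof -
      have "m (x \<bullet> x) \<ge> 1" using x S by (simp add: m_def le_divide_eq)
      then have "max 0 (1 - (m (x \<bullet> x))\<^sup>2) = 0" by simp
      then show ?thesis by (simp add: k'_def \<zeta>_def \<zeta>'_def)
    qed
    then show ?thesis using supp[OF x] by (simp add: I_def)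
  qed
  have ball_iff: "x \<in> cball 0 (sqrt t) \<longleftrightarrow> x \<bullet> x \<le> t" if "t \<ge> 0" for x :: "real^'n" and t
    using that real_le_rsqrt[of "norm x" t] real_le_lsqrt[of t "norm x"]
    by (auto simp: power2_norm_eq_inner norm_eq_sqrt_inner)
  have ind: "integrable lborel (indicator (cball (0::real^'n) r) :: _ \<Rightarrow> real)" for r
    using emeasure_bounded_finite[of "cball (0::real^'n) r"] by (intro integrable_real_indicator) auto
  define \<omega> where "\<omega> = measure lborel (ball (0::real^'n) 1)"
  have \<omega>: "\<omega> > 0" using content_ball_pos[of 1 "0::real^'n"] by (simp add: \<omega>_def)
  have "0 \<le> integral\<^sup>L lborel I" using I by simp
  also have "\<dots> \<le> (LINT x|lborel. A * indicator (cball (0::real^'n) (sqrt (2 * S))) x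
      - B * (indicator (cball 0 (sqrt e)) x - indicator (cball 0 (sqrt (e / 4))) x))"
  proof (rule integral_mono[OF I(1)])
    fix x :: "real^'n"
    have B0: "B \<ge> 0" unfolding B_def using e N3' by auto
    consider "x \<bullet> x \<le> e / 4" | "e / 4 < x \<bullet> x" "x \<bullet> x \<le> e" | "e < x \<bullet> x" "x \<bullet> x \<le> S" | "S < x \<bullet> x" "x \<bullet> x \<le> 2 * S" | "2 * S < x \<bullet> x"
      by linarith
    moreover have i: "indicator (cball 0 (sqrt t)) x = (if x \<bullet> x \<le> t then 1 else 0 :: real)" if "t \<ge> 0" for t
      unfolding indicator_def ball_iff[OF that] by simp
    have "2 * S \<ge> 0" "e \<ge> 0" "e / 4 \<ge> 0" using e S by auto
    note i = this[THEN i]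
    ultimately show "I x \<le> A * indicator (cball 0 (sqrt (2 * S))) x - B * (indicator (cball 0 (sqrt e)) x - indicator (cball 0 (sqrt (e / 4))) x)"
      unfolding i using e S A0 I1[of x] I2[of x] I3[of x] I4[of x] by cases auto
  qed (use ind in auto)
  also have "\<dots> = A * ((sqrt (2 * S)) ^ CARD('n) * \<omega>) - B * ((sqrt e) ^ CARD('n) * \<omega> - (sqrt (e / 4)) ^ CARD('n) * \<omega>)"
    using ind e S by (simp add: measure_cball_scaling \<omega>_def del: real_sqrt_mult real_sqrt_divide)
  also have "\<dots> \<le> A * ((sqrt (2 * S)) ^ CARD('n) * \<omega>) - B * ((sqrt e) ^ CARD('n) * \<omega> / 2)"
  proof -
    have "sqrt (e / 4) = sqrt e * (1 / 2)" by (simp add: real_sqrt_divide)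
    then have "(sqrt (e / 4)) ^ CARD('n) = (sqrt e) ^ CARD('n) * (1 / 2) ^ CARD('n)" by (simp only: power_mult_distrib)
    also have "\<dots> \<le> (sqrt e) ^ CARD('n) * (1 / 2) ^ 1"
      using e N3 by (intro mult_left_mono power_decreasing) auto
    finally have "(sqrt (e / 4)) ^ CARD('n) * \<omega> \<le> (sqrt e) ^ CARD('n) * \<omega> / 2" using \<omega> by simp
    moreover have "B \<ge> 0" unfolding B_def using e N3' by auto
    ultimately show ?thesis by (intro diff_left_mono mult_left_mono) linarith+
  qed
  finally have "B * (sqrt e) ^ CARD('n) / 2 * \<omega> \<le> A * (sqrt (2 * S)) ^ CARD('n) * \<omega>" by simp
  then have main: "B * (sqrt e) ^ CARD('n) / 2 \<le> A * (sqrt (2 * S)) ^ CARD('n)" using \<omega> by (simp only: mult_le_cancel_right_pos)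
  have "(sqrt e) ^ CARD('n) = e powr (N / 2)"
    using e by (simp add: powr_half_sqrt[symmetric] powr_power N_def)
  moreover have "((2 * e) powr (- b))\<^sup>2 = 2 powr (- (a + 1)) * e powr (- (a + 1))"
  proof -
    have "((2 * e) powr (- b))\<^sup>2 = (2 * e) powr (- b + - b)" unfolding power2_eq_square powr_add ..
    also have "- b + - b = - (a + 1)" using b(1) by simp
    finally show ?thesis using e by (simp add: powr_mult)
  qed
  moreover have "e * e powr (- (a + 1)) * e powr (N / 2) = e powr (N / 2 - a)"
  proof -
    have "e powr 1 * e powr (- (a + 1)) * e powr (N / 2) = e powr (N / 2 - a)" unfolding powr_add[symmetric] by simp
    then show ?thesis using e by simp
  qed
  moreover have "e / 4 * \<gamma>\<^sup>2 * ((P * Q) * ((N - 2) / 2)) * T / 2 = (N - 2) / 16 * P * \<gamma>\<^sup>2 * (e * Q * T)" for P Q T :: real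
    by simp
  ultimately have "B * (sqrt e) ^ CARD('n) / 2 = (N - 2) / 16 * 2 powr (- (a + 1)) * \<gamma>\<^sup>2 * e powr (N / 2 - a)"
    unfolding B_def by presburger
  moreover have "A * (sqrt (2 * S)) ^ CARD('n) = 2 * S * (S powr (- ((a + 1) / 2)))\<^sup>2 * (18 + a)\<^sup>2 * (sqrt (2 * S)) ^ CARD('n) * G\<^sup>2"
    by (simp add: A_def b_def)
  ultimately show ?thesis using main unfolding N_def by presburger
qed

section \<open>Slope estimates for globally positive solutions\<close>

lemma positive_profile_slope_le:
  assumes p: "radial_profile (real n) f v g" and n: "n > 0"
    and pos: "\<And>s. 0 \<le> s \<Longrightarrow> v s > 0" and r: "0 \<le> r"
  shows "- g r \<le> f (v 0) / n"
proof (cases "r = 0")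
  case True
  then show ?thesis using p by (simp add: radial_profile_def)
next
  case False
  have gc: "continuous_on {0..r} g" using p by (auto simp: radial_profile_def intro: continuous_on_subset)
  have "0 ^ n * (g 0 + f (v 0) / n) \<le> r ^ n * (g r + f (v 0) / n)"
  proof (rule DERIV_nonneg_imp_increasing_open[where f="\<lambda>s. s ^ n * (g s + f (v 0) / n)"])
    fix s assume s: "0 < s" "s < r"
    have dg: "(g has_real_derivative - (n * g s + f (v s)) / s) (at s)"
      using p s by (auto simp: radial_profile_def)
    define y where "y = s ^ (n - 1) * (f (v 0) - f (v s))"
    have sn: "s ^ n = s * s ^ (n - 1)" using n by (simp add: power_eq_if)
    have "((\<lambda>s. s ^ n * (g s + f (v 0) / n)) has_real_derivative y) (at s)"
      by (rule DERIV_cong[OF DERIV_mult[OF DERIV_pow DERIV_add[OF dg DERIV_const]]])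
        (use s n in \<open>simp add: y_def sn field_simps\<close>)
    moreover have "v s \<le> v 0"
      by (rule positive_profile_antimono[OF p n, where R="r"])
         (use pos s admissible_pos in \<open>auto intro: less_imp_le\<close>)
    then have "f (v s) \<le> f (v 0)" using pos[of s] s by (intro admissible_mono) auto
    then have "y \<ge> 0" using s by (simp add: y_def)
    ultimately show "\<exists>y. ((\<lambda>s. s ^ n * (g s + f (v 0) / n)) has_real_derivative y) (at s) \<and> 0 \<le> y" by blast
  qed (use r gc n in \<open>auto intro!: continuous_intros\<close>)
  then have "0 \<le> r ^ n * (g r + f (v 0) / n)" unfolding zero_power[OF n] mult_zero_left .
  moreover have "r ^ n > 0" using r False by simp
  ultimately have "0 \<le> g r + f (v 0) / n" by (simp only: zero_le_mult_iff) auto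
  then show ?thesis by simp
qed

text \<open>n / f'(v 0) is the square of the core radius: the derivative of f (v) in r is at least -
  f'(v 0) f (v 0) r / n, so within the core f (v) loses at most half of its central value, and - g
  \<ge> f (v) / n.\<close>

lemma positive_profile_slope_ge_center:
  assumes p: "radial_profile (real n) f v g" and n: "n > 0"
    and pos: "\<And>s. 0 \<le> s \<Longrightarrow> v s > 0" and r: "0 \<le> r" "r\<^sup>2 \<le> n / deriv f (v 0)"
  shows "f (v 0) / (2 * real n) \<le> - g r"
proof -
  have vc: "continuous_on {0..r} v" using p by (auto simp: radial_profile_def intro: continuous_on_subset)
  have fvc: "continuous_on {0..r} (\<lambda>s. f (v s))"
    by (rule continuous_on_compose2[OF admissible_continuous[of UNIV] vc]) auto
  define d where "d = deriv f (v 0)"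
  have d: "d > 0" using admissible_deriv_pos pos[of 0] by (simp add: d_def)
  have "f (v 0) + d * f (v 0) / n * (0\<^sup>2 / 2) \<le> f (v r) + d * f (v 0) / n * (r\<^sup>2 / 2)"
  proof (rule DERIV_nonneg_imp_increasing_open[where f="\<lambda>s. f (v s) + d * f (v 0) / n * (s\<^sup>2 / 2)"])
    fix s assume s: "0 < s" "s < r"
    have dv: "(v has_real_derivative s * g s) (at s)" using p s by (auto simp: radial_profile_def)
    have dfv: "((\<lambda>s. f (v s)) has_real_derivative deriv f (v s) * (s * g s)) (at s)"
      by (rule DERIV_chain2[OF admissible_deriv dv])
    define y where "y = deriv f (v s) * (s * g s) + d * f (v 0) / n * s"
    have "((\<lambda>s. f (v s) + d * f (v 0) / n * (s\<^sup>2 / 2)) has_real_derivative y) (at s)"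
    proof -
      have "((\<lambda>s. s\<^sup>2 / 2) has_real_derivative s) (at s)" by (auto intro!: derivative_eq_intros)
      from DERIV_add[OF dfv DERIV_cmult[OF this]] show ?thesis unfolding y_def .
    qed
    moreover have "y \<ge> 0"
    proof -
      have vs: "v s > 0" using pos s by simp
      have "v s \<le> v 0"
        by (rule positive_profile_antimono[OF p n, where R="r"])
           (use pos s admissible_pos in \<open>auto intro: less_imp_le\<close>)
      then have "deriv f (v s) \<le> d" unfolding d_def using vs by (intro admissible_deriv_mono) auto
      moreover have g: "- g s \<le> f (v 0) / n" using positive_profile_slope_le[OF p n pos] s by simp
      moreover have "0 \<le> - g s"
        using positive_profile_nonpos[OF p n, of r s] pos s admissible_pos by (simp add: less_imp_le)
      ultimately have "deriv f (v s) * (- g s) \<le> d * (f (v 0) / n)"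
        using d by (intro mult_mono) auto
      then have "s * (deriv f (v s) * (- g s)) \<le> s * (d * (f (v 0) / n))" using s by (intro mult_left_mono) auto
      then show ?thesis by (simp add: y_def algebra_simps)
    qed
    ultimately show "\<exists>y. ((\<lambda>s. f (v s) + d * f (v 0) / n * (s\<^sup>2 / 2)) has_real_derivative y) (at s) \<and> 0 \<le> y" by blast
  qed (use r fvc n in \<open>auto intro!: continuous_intros\<close>)
  moreover have "d * f (v 0) / n * (r\<^sup>2 / 2) \<le> f (v 0) / 2"
  proof -
    have "d * r\<^sup>2 \<le> n" using r(2) d by (simp add: d_def le_divide_eq mult.commute)
    then have "d * r\<^sup>2 / n \<le> 1" using n by simp
    then have "f (v 0) / 2 * (d * r\<^sup>2 / n) \<le> f (v 0) / 2 * 1"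
      using admissible_pos[OF pos[of 0]] by (intro mult_left_mono) auto
    then show ?thesis by (simp add: mult_ac)
  qed
  ultimately have "f (v 0) / 2 \<le> f (v r)" unfolding zero_power2 by linarith
  then have "f (v 0) / 2 / n \<le> f (v r) / n" by (intro divide_right_mono) auto
  also have "\<dots> \<le> - g r" by (rule positive_profile_slope[OF p n, where R="r + 1"]) (use pos r in auto)
  finally show ?thesis by simp
qed

text \<open>The derivative of F (v) is s (- g / f (v)) \<ge> s / n. The constant 2 n is cruder than
  the 2 n - 4 q of the singular solution, but no condition on q is needed, and for the decay
  estimate only the power r^2 counts.\<close>

lemma positive_profile_tail_integral_ge:
  assumes p: "radial_profile (real n) f v g" and n: "n > 0"
    and pos: "\<And>s. 0 \<le> s \<Longrightarrow> v s > 0" and r: "0 \<le> r"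
  shows "r\<^sup>2 / (2 * real n) \<le> tail_integral f (v r)"
proof -
  have vc: "continuous_on {0..r} v" using p by (auto simp: radial_profile_def intro: continuous_on_subset)
  have "continuous_on {0<..} (tail_integral f)"
    by (intro continuous_at_imp_continuous_on ballI DERIV_isCont[OF tail_integral_deriv]) auto
  then have Fvc: "continuous_on {0..r} (\<lambda>s. tail_integral f (v s))"
    by (rule continuous_on_compose2[OF _ vc]) (use pos in auto)
  have "tail_integral f (v 0) - 0\<^sup>2 / (2 * real n) \<le> tail_integral f (v r) - r\<^sup>2 / (2 * real n)"
  proof (rule DERIV_nonneg_imp_increasing_open[where f="\<lambda>s. tail_integral f (v s) - s\<^sup>2 / (2 * real n)"])
    fix s assume s: "0 < s" "s < r"
    have vs: "v s > 0" using pos s by simp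
    have fs: "f (v s) > 0" by (rule admissible_pos[OF vs])
    have dv: "(v has_real_derivative s * g s) (at s)" using p s by (auto simp: radial_profile_def)
    have dF: "((\<lambda>s. tail_integral f (v s)) has_real_derivative - 1 / f (v s) * (s * g s)) (at s)"
      by (rule DERIV_chain2[OF tail_integral_deriv[OF vs] dv])
    define y where "y = s * (- g s / f (v s) - 1 / n)"
    have "((\<lambda>s. tail_integral f (v s) - s\<^sup>2 / (2 * real n)) has_real_derivative y) (at s)"
    proof -
      have "((\<lambda>s. s\<^sup>2 / (2 * real n)) has_real_derivative s / n) (at s)" using n by (auto intro!: derivative_eq_intros)
      from DERIV_diff[OF dF this] show ?thesis by (rule DERIV_cong) (simp add: y_def algebra_simps)
    qed
    moreover have "f (v s) / n \<le> - g s" by (rule positive_profile_slope[OF p n, where R=r]) (use pos s in auto)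
    then have "1 / n \<le> - g s / f (v s)" using fs n by (simp add: field_simps)
    then have "y \<ge> 0" using s by (simp add: y_def)
    ultimately show "\<exists>y. ((\<lambda>s. tail_integral f (v s) - s\<^sup>2 / (2 * real n)) has_real_derivative y) (at s) \<and> 0 \<le> y" by blast
  qed (use r Fvc n in \<open>auto intro!: continuous_intros\<close>)
  moreover have "tail_integral f (v 0) \<ge> 0" by (rule tail_integral_nonneg) (use pos in auto)
  ultimately show ?thesis by simp
qed

text \<open>The logarithmic derivative of f F^q is (f'F - q) / (f F). For large arguments this
  bounds f (v) by a multiple of F (v)^(-q), with the multiple determined by the central
  value.\<close>

lemma tail_integral_powr_mono:
  assumes q: "\<And>s. s \<ge> M \<Longrightarrow> q \<le> deriv f s * tail_integral f s" and "0 < M" "M \<le> a" "a \<le> b"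
  shows "f a * tail_integral f a powr q \<le> f b * tail_integral f b powr q"
proof (rule DERIV_nonneg_imp_nondecreasing[OF \<open>a \<le> b\<close>])
  fix s assume s: "a \<le> s" "s \<le> b"
  then have s0: "s > 0" "s \<ge> M" using assms by auto
  have F: "tail_integral f s > 0" by (rule tail_integral_pos[OF s0(1)])
  have fs: "f s > 0" by (rule admissible_pos[OF s0(1)])
  define y where "y = tail_integral f s powr (q - 1) * (deriv f s * tail_integral f s - q)"
  have "((\<lambda>s. f s * tail_integral f s powr q) has_real_derivative y) (at s)"
    by (rule DERIV_cong[OF DERIV_mult[OF admissible_deriv DERIV_chain2[OF has_real_derivative_powr[OF F] tail_integral_deriv[OF s0(1)]]]])
      (use F fs in \<open>simp add: y_def powr_diff field_simps\<close>)
  moreover have "y \<ge> 0" using q[OF s0(2)] by (simp add: y_def)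
  ultimately show "\<exists>y. ((\<lambda>s. f s * tail_integral f s powr q) has_real_derivative y) (at s) \<and> 0 \<le> y" by blast
qed

text \<open>As F (v) \<ge> s^2 / (2 n), monotonicity of f F^q turns into f (v) \<le> H (2 n)^q
  s^(-2q); this is inserted into (s^n g)' = - s^(n-1) f (v) and integrated. 2 q < n makes the
  right-hand side integrable at 0.\<close>

lemma positive_profile_slope_decay:
  assumes p: "radial_profile (real n) f v g" and n: "n > 0"
    and pos: "\<And>s. 0 \<le> s \<Longrightarrow> v s > 0"
    and q: "\<And>s. s \<ge> M \<Longrightarrow> q \<le> deriv f s * tail_integral f s" "0 < q" "2 * q < n"
    and M: "0 < M" "\<And>s. 0 \<le> s \<Longrightarrow> s \<le> r \<Longrightarrow> M \<le> v s" and r: "0 < r"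
  shows "- g r \<le> (2 * real n) powr q / (n - 2 * q) * (f (v 0) * tail_integral f (v 0) powr q) * r powr (- 2 * q)"
proof -
  define H where "H = f (v 0) * tail_integral f (v 0) powr q"
  define C where "C = (2 * real n) powr q / (n - 2 * q)"
  have gc: "continuous_on {0..r} g" using p by (auto simp: radial_profile_def intro: continuous_on_subset)
  have "C * H * 0 powr (n - 2 * q) + 0 ^ n * g 0 \<le> C * H * r powr (n - 2 * q) + r ^ n * g r"
  proof (rule DERIV_nonneg_imp_increasing_open[where f="\<lambda>s. C * H * s powr (n - 2 * q) + s ^ n * g s"])
    show "continuous_on {0..r} (\<lambda>s. C * H * s powr (n - 2 * q) + s ^ n * g s)"
      using q by (intro continuous_intros continuous_on_powr' gc) auto
    fix s assume s: "0 < s" "s < r"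
    have vs: "v s > 0" using pos s by simp
    have fs: "f (v s) > 0" by (rule admissible_pos[OF vs])
    have dg: "(g has_real_derivative - (n * g s + f (v s)) / s) (at s)"
      using p s by (auto simp: radial_profile_def)
    have sn: "s ^ n = s * s ^ (n - 1)" using n by (simp add: power_eq_if)
    have "((\<lambda>s. s ^ n * g s) has_real_derivative - f (v s) * s ^ (n - 1)) (at s)"
      by (intro DERIV_mult[OF DERIV_pow dg, THEN DERIV_cong]) (use s n sn in \<open>auto simp: field_simps\<close>)
    from DERIV_add[OF DERIV_cmult[OF has_real_derivative_powr[OF s(1)], of "C * H"] this]
    have "((\<lambda>s. C * H * s powr (n - 2 * q) + s ^ n * g s) has_real_derivative
        C * H * ((n - 2 * q) * s powr (n - 2 * q - 1)) + - f (v s) * s ^ (n - 1)) (at s)" .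
    moreover have "C * H * ((n - 2 * q) * s powr (n - 2 * q - 1)) + - f (v s) * s ^ (n - 1) \<ge> 0"
    proof -
      have F: "s\<^sup>2 / (2 * real n) \<le> tail_integral f (v s)" by (rule positive_profile_tail_integral_ge[OF p n pos]) (use s in auto)
      have "v s \<le> v 0"
        by (rule positive_profile_antimono[OF p n, where R="r"])
           (use pos s admissible_pos in \<open>auto intro: less_imp_le\<close>)
      then have "f (v s) * tail_integral f (v s) powr q \<le> H"
        unfolding H_def using s by (intro tail_integral_powr_mono[of M] q M) auto
      moreover have "f (v s) * (s\<^sup>2 / (2 * real n)) powr q \<le> f (v s) * tail_integral f (v s) powr q"
        using F s n q fs by (intro mult_left_mono powr_mono2) auto
      moreover have "(s\<^sup>2 / (2 * real n)) powr q = s powr (2 * q) / (2 * real n) powr q"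
      proof -
        have "(s\<^sup>2) powr q = s powr (2 * q)" using s by (simp add: powr_powr flip: powr_numeral)
        then show ?thesis using s n by (simp add: powr_divide)
      qed
      ultimately have "f (v s) * (s powr (2 * q) / (2 * real n) powr q) \<le> H" by simp
      then have "f (v s) * s powr (2 * q) \<le> H * (2 * real n) powr q"
        using n by (simp add: divide_le_eq)
      then have "f (v s) * s powr (2 * q) * s powr (n - 2 * q - 1) \<le> H * (2 * real n) powr q * s powr (n - 2 * q - 1)"
        by (intro mult_right_mono) auto
      moreover have "s powr (2 * q) * s powr (n - 2 * q - 1) = s ^ (n - 1)"
      proof -
        have "s powr (2 * q) * s powr (n - 2 * q - 1) = s powr real (n - 1)"
          using n by (simp add: of_nat_diff flip: powr_add)
        then show ?thesis using s by (simp add: powr_realpow)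
      qed
      ultimately have "f (v s) * s ^ (n - 1) \<le> H * (2 * real n) powr q * s powr (n - 2 * q - 1)"
        by (simp add: mult.assoc)
      moreover have "C * H * ((n - 2 * q) * s powr (n - 2 * q - 1)) = H * (2 * real n) powr q * s powr (n - 2 * q - 1)"
        using q by (simp add: C_def)
      ultimately show ?thesis by linarith
    qed
    ultimately show "\<exists>y. ((\<lambda>s. C * H * s powr (n - 2 * q) + s ^ n * g s) has_real_derivative y) (at s) \<and> 0 \<le> y" by blast
  qed (use r in auto)
  then have "0 \<le> C * H * r powr (n - 2 * q) + r ^ n * g r" unfolding zero_power[OF n] by simp
  moreover have "r powr (n - 2 * q) = r ^ n * r powr (- 2 * q)"
    using r by (simp add: powr_diff powr_realpow powr_minus_divide)
  ultimately have "0 \<le> r ^ n * (C * H * r powr (- 2 * q) + g r)" by (simp add: algebra_simps)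
  moreover have "r ^ n > 0" using r by simp
  ultimately have "0 \<le> C * H * r powr (- 2 * q) + g r" by (simp only: zero_le_mult_iff) auto
  then show ?thesis by (simp add: C_def H_def)
qed

text \<open>In units of F = F(\<alpha>) the core has squared radius e of order F and slope of order
  f(\<alpha>), while the slope at a fixed radius is at most C f(\<alpha>) F^q. The slope inequality
  becomes const \<le> F^(2q - P) with P = 2 \<open>q_JL\<close>, absurd for 2 q > P as F tends to
  0.\<close>

lemma exists_unstable:
  assumes N: "CARD('n) \<ge> 11"
    and lim: "((\<lambda>s. deriv f s * tail_integral f s) \<longlongrightarrow> qinf) at_top" "q_JL CARD('n) < qinf"
    and p: "\<And>\<alpha>. \<alpha> > 0 \<Longrightarrow> radial_profile (real CARD('n)) f (v \<alpha>) (g \<alpha>)"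
    and init: "\<And>\<alpha>. \<alpha> > 0 \<Longrightarrow> v \<alpha> 0 = \<alpha>"
  shows "\<exists>\<alpha>>0. \<not> stable_solution f (\<lambda>x::real^'n::finite. v \<alpha> (norm x))"
proof (rule ccontr)
  assume "\<not> ?thesis"
  then have stable: "stable_solution f (\<lambda>x::real^'n. v \<alpha> (norm x))" if "\<alpha> > 0" for \<alpha> using that by blast
  define N where "N = real CARD('n)"
  have n0: "CARD('n) > 0" by simp
  have N11: "N \<ge> 11" using N by (simp add: N_def)
  define a where "a = sqrt (N - 1)"
  have a: "a > 1" "a\<^sup>2 = N - 1" using N11 by (auto simp: a_def)
  define P where "P = N / 2 - a"
  have JL: "q_JL CARD('n) = P / 2" by (simp add: q_JL_def P_def a_def N_def field_simps)
  have "2 * a < N"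
  proof -
    have "0 < (a - 1)\<^sup>2" using a by simp
    then show ?thesis using a(2) by (simp add: power2_eq_square algebra_simps)
  qed
  then have P: "P > 0" "P < N" using a by (auto simp: P_def)
  \<comment> \<open>Midpoint between \<open>q_JL\<close> = P / 2 and qinf, the latter capped at N /
    2 to ensure 2 q < N for the decay estimate.\<close>
  define q where "q = (P / 2 + min qinf (N / 2)) / 2"
  have q: "P / 2 < q" "q < qinf" "2 * q < N" "0 < q"
    using lim(2) P unfolding JL q_def by (auto simp: min_def)
  have "\<forall>\<^sub>F s in at_top. q < deriv f s * tail_integral f s \<and> deriv f s * tail_integral f s < qinf + 1 \<and> s > 0"
    using order_tendstoD(1)[OF lim(1) q(2)] order_tendstoD(2)[OF lim(1), of "qinf + 1"] eventually_gt_at_top[of 0]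
    by (simp add: eventually_conj_iff)
  then obtain M where M: "\<And>s. s \<ge> M \<Longrightarrow> q < deriv f s * tail_integral f s \<and> deriv f s * tail_integral f s < qinf + 1 \<and> s > 0"
    unfolding eventually_at_top_linorder by blast
  have M0: "M > 0" using M[of M] by simp
  \<comment> \<open>Under the assumption to be refuted, the solution starting at \<alpha> + 1 is
    stable and serves as upper barrier.\<close>
  have pos: "v \<alpha> r > 0" if "\<alpha> > 0" "r \<ge> 0" for \<alpha> r
    using stable_solution_ordered[OF p[of "\<alpha> + 1"] p[of \<alpha>] stable[of "\<alpha> + 1"]] that init by simp
  obtain R0 where R0: "R0 > 0" "\<And>r. 0 \<le> r \<Longrightarrow> r \<le> R0 \<Longrightarrow> M \<le> v (M + 1) r"
  proof -
    have "continuous_on {0..} (v (M + 1))" using p[of "M + 1"] M0 by (simp add: radial_profile_def)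
    then have "(v (M + 1) \<longlongrightarrow> M + 1) (at 0 within {0..})"
      using init[of "M + 1"] M0 by (auto simp: continuous_on_def dest!: bspec[of _ _ 0])
    then have "\<forall>\<^sub>F r in at 0 within {0..}. M < v (M + 1) r" by (rule order_tendstoD) simp
    then obtain d where d: "d > 0" "\<And>r. 0 < r \<Longrightarrow> r < d \<Longrightarrow> M < v (M + 1) r"
      by (auto simp: eventually_at dist_real_def)
    show thesis
    proof (rule that[of "d / 2"])
      fix r assume "0 \<le> r" "r \<le> d / 2"
      then show "M \<le> v (M + 1) r" using d(2)[of r] d(1) init[of "M + 1"] M0 by (cases "r = 0") auto
    qed (use d in auto)
  qed
  have Mv: "M \<le> v \<alpha> r" if "\<alpha> > M + 1" "0 \<le> r" "r \<le> R0" for \<alpha> r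
    using stable_solution_ordered[OF p[of \<alpha>] p[of "M + 1"] stable[of \<alpha>], of r] R0(2)[of r] that init M0 by simp
  \<comment> \<open>The cut-off region S \<le> r^2 \<le> 2 S then ends exactly at R0, up to which
    all large solutions stay above M.\<close>
  define S where "S = R0\<^sup>2 / 2"
  have S: "S > 0" using R0 by (simp add: S_def)
  define F where "F = tail_integral f"
  have F: "F \<alpha> > 0" if "\<alpha> > 0" for \<alpha> unfolding F_def by (rule tail_integral_pos[OF that])
  define c1 where "c1 = (N - 2) / 16 * 2 powr (- (a + 1))"
  have c1: "c1 > 0" using N11 by (simp add: c1_def)
  define c2 where "c2 = 2 * S * (S powr (- ((a + 1) / 2)))\<^sup>2 * (18 + a)\<^sup>2 * (sqrt (2 * S)) ^ CARD('n)"
  have c2: "c2 \<ge> 0" using S by (simp add: c2_def)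
  define C where "C = (2 * N) powr q / (N - 2 * q) * (sqrt S) powr (- 2 * q)"
  have C: "C \<ge> 0" using q by (simp add: C_def)
  \<comment> \<open>f'F < qinf + 1 at \<alpha> gives e \<ge> \<theta> F(\<alpha>), so the core is
    not too small compared with F(\<alpha>).\<close>
  define \<theta> where "\<theta> = N / (qinf + 1)"
  have \<theta>: "\<theta> > 0" using q N11 by (simp add: \<theta>_def)
  have key: "c1 / (4 * N\<^sup>2) * \<theta> powr P \<le> c2 * C\<^sup>2 * F \<alpha> powr (2 * q - P)"
    if \<alpha>: "\<alpha> > M + 1" and F\<alpha>: "N / q * F \<alpha> \<le> S" for \<alpha>
  proof -
    have \<alpha>0: "\<alpha> > 0" and \<alpha>M: "\<alpha> \<ge> M" using \<alpha> M0 by auto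
    have f0: "f \<alpha> > 0" and d0: "deriv f \<alpha> > 0" using admissible_pos[OF \<alpha>0] admissible_deriv_pos[OF \<alpha>0] by auto
    note F0 = F[OF \<alpha>0]
    define e where "e = N / deriv f \<alpha>"
    have e: "e > 0" using d0 N11 by (simp add: e_def)
    have dF: "q < deriv f \<alpha> * F \<alpha>" "deriv f \<alpha> * F \<alpha> < qinf + 1" using M[OF \<alpha>M] by (auto simp: F_def)
    have eF: "e = N / (deriv f \<alpha> * F \<alpha>) * F \<alpha>" using F0 by (simp add: e_def)
    have "e \<le> N / q * F \<alpha>" unfolding eF using dF q N11 F0 by (intro mult_right_mono divide_left_mono) auto
    then have eS: "e \<le> S" using F\<alpha> by simp
    have "\<theta> * F \<alpha> \<le> e" unfolding eF \<theta>_def using dF q N11 F0 by (intro mult_right_mono divide_left_mono) auto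
    then have e_ge: "(\<theta> * F \<alpha>) powr P \<le> e powr P" using \<theta> F0 P by (intro powr_mono2) auto
    define \<gamma> where "\<gamma> = f \<alpha> / (2 * N)"
    define G where "G = C * (f \<alpha> * F \<alpha> powr q)"
    have "c1 * \<gamma>\<^sup>2 * e powr P \<le> c2 * G\<^sup>2"
      unfolding c1_def c2_def P_def a_def N_def
    proof (rule stable_slope_inequality[OF p[OF \<alpha>0] _ stable[OF \<alpha>0] e eS])
      show "\<gamma> \<ge> 0" using f0 N11 by (simp add: \<gamma>_def)
      fix r :: real assume r: "0 \<le> r"
      show "\<gamma> \<le> - g \<alpha> r" if "r\<^sup>2 \<le> e"
        using positive_profile_slope_ge_center[OF p[OF \<alpha>0] n0 pos[OF \<alpha>0] r] that init[OF \<alpha>0]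
        by (simp add: \<gamma>_def e_def N_def)
      show "\<bar>g \<alpha> r\<bar> \<le> G" if "S \<le> r\<^sup>2" "r\<^sup>2 \<le> 2 * S"
      proof -
        have r0: "r > 0" using that S r by (cases "r = 0") auto
        have "r\<^sup>2 \<le> R0\<^sup>2" using that by (simp add: S_def)
        from power2_le_imp_le[OF this] have "r \<le> R0" using R0(1) by simp
        then have "- g \<alpha> r \<le> (2 * real CARD('n)) powr q / (real CARD('n) - 2 * q) * (f (v \<alpha> 0) * tail_integral f (v \<alpha> 0) powr q) * r powr (- 2 * q)"
          using M q(3,4) M0 Mv[OF \<alpha>] r0
          by (intro positive_profile_slope_decay[OF p[OF \<alpha>0] n0 pos[OF \<alpha>0], of M]) (auto simp: N_def less_imp_le)
        also have "\<dots> = (2 * N) powr q / (N - 2 * q) * (f \<alpha> * F \<alpha> powr q) * r powr (- 2 * q)"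
          using init[OF \<alpha>0] by (simp add: N_def F_def)
        also have "\<dots> \<le> (2 * N) powr q / (N - 2 * q) * (f \<alpha> * F \<alpha> powr q) * (sqrt S) powr (- 2 * q)"
        proof (rule mult_left_mono)
          show "r powr (- 2 * q) \<le> (sqrt S) powr (- 2 * q)"
            using that(1) r S q by (intro powr_mono2') (auto intro: real_le_lsqrt)
        qed (use q f0 in auto)
        also have "\<dots> = G" by (simp add: G_def C_def)
        finally have "- g \<alpha> r \<le> G" .
        moreover have "0 \<le> - g \<alpha> r"
          using positive_profile_nonpos[OF p[OF \<alpha>0] n0, of "r + 1" r] pos[OF \<alpha>0] r admissible_pos
          by (simp add: less_imp_le)
        ultimately show ?thesis by simp
      qed
    qed (use N in auto)
    then have "c1 * \<gamma>\<^sup>2 * (\<theta> * F \<alpha>) powr P \<le> c2 * G\<^sup>2"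
      using e_ge c1 by (meson mult_left_mono order_trans less_imp_le mult_nonneg_nonneg zero_le_power2)
    moreover have "(\<theta> * F \<alpha>) powr P = \<theta> powr P * F \<alpha> powr P" using \<theta> F0 by (simp add: powr_mult)
    moreover have "G\<^sup>2 = C\<^sup>2 * (f \<alpha>)\<^sup>2 * (F \<alpha> powr (2 * q - P) * F \<alpha> powr P)"
    proof -
      have "F \<alpha> powr (2 * q - P) * F \<alpha> powr P = F \<alpha> powr q * F \<alpha> powr q" by (simp flip: powr_add)
      then show ?thesis by (simp add: G_def power2_eq_square)
    qed
    moreover have "\<gamma>\<^sup>2 = (f \<alpha>)\<^sup>2 * (1 / (4 * N\<^sup>2))" by (simp add: \<gamma>_def power_divide power_mult_distrib)
    ultimately have "(c1 / (4 * N\<^sup>2) * \<theta> powr P) * ((f \<alpha>)\<^sup>2 * F \<alpha> powr P) \<le> (c2 * C\<^sup>2 * F \<alpha> powr (2 * q - P)) * ((f \<alpha>)\<^sup>2 * F \<alpha> powr P)"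
      by (simp add: mult_ac)
    moreover have "(f \<alpha>)\<^sup>2 * F \<alpha> powr P > 0" using f0 F0 by simp
    ultimately show ?thesis by (simp only: mult_le_cancel_right_pos)
  qed
  have F_lim: "(F \<longlongrightarrow> 0) at_top" unfolding F_def by (rule tail_integral_tendsto_0)
  have "((\<lambda>\<alpha>. F \<alpha> powr (2 * q - P)) \<longlongrightarrow> 0 powr (2 * q - P)) at_top"
  proof (rule tendsto_powr'[OF F_lim tendsto_const])
    have "\<forall>\<^sub>F x in at_top. 0 \<le> F x"
      using eventually_gt_at_top[of 0] by eventually_elim (use F in \<open>auto intro: less_imp_le\<close>)
    then show "(0::real) \<noteq> 0 \<or> 0 < 2 * q - P \<and> (\<forall>\<^sub>F x in at_top. 0 \<le> F x)"
      using q(1) by simp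
  qed
  then have "((\<lambda>\<alpha>. c2 * C\<^sup>2 * F \<alpha> powr (2 * q - P)) \<longlongrightarrow> c2 * C\<^sup>2 * 0) at_top"
    by (intro tendsto_intros) simp
  moreover have "c1 / (4 * N\<^sup>2) * \<theta> powr P > c2 * C\<^sup>2 * 0" using c1 \<theta> N11 by simp
  ultimately have ev1: "\<forall>\<^sub>F \<alpha> in at_top. c2 * C\<^sup>2 * F \<alpha> powr (2 * q - P) < c1 / (4 * N\<^sup>2) * \<theta> powr P"
    by (rule order_tendstoD(2))
  have "((\<lambda>\<alpha>. N / q * F \<alpha>) \<longlongrightarrow> N / q * 0) at_top" by (intro tendsto_intros F_lim)
  then have ev2: "\<forall>\<^sub>F \<alpha> in at_top. N / q * F \<alpha> < S" by (rule order_tendstoD(2)) (use S in simp)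
  have "\<forall>\<^sub>F \<alpha> in at_top. c2 * C\<^sup>2 * F \<alpha> powr (2 * q - P) < c1 / (4 * N\<^sup>2) * \<theta> powr P \<and> N / q * F \<alpha> < S \<and> M + 1 < \<alpha>"
    using ev1 ev2 eventually_gt_at_top[of "M + 1"] by eventually_elim auto
  then obtain \<alpha> where "c2 * C\<^sup>2 * F \<alpha> powr (2 * q - P) < c1 / (4 * N\<^sup>2) * \<theta> powr P" "N / q * F \<alpha> < S" "M + 1 < \<alpha>"
    using eventually_happens'[OF trivial_limit_at_top_linorder] by blast
  with key[of \<alpha>] show False by linarith
qed

end

section \<open>The threshold as supremum of the stable parameters\<close>

theorem corollary1p7:
  fixes f :: "real \<Rightarrow> real"
    and u :: "real \<Rightarrow> real \<Rightarrow> real"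
    and q0 qinf :: real
  assumes "CARD('n::finite) \<ge> 11"
    and "admissible f"
    and "((\<lambda>s. deriv f s * tail_integral f s) \<longlongrightarrow> q0) (at_right 0)"
    and "((\<lambda>s. deriv f s * tail_integral f s) \<longlongrightarrow> qinf) at_top"
    and "1 < q0" and "q0 < q_JL CARD('n)" and "q_JL CARD('n) < qinf"
    and "\<And>\<alpha>. \<alpha> > 0 \<Longrightarrow> radial_solution CARD('n) f \<alpha> (\<lambda>r. u r \<alpha>)"
  shows "\<exists>\<alpha>s>0.
           (\<forall>\<alpha>\<in>{0<..\<alpha>s}. stable_solution f (\<lambda>x::real^'n. u (norm x) \<alpha>)) \<and>
           (\<forall>\<alpha>>\<alpha>s. unstable_solution f (\<lambda>x::real^'n. u (norm x) \<alpha>)) \<and>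
           (\<forall>r>0. strict_mono_on {0<..<\<alpha>s} (\<lambda>\<alpha>. u r \<alpha>))"
proof -
  note adm = assms(2)
  define N where "N = real CARD('n)"
  have N11: "N \<ge> 11" using assms(1) by (simp add: N_def)
  have "\<exists>g. radial_profile N f (\<lambda>r. u r \<alpha>) g" if "\<alpha> > 0" for \<alpha>
    unfolding N_def using radial_solution_profile[OF assms(8)[OF that] _ admissible_continuous[OF adm]] by auto
  then obtain g where p: "\<And>\<alpha>. \<alpha> > 0 \<Longrightarrow> radial_profile (real CARD('n)) f (\<lambda>r. u r \<alpha>) (g \<alpha>)"
    unfolding N_def by metis
  have init: "u 0 \<alpha> = \<alpha>" if "\<alpha> > 0" for \<alpha> using assms(8)[OF that] by (simp add: radial_solution_def)
  define st where "st = (\<lambda>\<alpha>. stable_solution f (\<lambda>x::real^'n. u (norm x) \<alpha>))"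
  have down: "st \<alpha>" if "0 < \<alpha>" "\<alpha> < \<beta>" "st \<beta>" for \<alpha> \<beta>
    using stable_solution_below[OF adm p[of \<beta>] p[of \<alpha>]] that init by (simp add: st_def)
  obtain \<alpha>0 where \<alpha>0: "\<alpha>0 > 0" "st \<alpha>0"
  proof -
    define a where "a = sqrt (N - 1)"
    have a2: "a\<^sup>2 = N - 1" and a3: "a > 3" using N11 by (auto simp: a_def real_less_rsqrt)
    have q0: "4 * q0 < N - 2 * a" using assms(6) by (simp add: q_JL_def a_def N_def)
    \<comment> \<open>The source of \<open>q_JL\<close>: the gap to the Hardy constant is a
      quadratic in q with smaller root (N - 2 a) / 4.\<close>
    have fac: "(N - 2)\<^sup>2 / 4 - q * (2 * N - 4 * q) = (N - 2 * a - 4 * q) * (N + 2 * a - 4 * q) / 4" for q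
      using a2 by (simp add: power2_eq_square field_simps)
    have "(N - 2 * a - 4 * q0) * (N + 2 * a - 4 * q0) / 4 > 0" using q0 a3 by simp
    then have "q0 * (2 * N - 4 * q0) < (N - 2)\<^sup>2 / 4" using fac[of q0] by simp
    \<comment> \<open>Near 0 the product f'F is known only up to d, so the lower exponent enters
      through c and the upper one through f'; the strict inequality at d = 0 survives for small
      d.\<close>
    moreover have "((\<lambda>d. (q0 + d) * (2 * N - 4 * (q0 - d))) \<longlongrightarrow> (q0 + 0) * (2 * N - 4 * (q0 - 0))) (at_right 0)"
      by (intro tendsto_intros)
    ultimately have "\<forall>\<^sub>F d in at_right 0. (q0 + d) * (2 * N - 4 * (q0 - d)) < (N - 2)\<^sup>2 / 4"
      by (intro order_tendstoD(2)) auto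
    \<comment> \<open>Together with 1 < q0 this keeps the lowered exponent q0 - d positive.\<close>
    moreover have "\<forall>\<^sub>F d in at_right 0. d < (1::real)"
      unfolding eventually_at_right_field by (intro exI[of _ 1]) auto
    moreover have "\<forall>\<^sub>F d in at_right 0. d > (0::real)" by (rule eventually_at_right_less)
    ultimately have "\<forall>\<^sub>F d in at_right 0. (q0 + d) * (2 * N - 4 * (q0 - d)) < (N - 2)\<^sup>2 / 4 \<and> d < 1 \<and> 0 < d"
      by eventually_elim auto
    then obtain d where d: "(q0 + d) * (2 * N - 4 * (q0 - d)) < (N - 2)\<^sup>2 / 4" "0 < d" "d < 1"
      using eventually_happens'[OF trivial_limit_at_right_real] by blast
    have "\<forall>\<^sub>F s in at_right 0. \<bar>deriv f s * tail_integral f s - q0\<bar> < d"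
      using assms(3) d(2) by (auto simp: tendsto_iff dist_real_def)
    then obtain b where b: "b > 0" "\<And>s. 0 < s \<Longrightarrow> s < b \<Longrightarrow> \<bar>deriv f s * tail_integral f s - q0\<bar> < d"
      by (auto simp: eventually_at_right_field)
    have "stable_solution f (\<lambda>x::real^'n. u (norm x) (b / 2))"
    proof (rule stable_solution_small[OF adm p, where q="q0 - d" and q'="q0 + d"])
      \<comment> \<open>Expanded, the reality of the Euler exponents is the same quadratic
        inequality in q as nonnegativity of the Hardy gap.\<close>
      show "16 * (q0 - d) \<le> (real CARD('n) - 2 - 4 * (q0 - d))\<^sup>2"
      proof -
        have "(N - 2 * a - 4 * (q0 - d)) * (N + 2 * a - 4 * (q0 - d)) \<ge> 0" using q0 a3 d by simp
        then have "(q0 - d) * (2 * N - 4 * (q0 - d)) \<le> (N - 2)\<^sup>2 / 4" using fac[of "q0 - d"] by simp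
        then show ?thesis unfolding N_def[symmetric] by (simp add: power2_eq_square algebra_simps)
      qed
      fix s assume s: "0 < s" "s \<le> u 0 (b / 2)"
      then have "s < b" using init[of "b / 2"] b(1) by simp
      from b(2)[OF s(1) this]
      show "q0 - d \<le> deriv f s * tail_integral f s \<and> deriv f s * tail_integral f s \<le> q0 + d"
        by (auto simp: abs_less_iff)
    qed (use assms(1,5) d b q0 a3 init in \<open>auto simp: N_def\<close>)
    then show thesis using that[of "b / 2"] b by (simp add: st_def)
  qed
  obtain \<alpha>1 where \<alpha>1: "\<alpha>1 > 0" "\<not> st \<alpha>1"
    using exists_unstable[OF adm assms(1,4,7) p init] by (auto simp: st_def)
  define A where "A = {\<alpha>. 0 < \<alpha> \<and> st \<alpha>}"
  have ub: "\<alpha> \<le> \<alpha>1" if "\<alpha> \<in> A" for \<alpha>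
    using down[of \<alpha>1 \<alpha>] \<alpha>1 that by (force simp: A_def)
  have bdd: "bdd_above A" by (rule bdd_aboveI[OF ub])
  have A0: "\<alpha>0 \<in> A" using \<alpha>0 by (simp add: A_def)
  define \<alpha>s where "\<alpha>s = Sup A"
  have s0: "\<alpha>s > 0" using cSup_upper[OF A0 bdd] \<alpha>0 by (simp add: \<alpha>s_def)
  have below: "st \<alpha>" if \<alpha>: "0 < \<alpha>" "\<alpha> < \<alpha>s" for \<alpha>
  proof -
    obtain \<beta> where "\<beta> \<in> A" "\<alpha> < \<beta>"
      using \<alpha>(2) less_cSup_iff[OF _ bdd, of \<alpha>] A0 by (auto simp: \<alpha>s_def)
    then show ?thesis using down \<alpha> by (auto simp: A_def)
  qed
  have "st \<alpha>s"
    unfolding st_def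
    by (rule stable_solution_limit[OF adm p[OF s0], where v="\<lambda>\<alpha> r. u r \<alpha>" and g=g])
      (use s0 init p below in \<open>auto simp: st_def\<close>)
  then have 1: "\<forall>\<alpha>\<in>{0<..\<alpha>s}. stable_solution f (\<lambda>x::real^'n. u (norm x) \<alpha>)"
    using below by (force simp: st_def)
  have 2: "unstable_solution f (\<lambda>x::real^'n. u (norm x) \<alpha>)" if "\<alpha> > \<alpha>s" for \<alpha>
  proof -
    have "\<alpha> \<notin> A" using cSup_upper[OF _ bdd] that by (force simp: \<alpha>s_def)
    then show ?thesis
      using radial_profile_classical_solution[OF p admissible_continuous[OF adm]] that s0
      by (auto simp: unstable_solution_def A_def st_def)
  qed
  have 3: "strict_mono_on {0<..<\<alpha>s} (\<lambda>\<alpha>. u r \<alpha>)" if "r > 0" for r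
  proof (rule strict_mono_onI)
    fix \<alpha> \<beta> assume ab: "\<alpha> \<in> {0<..<\<alpha>s}" "\<beta> \<in> {0<..<\<alpha>s}" "\<alpha> < \<beta>"
    then show "u r \<alpha> < u r \<beta>"
      using stable_solution_ordered[OF adm p[of \<beta>] p[of \<alpha>], of r] below[of \<beta>] init[of \<alpha>] init[of \<beta>] that
      by (simp add: st_def)
  qed
  show ?thesis using s0 1 2 3 by blast
qed

end
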